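(* Let $h$ be a real-valued function on $[0,+\infty)$ satisfying the following two conditions. (1) $h\in M_2$, $0<h(+0)\le1$ and $h(+\infty)=0$. (2) For some $\rho\ge1$, real $\gamma\le\gamma_1(\rho,h)$, $\alpha>0$ and $\delta>0$ the series $\sum_{k\in\mathbb{Z}}(1+|k|^\alpha\delta\gamma)h(|k|^\alpha\delta)e^{ikt}$ is the Fourier series of some function $g_{\alpha,\delta,\gamma}\in L_1$. Let $G_{\alpha,\delta,\gamma}$ be the operator $G_{\alpha,\delta,\gamma}(f)(x)=\frac1{2\pi}\int_{-\pi}^{\pi}f(x-t)g_{\alpha,\delta,\gamma}(t)\,dt$, and let $p=1$ or $p=\infty$. Then: 1. If $\beta$ is an odd integer and one of the two conditions (i) $n\in\mathbb{N}$, $\alpha\in(0,1]$, $r\ge\alpha\rho$, or (ii) $n=1$, $\alpha>1$, $r\ge\alpha\rho+1$ holds, then $$E(\mathbf{W}^{r,\beta}_{p,n};G_{\alpha,\delta,\gamma})_p=\frac{4}{\pi n^r}\sum_{k=0}^{\infty}\frac{1-(1+(2k+1)^\alpha n^\alpha\delta\gamma)\,h((2k+1)^\alpha n^\alpha\delta)}{(2k+1)^{r+1}} .$$ 2. If $\beta$ is an even integer and one of the two conditions (i) $n=1$, $\alpha\in(0,1]$, $r\ge\alpha\rho+1$, or (ii) $n=1$, $\alpha>1$, $r\ge\alpha\rho+2$ holds, then $$E(\mathbf{W}^{r,\beta}_{p,n};G_{\alpha,\delta,\gamma})_p=\frac{4}{\pi n^r}\sum_{k=0}^{\infty}\frac{1-(1+(2k+1)^\alpha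 n^\alpha\delta\gamma)\,h((2k+1)^\alpha n^\alpha\delta)}{(2k+1)^{r+1}}(-1)^k .\qquad( * )$$ If in addition $h\in M_3$, $\gamma\le\gamma_2(\rho,h)$ and $\alpha\in(0,1]$, then (still for $\beta$ even) equality $( * )$ holds for all $n\in\mathbb{N}$ and $r\ge\alpha\rho$.
   Context: $\mathbb{N}=\{1,2,\dots\}$. $L_p$, $1\le p\le\infty$, is the space of $2\pi$-periodic real-valued measurable functions with finite norm $\|f\|_p=(\int_{-\pi}^{\pi}|f(t)|^p\,dt)^{1/p}$ for $p<\infty$ and $\|f\|_\infty=\operatorname{ess\,sup}_{[-\pi,\pi]}|f|$. Fourier coefficients: $\widehat{\varphi}(k)=\frac1{2\pi}\int_{-\pi}^{\pi}\varphi(t)e^{-ikt}\,dt$; the Fourier series of $\varphi$ is $\sum_{k\in\mathbb{Z}}\widehat\varphi(k)e^{ikt}$. For $n\in\mathbb{N}$, $H_p^n=\{\varphi\in L_p:\|\varphi\|_p\le1,\ \widehat\varphi(k)=0\text{ for all }k\in\mathbb{Z},\ |k|\le n-1\}$. For $r>0$ and $\beta\in\mathbb{R}$ put $$\psi_{r,\beta}(t)=\sum_{k\ne0}\frac{e^{-i\beta\pi\operatorname{sign}(k)/2}}{|k|^r}e^{ikt}=\sum_{k=1}^\infty\frac{2\cos(kt-\beta\pi/2)}{k^r};$$ this function belongs to $L_1$ and the series is its Fourier series. $\mathbf{W}^{r,\beta}_{p,n}$ is the class of all functions $f(x)=\frac1{2\pi}\int_{-\pi}^{\pi}\varphi(x-t)\psi_{r,\beta}(t)\,dt$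 with $\varphi\in H_p^n$. For an operator $G$, $E(\mathbf{W}^{r,\beta}_{p,n};G)_p=\sup\{\|f-G(f)\|_p: f\in\mathbf{W}^{r,\beta}_{p,n}\}$. For $m\in\mathbb{N}$, $M_m$ is the class of functions $h\in C^{m-1}(0,+\infty)$ for which $(-1)^{m-1}h^{(m-1)}$ is nonnegative, decreasing (non-increasing) and convex on $(0,+\infty)$ and the finite limit $h(+\infty)=\lim_{x\to+\infty}h(x)\ge0$ exists. $h(+0)=\lim_{x\to0+}h(x)$. For $m\in\mathbb{N}$, $h\in M_{m+1}$ with $0<h(+0)\le1$, $h(+\infty)=0$, and $\rho\ge1$, $\gamma_m(\rho,h)$ is the supremum of those $\gamma\in\mathbb{R}$ for which $\lambda_{\rho,\gamma}\in M_m$, where $$\lambda_{\rho,\gamma}(x)=\frac{1-(1+\gamma x)h(x)}{x^\rho},\quad x>0 .$$ *)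

theory Defs
  imports "HOL-Analysis.Analysis" "HOL-Probability.Essential_Supremum"
begin

(* The spaces L_p, 1 <= p <= \<infinity>, of 2pi-periodic Lebesgue measurable functions. The norm
   takes values in ereal, so that it is infinite, not 0, on measurable functions outside L_p. *)

definition Lp_norm :: "ereal \<Rightarrow> (real \<Rightarrow> real) \<Rightarrow> ereal" where
  "Lp_norm p f =
    (if p = \<infinity> then esssup (lebesgue_on {-pi..pi}) (\<lambda>t. ereal \<bar>f t\<bar>)
     else let I = (\<integral>\<^sup>+ t. ennreal (\<bar>f t\<bar> powr real_of_ereal p) \<partial>lebesgue_on {-pi..pi})
       in if I = \<infinity> then \<infinity> else ereal (enn2real I powr (1 / real_of_ereal p)))"

definition Lp_space :: "ereal \<Rightarrow> (real \<Rightarrow> real) set" where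
  "Lp_space p = {f. f \<in> borel_measurable lebesgue \<and> (\<forall>t. f (t + 2 * pi) = f t) \<and> Lp_norm p f < \<infinity>}"

definition fourier_coeff :: "(real \<Rightarrow> real) \<Rightarrow> int \<Rightarrow> complex" where
  "fourier_coeff \<phi> k =
    (1 / (2 * pi)) *\<^sub>R (LINT t:{-pi..pi}|lebesgue. complex_of_real (\<phi> t) * exp (- \<i> * of_int k * of_real t))"

definition is_fourier_series_of :: "(int \<Rightarrow> complex) \<Rightarrow> (real \<Rightarrow> real) \<Rightarrow> bool" where
  "is_fourier_series_of c g \<longleftrightarrow> (\<forall>k. fourier_coeff g k = c k)"

definition H_class :: "ereal \<Rightarrow> nat \<Rightarrow> (real \<Rightarrow> real) set" where
  "H_class p n = {\<phi> \<in> Lp_space p. Lp_norm p \<phi> \<le> 1 \<and> (\<forall>k::int. \<bar>k\<bar> \<le> int n - 1 \<longrightarrow> fourier_coeff \<phi> k = 0)}"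

(* For integrable f and g the integral exists for almost every x; the default value 0 on the
   exceptional null set does not affect any L_p norm. *)
definition convol :: "(real \<Rightarrow> real) \<Rightarrow> (real \<Rightarrow> real) \<Rightarrow> real \<Rightarrow> real" where
  "convol f g x = 1 / (2 * pi) * (LINT t:{-pi..pi}|lebesgue. f (x - t) * g t)"

(* For r > 0 the series converges (perhaps only conditionally) at every t outside 2 pi Z, hence
   almost everywhere; the values of psi on that null set play no role. *)
definition psi :: "real \<Rightarrow> real \<Rightarrow> real \<Rightarrow> real" where
  "psi r \<beta> t = (\<Sum>j. 2 * cos (real (Suc j) * t - \<beta> * pi / 2) / real (Suc j) powr r)"

definition W_class :: "ereal \<Rightarrow> nat \<Rightarrow> real \<Rightarrow> real \<Rightarrow> (real \<Rightarrow> real) set" where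
  "W_class p n r \<beta> = {convol \<phi> (psi r \<beta>) | \<phi>. \<phi> \<in> H_class p n}"

definition approx_error ::
    "ereal \<Rightarrow> (real \<Rightarrow> real) set \<Rightarrow> ((real \<Rightarrow> real) \<Rightarrow> real \<Rightarrow> real) \<Rightarrow> ereal" where
  "approx_error p W G = (SUP f\<in>W. Lp_norm p (\<lambda>x. f x - G f x))"

(* Only the values of h on the open half-line matter, since deriv is a local notion there.
   Intended for m >= 1. *)
definition M_class :: "nat \<Rightarrow> (real \<Rightarrow> real) set" where
  "M_class m = {h.
     (\<forall>k < m - 1. \<forall>x > 0. (deriv ^^ k) h differentiable (at x)) \<and>
     continuous_on {0<..} ((deriv ^^ (m - 1)) h) \<and>
     (\<forall>x > 0. 0 \<le> (-1) ^ (m - 1) * (deriv ^^ (m - 1)) h x) \<and>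
     antimono_on {0<..} (\<lambda>x. (-1) ^ (m - 1) * (deriv ^^ (m - 1)) h x) \<and>
     convex_on {0<..} (\<lambda>x. (-1) ^ (m - 1) * (deriv ^^ (m - 1)) h x) \<and>
     (\<exists>L \<ge> 0. (h \<longlongrightarrow> L) at_top)}"

definition lambda_fun :: "real \<Rightarrow> real \<Rightarrow> (real \<Rightarrow> real) \<Rightarrow> real \<Rightarrow> real" where
  "lambda_fun \<rho> \<gamma> h x = (1 - (1 + \<gamma> * x) * h x) / x powr \<rho>"

(* Supremum in ereal, so that no nonemptiness or boundedness of the set is presupposed. *)
definition gamma_sup :: "nat \<Rightarrow> real \<Rightarrow> (real \<Rightarrow> real) \<Rightarrow> ereal" where
  "gamma_sup m \<rho> h = Sup (ereal ` {\<gamma>. lambda_fun \<rho> \<gamma> h \<in> M_class m})"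

end

theory Submission
  imports Defs
begin

text \<open>
  By its Fourier coefficients, \<open>f - G(f)\<close> is the convolution of \<open>\<phi>\<close> with the kernel \<open>K\<close> whose
  cosine (\<open>\<beta>\<close> even) or sine (\<open>\<beta>\<close> odd) coefficients are
  \<open>\<mu>(k) = (1 - (1 + k\<^sup>\<alpha> \<delta> \<gamma>) h(k\<^sup>\<alpha> \<delta>)) / k\<^sup>r\<close>, so the error is the best \<open>L\<^sub>1\<close> approximation of
  \<open>K\<close> by trigonometric polynomials of degree less than \<open>n\<close>. Following Nagy, if \<open>\<mu>\<close> is convex and
  decreasing (and, for cosines, has nonnegative third differences), some polynomial \<open>T\<close> of low degree makes
  \<open>K - T\<close> equal to \<open>sin (n t)\<close> or \<open>cos (n t)\<close> times a nonnegative Fejer-type sum; then the \<open>L\<^sub>1\<close>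
  norm of \<open>K - T\<close> is the integral of \<open>K\<close> against the square wave \<open>sgn (sin (n t))\<close> or
  \<open>sgn (cos (n t))\<close>, which is the stated series. The square wave itself (for \<open>p = \<infinity>\<close>) and narrow
  alternating combs (for \<open>p = 1\<close>) show that the bound is attained in the limit. For \<open>n = 1\<close>
  weaker monotonicity suffices, by the Fejer-Jackson inequality.
\<close>

section \<open>Convolution of periodic functions\<close>

text \<open>The interpolating polynomial is built only for finite sums, so the coefficients are
  multiplied by a cutoff that keeps their shape, and the bound passes to the limit in
  \<open>L_1\<close>. For small \<open>r\<close> the series converges only conditionally, so a
  majorant common to all cutoffs must come from summation by parts. The shape is inherited from
  \<open>lambda_fun\<close>: \<open>\<mu>(k)\<close> is its value at
  \<open>\<delta> * k powr \<alpha>\<close> times \<open>k powr (\<alpha> * \<rho> - r)\<close> and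
  a constant. For \<open>\<alpha> \<le> 1\<close> the inner power is concave and convexity survives.
  For \<open>\<alpha> > 1\<close> only monotonicity does, and for sines \<open>k * \<mu>(k)\<close>
  must then decrease, which costs one unit of \<open>r\<close>. Cosines need one order of regularity
  more: for \<open>n = 1\<close> the kernel is differentiated, which costs another factor
  \<open>k\<close>; in general the interpolation coefficients become an alternating series, whose
  terms are controlled by third differences. All identities between functions are read off Fourier
  coefficients, hence the need for a uniqueness theorem in \<open>L_1\<close>, with equality almost
  everywhere.\<close>

abbreviation circle :: "real measure" where
  "circle \<equiv> lebesgue_on {-pi..pi}"

abbreviation fourier_exp :: "int \<Rightarrow> real \<Rightarrow> complex" where
  "fourier_exp k t \<equiv> exp (- \<i> * of_int k * complex_of_real t)"

lemma finite_measure_period: "finite_measure circle"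
  by (rule finite_measureI) (simp add: space_restrict_space emeasure_restrict_space)

lemma periodic_int:
  fixes f :: "real \<Rightarrow> 'a"
  assumes "\<And>t. f (t + 2 * pi) = f t"
  shows "f (t + 2 * pi * of_int m) = f t"
proof -
  have n: "f (t + 2 * pi * real k) = f t" for t and k :: nat
  proof (induction k)
    case (Suc k)
    have "f (t + 2 * pi * real (Suc k)) = f ((t + 2 * pi * real k) + 2 * pi)" by (simp add: algebra_simps)
    then show ?case using assms Suc by simp
  qed simp
  show ?thesis
  proof (cases "m \<ge> 0")
    case True then show ?thesis using n[of t "nat m"] by simp
  next
    case False then show ?thesis using n[of "t + 2 * pi * of_int m" "nat (-m)"] by simp
  qed
qed

text \<open>Modulo \<open>2 * pi\<close> the shift is some \<open>b\<close> in
  \<open>[0, 2 * pi)\<close>. The period is cut at \<open>-pi + b\<close>; the right piece moves by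
  \<open>b\<close>, the left one by \<open>b - 2 * pi\<close>, and together they tile the period
  again up to the point \<open>pi\<close>.\<close>

lemma has_bochner_integral_period_shift:
  fixes f :: "real \<Rightarrow> 'a::euclidean_space"
  assumes per: "\<And>t. f (t + 2 * pi) = f t" and int: "integrable circle f"
  shows "has_bochner_integral circle (\<lambda>t. f (t + a)) (integral\<^sup>L circle f)"
proof -
  define m where "m = \<lfloor>a / (2 * pi)\<rfloor>"
  define b where "b = a - 2 * pi * of_int m"
  have b: "0 \<le> b" "b < 2 * pi"
  proof -
    have "of_int m \<le> a / (2*pi)" "a / (2*pi) < of_int m + 1" unfolding m_def by linarith+
    then show "0 \<le> b" "b < 2 * pi" unfolding b_def by (simp_all add: field_simps)
  qed
  have fa: "f (t + a) = f (t + b)" for t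
    using periodic_int[of f "t + b" m, OF per] by (simp add: b_def algebra_simps)
  have int': "integrable lebesgue (\<lambda>t. indicator {-pi..pi} t *\<^sub>R f t)"
    using int by (simp add: integrable_restrict_space)
  define g where "g = (\<lambda>t. indicator {-pi..pi} t *\<^sub>R f t)"
  define g1 where "g1 = (\<lambda>t. indicator {-pi+b..<pi} t *\<^sub>R g t)"
  define g2 where "g2 = (\<lambda>t. indicator {-pi..<-pi+b} t *\<^sub>R g t)"
  have g1: "integrable lebesgue g1" unfolding g1_def g_def by (rule integrable_mult_indicator) (use int' in auto)
  have g2: "integrable lebesgue g2" unfolding g2_def g_def by (rule integrable_mult_indicator) (use int' in auto)
  have ne: "AE t in lebesgue. t \<noteq> pi"
    by (rule AE_I'[of "{pi}"]) auto
  have eq1: "AE t in lebesgue. g1 t + g2 t = g t"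
    using ne by eventually_elim (use b in \<open>auto simp: g1_def g2_def g_def indicator_def\<close>)
  have A1: "has_bochner_integral lebesgue (\<lambda>t. g1 (b + 1 * t)) (integral\<^sup>L lebesgue g1)"
    using has_bochner_integral_lebesgue_real_affine_iff[of 1 g1 "integral\<^sup>L lebesgue g1" b] g1
    by (simp add: has_bochner_integral_integrable)
  have A2: "has_bochner_integral lebesgue (\<lambda>t. g2 (b - 2*pi + 1 * t)) (integral\<^sup>L lebesgue g2)"
    using has_bochner_integral_lebesgue_real_affine_iff[of 1 g2 "integral\<^sup>L lebesgue g2" "b - 2*pi"] g2
    by (simp add: has_bochner_integral_integrable)
  have S: "integral\<^sup>L lebesgue g1 + integral\<^sup>L lebesgue g2 = integral\<^sup>L lebesgue g"
  proof -
    have "integral\<^sup>L lebesgue (\<lambda>t. g1 t + g2 t) = integral\<^sup>L lebesgue g"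
      by (rule integral_cong_AE) (use eq1 g1 g2 int' in \<open>auto simp: g_def\<close>)
    then show ?thesis using g1 g2 by simp
  qed
  have eq2: "AE t in lebesgue. g1 (b + 1 * t) + g2 (b - 2*pi + 1 * t) = indicator {-pi..pi} t *\<^sub>R f (t + a)"
    using ne
  proof eventually_elim
    case (elim t)
    have "f (b + t) = f (b - 2 * pi + t)" using per[of "b - 2*pi + t"] by (simp add: algebra_simps)
    moreover have "f (t + a) = f (b + t)" using fa[of t] by (simp add: add.commute)
    moreover have "b - 2 * pi + 1 * t = t + (b - 2 * pi)" by simp
    ultimately show ?case using elim b
      by (auto simp: g1_def g2_def g_def indicator_def add.commute simp del: add_diff_eq)
  qed
  have "has_bochner_integral lebesgue (\<lambda>t. g1 (b + 1 * t) + g2 (b - 2*pi + 1 * t)) (integral\<^sup>L lebesgue g)"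
    using has_bochner_integral_add[OF A1 A2] S by simp
  then have "has_bochner_integral lebesgue (\<lambda>t. indicator {-pi..pi} t *\<^sub>R f (t + a)) (integral\<^sup>L lebesgue g)"
  proof (rule has_bochner_integralI_AE[OF _ _ eq2])
    have "(\<lambda>t. g1 (b + 1 * t) + g2 (b - 2*pi + 1 * t)) \<in> borel_measurable lebesgue"
      using A1 A2 by (auto simp: has_bochner_integral_iff)
    then show "(\<lambda>t. indicator {-pi..pi} t *\<^sub>R f (t + a)) \<in> borel_measurable lebesgue"
      by (rule borel_measurable_AE[OF _ eq2])
  qed
  then show ?thesis
    by (simp add: has_bochner_integral_restrict_space integral_restrict_space g_def)
qed

lemma period_integral_shift:
  fixes f :: "real \<Rightarrow> 'a::euclidean_space"
  assumes "\<And>t. f (t + 2 * pi) = f t" and "integrable circle f"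
  shows "integrable circle (\<lambda>t. f (t + a))"
    and "(LINT t|circle. f (t + a)) = integral\<^sup>L circle f"
  using has_bochner_integral_period_shift[OF assms] by (auto simp: has_bochner_integral_iff)

lemma period_integral_reflect:
  fixes f :: "real \<Rightarrow> 'a::euclidean_space"
  shows "integrable circle (\<lambda>t. f (- t)) \<longleftrightarrow> integrable circle f"
    and "(LINT t|circle. f (- t)) = integral\<^sup>L circle f"
  using integrable_reflect_real[of "pi" "-pi" f] integral_reflect_real[of "pi" "-pi" f] by simp_all

lemma period_integral_reflect_shift:
  fixes f :: "real \<Rightarrow> 'a::euclidean_space"
  assumes per: "\<And>t. f (t + 2 * pi) = f t" and int: "integrable circle f"
  shows "integrable circle (\<lambda>t. f (x - t))"
    and "(LINT t|circle. f (x - t)) = integral\<^sup>L circle f"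
proof -
  have p: "f (- (t + 2 * pi)) = f (- t)" for t using per[of "- (t + 2*pi)"] by simp
  have i: "integrable circle (\<lambda>t. f (- t))" using int period_integral_reflect by blast
  have eq: "f (- (t + (- x))) = f (x - t)" for t by simp
  show "integrable circle (\<lambda>t. f (x - t))"
    using period_integral_shift(1)[of "\<lambda>t. f (-t)" "-x", OF p i] unfolding eq .
  show "(LINT t|circle. f (x - t)) = integral\<^sup>L circle f"
    using period_integral_shift(2)[of "\<lambda>t. f (-t)" "-x", OF p i] unfolding eq period_integral_reflect(2) .
qed

lemma lebesgue_measurable_reflect_shift:
  fixes f :: "real \<Rightarrow> 'a::euclidean_space"
  assumes "f \<in> borel_measurable lebesgue"
  shows "(\<lambda>t. f (x - t)) \<in> borel_measurable lebesgue"
proof -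
  have "(\<lambda>t::real. x + (-1) * t) \<in> lebesgue \<rightarrow>\<^sub>M lebesgue"
    using lebesgue_affine_measurable[where c= "\<lambda>x::real. -1" and t = x] by simp
  from measurable_compose[OF this assms] show ?thesis by simp
qed

lemma measurable_period [simp, intro]:
  fixes f :: "real \<Rightarrow> 'a::euclidean_space"
  assumes "f \<in> borel_measurable lebesgue"
  shows "f \<in> borel_measurable circle"
  using assms by (rule measurable_restrict_space1)

text \<open>Lebesgue measure equals its image under a reflection followed by a translation, so null
  sets stay null; its representation as a \<open>density\<close> of a \<open>distr\<close> supplies
  this.\<close>

lemma AE_lebesgue_reflect_shift:
  fixes f f' :: "real \<Rightarrow> real"
  assumes m: "f \<in> borel_measurable lebesgue" "f' \<in> borel_measurable lebesgue"
    and ae: "AE t in lebesgue. f t = f' t"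
  shows "AE t in lebesgue. f (x - t) = f' (x - t)"
proof -
  have T: "(\<lambda>t::real. x + (-1) * t) \<in> lebesgue \<rightarrow>\<^sub>M lebesgue"
    using lebesgue_affine_measurable[where c= "\<lambda>x::real. -1" and t = x] by simp
  have "AE t in density (distr lebesgue lebesgue (\<lambda>t. x + (-1) * t)) (\<lambda>_. ennreal (abs (-1))). f t = f' t"
    using ae by (subst lebesgue_real_affine[symmetric]) auto
  then have "AE t in distr lebesgue lebesgue (\<lambda>t. x + (-1) * t). f t = f' t"
    by (subst (asm) AE_density) auto
  moreover have "{t \<in> space lebesgue. f t = f' t} \<in> sets lebesgue"
    using m by measurable
  ultimately show ?thesis by (subst (asm) AE_distr_iff[OF T]) auto
qed

lemma convol_eq_period: "convol f g x = (LINT t|circle. f (x - t) * g t) / (2 * pi)"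
  unfolding convol_def set_lebesgue_integral_def by (subst integral_restrict_space) auto

lemma AE_period:
  assumes "AE t in lebesgue. P t" shows "AE t in circle. P t"
  using assms by (subst AE_restrict_space_iff) auto

text \<open>Fubini's theorem in the form used throughout: \<open>w = 1\<close> yields integrability
  of a convolution, exponentials yield the convolution theorem, signs yield norm bounds. The
  obstacle is that \<open>f\<close> is merely Lebesgue measurable, so \<open>f (x - t)\<close> has
  no immediate measurability on the product; a Borel version \<open>f'\<close> replaces it, and
  every section is compared with \<open>f\<close> almost everywhere.\<close>

lemma convol_pairing:
  fixes f g :: "real \<Rightarrow> real" and w :: "real \<Rightarrow> complex"
  assumes fm: "f \<in> borel_measurable lebesgue" and per: "\<And>t. f (t + 2 * pi) = f t"
    and fi: "integrable circle f" and gi: "integrable circle g"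
    and wm: "w \<in> borel_measurable circle" and wb: "\<And>x. norm (w x) \<le> B"
  shows "integrable circle (\<lambda>x. complex_of_real (convol f g x) * w x)" (is ?A)
    and "(LINT x|circle. complex_of_real (convol f g x) * w x) =
         (LINT t|circle. complex_of_real (g t) * (LINT x|circle. complex_of_real (f (x - t)) * w x)) / (2 * pi)" (is ?B)
    and "convol f g \<in> borel_measurable lebesgue" (is ?C)
proof -
  interpret P: finite_measure circle by (rule finite_measure_period)
  interpret PP: pair_sigma_finite circle circle ..
  have gm: "g \<in> borel_measurable circle" using gi by simp
  obtain f' where f': "f' \<in> borel_measurable borel" and ae: "AE t in lborel. f t = f' t"
    using completion_ex_borel_measurable_real[OF fm] by auto
  have f'l: "f' \<in> borel_measurable lebesgue" using f' by (simp add: measurable_completion)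
  have ae': "AE t in lebesgue. f t = f' t" using ae by (rule AE_completion)
  have aes: "AE t in circle. f (x - t) = f' (x - t)" for x
    by (rule AE_period, rule AE_lebesgue_reflect_shift[OF fm f'l ae'])
  \<comment> \<open>In the other variable \<open>x - t\<close> is written as
    \<open>- (t - x)\<close>, so the reflection about \<open>t\<close> is applied to the reflected
    functions.\<close>
  have aes2: "AE x in circle. f (x - t) = f' (x - t)" for t
  proof -
    define h h' where "h = (\<lambda>s. f (- s))" and "h' = (\<lambda>s. f' (- s))"
    have 1: "AE s in lebesgue. h s = h' s"
      using AE_lebesgue_reflect_shift[OF fm f'l ae', of 0] by (simp add: h_def h'_def)
    have 2: "h \<in> borel_measurable lebesgue" "h' \<in> borel_measurable lebesgue"
      using lebesgue_measurable_reflect_shift[OF fm, of 0] lebesgue_measurable_reflect_shift[OF f'l, of 0]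
      by (simp_all add: h_def h'_def)
    show ?thesis
      using AE_period[OF AE_lebesgue_reflect_shift[OF 2 1, of t]] by (simp add: h_def h'_def)
  qed
  have idm: "(\<lambda>x. x) \<in> circle \<rightarrow>\<^sub>M borel"
    by (simp add: measurable_restrict_space1 measurable_completion)
  have f'x: "(\<lambda>p. f' (snd p - fst p)) \<in> borel_measurable (circle \<Otimes>\<^sub>M circle)"
  proof -
    have "(\<lambda>p. snd p - fst p) \<in> (circle \<Otimes>\<^sub>M circle) \<rightarrow>\<^sub>M (borel :: real measure)"
      using measurable_compose[OF measurable_fst idm] measurable_compose[OF measurable_snd idm]
      by (intro borel_measurable_diff)
    from measurable_compose[OF this f'] show ?thesis .
  qed
  define H where "H = (\<lambda>t x. complex_of_real (f' (x - t)) * (complex_of_real (g t) * w x))"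
  have Hm: "case_prod H \<in> borel_measurable (circle \<Otimes>\<^sub>M circle)"
    unfolding H_def case_prod_beta
    using f'x measurable_compose[OF measurable_fst gm] measurable_compose[OF measurable_snd wm]
    by (intro borel_measurable_times measurable_compose[OF _ borel_measurable_of_real]) auto
  have B0: "0 \<le> B" using wb[of 0] norm_ge_zero order_trans by blast
  have fx: "integrable circle (\<lambda>x. f (x - t))"
      "(LINT x|circle. \<bar>f (x - t)\<bar>) = (LINT x|circle. \<bar>f x\<bar>)" for t
    using period_integral_shift[of f "-t", OF per fi]
      period_integral_shift[of "\<lambda>t. \<bar>f t\<bar>" "-t"] per fi by auto
  have Hsec: "integrable circle (H t)"
    and Hsecn: "(LINT x|circle. norm (H t x)) \<le> \<bar>g t\<bar> * (B * (LINT x|circle. \<bar>f x\<bar>))" for t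
  proof -
    have f's: "(\<lambda>x. f' (x - t)) \<in> borel_measurable circle"
      using measurable_compose[OF _ f', of "\<lambda>x. x - t" circle] idm by simp
    have mH: "H t \<in> borel_measurable circle"
      unfolding H_def using f's wm by (intro borel_measurable_times measurable_compose[OF _ borel_measurable_of_real]) auto
    have bd: "AE x in circle. norm (H t x) \<le> \<bar>f (x - t)\<bar> * (\<bar>g t\<bar> * B)"
      using aes2[of t]
    proof eventually_elim
      case (elim x)
      then show ?case using wb[of x] by (simp add: H_def norm_mult mult_left_mono)
    qed
    have i: "integrable circle (\<lambda>x. \<bar>f (x - t)\<bar> * (\<bar>g t\<bar> * B))" using fx(1)[of t] by auto
    show I: "integrable circle (H t)"
      by (rule Bochner_Integration.integrable_bound[OF i mH]) (use bd B0 in auto)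
    have "(LINT x|circle. norm (H t x)) \<le> (LINT x|circle. \<bar>f (x - t)\<bar> * (\<bar>g t\<bar> * B))"
      by (rule integral_mono_AE) (use I i bd in auto)
    also have "\<dots> = (LINT x|circle. \<bar>f x\<bar>) * (\<bar>g t\<bar> * B)" using fx(2)[of t] by simp
    finally show "(LINT x|circle. norm (H t x)) \<le> \<bar>g t\<bar> * (B * (LINT x|circle. \<bar>f x\<bar>))"
      by (simp add: mult_ac)
  qed
  have HI: "integrable (circle \<Otimes>\<^sub>M circle) (case_prod H)"
  proof (rule PP.Fubini_integrable[OF Hm])
    show "AE t in circle. integrable circle (\<lambda>x. case (t, x) of (t, x) \<Rightarrow> H t x)"
      using Hsec by simp
    show "integrable circle (\<lambda>t. LINT x|circle. norm (case (t, x) of (t, x) \<Rightarrow> H t x))"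
    proof (rule Bochner_Integration.integrable_bound)
      show "integrable circle (\<lambda>t. \<bar>g t\<bar> * (B * (LINT x|circle. \<bar>f x\<bar>)))"
        using gi by auto
      show "(\<lambda>t. LINT x|circle. norm (case (t, x) of (t, x) \<Rightarrow> H t x)) \<in> borel_measurable circle"
        using Hm by (intro P.borel_measurable_lebesgue_integral) (simp add: case_prod_beta)
      show "AE t in circle. norm (LINT x|circle. norm (case (t, x) of (t, x) \<Rightarrow> H t x))
            \<le> norm (\<bar>g t\<bar> * (B * (LINT x|circle. \<bar>f x\<bar>)))"
        using Hsecn B0 by (auto simp: abs_mult)
    qed
  qed
  have inner: "(LINT t|circle. H t x) = complex_of_real (2 * pi * convol f g x) * w x" for x
  proof -
    have f's: "(\<lambda>t. f' (x - t)) \<in> borel_measurable circle"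
      using lebesgue_measurable_reflect_shift[OF f'l] by simp
    have fs: "(\<lambda>t. f (x - t)) \<in> borel_measurable circle"
      using lebesgue_measurable_reflect_shift[OF fm] by simp
    have "(LINT t|circle. H t x) = (LINT t|circle. complex_of_real (f (x - t) * g t) * w x)"
    proof (rule integral_cong_AE)
      show "(\<lambda>t. H t x) \<in> borel_measurable circle"
        unfolding H_def using f's gm by measurable
      show "(\<lambda>t. complex_of_real (f (x - t) * g t) * w x) \<in> borel_measurable circle"
        using fs gm by measurable
      show "AE t in circle. H t x = complex_of_real (f (x - t) * g t) * w x"
        using aes[of x] by eventually_elim (simp add: H_def)
    qed
    also have "\<dots> = complex_of_real (LINT t|circle. f (x - t) * g t) * w x"
      by (simp del: of_real_mult)
    finally show ?thesis by (simp add: convol_eq_period)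
  qed
  have inner2: "(LINT x|circle. H t x) = complex_of_real (g t) * (LINT x|circle. complex_of_real (f (x - t)) * w x)" for t
  proof -
    have f's: "(\<lambda>x. f' (x - t)) \<in> borel_measurable circle"
      using measurable_compose[OF _ f', of "\<lambda>x. x - t" circle] idm by simp
    have fs: "(\<lambda>x. f (x - t)) \<in> borel_measurable circle"
      using fx(1) by simp
    have "(LINT x|circle. H t x) = (LINT x|circle. complex_of_real (g t) * (complex_of_real (f (x - t)) * w x))"
    proof (rule integral_cong_AE)
      show "H t \<in> borel_measurable circle"
        unfolding H_def using f's wm by measurable
      show "(\<lambda>x. complex_of_real (g t) * (complex_of_real (f (x - t)) * w x)) \<in> borel_measurable circle"
        using fs wm by measurable
      show "AE x in circle. H t x = complex_of_real (g t) * (complex_of_real (f (x - t)) * w x)"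
        using aes2[of t] by eventually_elim (simp add: H_def)
    qed
    then show ?thesis by simp
  qed
  have "integrable circle (\<lambda>x. LINT t|circle. H t x)"
    using PP.integrable_snd[OF HI] .
  then have "integrable circle (\<lambda>x. complex_of_real (2 * pi) * (complex_of_real (convol f g x) * w x))"
    unfolding inner by (simp add: mult_ac)
  then have "integrable circle (\<lambda>x. (complex_of_real (2 * pi) * (complex_of_real (convol f g x) * w x)) / complex_of_real (2 * pi))"
    by (rule integrable_divide_zero)
  then show ?A by simp
  have "(LINT x|circle. LINT t|circle. H t x) = (LINT t|circle. LINT x|circle. H t x)"
    by (rule PP.Fubini_integral[OF HI])
  then have "complex_of_real (2 * pi) * (LINT x|circle. complex_of_real (convol f g x) * w x) =
     (LINT t|circle. complex_of_real (g t) * (LINT x|circle. complex_of_real (f (x - t)) * w x))"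
    unfolding inner inner2 by (simp add: mult.assoc)
  then show ?B by (simp add: field_simps)
  \<comment> \<open>Measurability is wanted on the whole line, whereas \<open>H\<close> lives on one
    period; hence a second product, with full Lebesgue measure in \<open>x\<close>.\<close>
  have "(\<lambda>x. LINT t|circle. f' (x - t) * g t) \<in> borel_measurable lebesgue"
  proof (rule P.borel_measurable_lebesgue_integral)
    have "(\<lambda>p. fst p - snd p) \<in> (lebesgue \<Otimes>\<^sub>M circle) \<rightarrow>\<^sub>M (borel :: real measure)"
      using measurable_compose[OF measurable_fst, of "\<lambda>x. x" "lebesgue :: real measure" borel] measurable_compose[OF measurable_snd idm]
      by (intro borel_measurable_diff) (auto simp: measurable_completion)
    from measurable_compose[OF this f'] measurable_compose[OF measurable_snd gm]
    show "(\<lambda>(x, t). f' (x - t) * g t) \<in> borel_measurable (lebesgue \<Otimes>\<^sub>M circle)"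
      unfolding case_prod_beta by (intro borel_measurable_times)
  qed
  moreover have "(LINT t|circle. f' (x - t) * g t) = 2 * pi * convol f g x" for x
  proof -
    have f's: "(\<lambda>t. f' (x - t)) \<in> borel_measurable circle"
      using lebesgue_measurable_reflect_shift[OF f'l] by simp
    have fs: "(\<lambda>t. f (x - t)) \<in> borel_measurable circle"
      using lebesgue_measurable_reflect_shift[OF fm] by simp
    have "(LINT t|circle. f' (x - t) * g t) = (LINT t|circle. f (x - t) * g t)"
      by (rule integral_cong_AE) (use aes[of x] f's fs gm in auto)
    then show ?thesis by (simp add: convol_eq_period)
  qed
  ultimately have "(\<lambda>x. 2 * pi * convol f g x) \<in> borel_measurable lebesgue" by simp
  then have "(\<lambda>x. (2 * pi * convol f g x) / (2 * pi)) \<in> borel_measurable lebesgue" by (rule borel_measurable_divide) auto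
  then show ?C by simp
qed

lemma norm_exp_minus_ii: "norm (fourier_exp k t) = 1"
  by (simp add: norm_exp_eq_Re)

lemma exp_minus_ii_measurable [measurable]:
  "(\<lambda>t. fourier_exp k t) \<in> borel_measurable circle"
  by (intro continuous_imp_measurable_on_sets_lebesgue continuous_intros) auto

lemma exp_minus_ii_periodic:
  "fourier_exp k (t + 2 * pi) = fourier_exp k t"
proof -
  have "fourier_exp k (t + 2 * pi) =
      fourier_exp k t * exp (2 * of_int (- k) * pi * \<i>)"
    by (simp add: exp_add[symmetric] algebra_simps)
  also have "exp (2 * of_int (- k) * pi * \<i>) = 1"
    using exp_integer_2pi[of "of_int (-k)"] by simp
  finally show ?thesis by simp
qed

lemma fourier_coeff_eq_period:
  "fourier_coeff f k = (LINT t|circle. complex_of_real (f t) * fourier_exp k t) / (2 * pi)"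
  unfolding fourier_coeff_def set_lebesgue_integral_def
  by (subst integral_restrict_space) (auto simp: scaleR_conv_of_real)

lemma integrable_times_bounded:
  fixes w :: "'a \<Rightarrow> complex"
  assumes f: "integrable M f" and w: "w \<in> borel_measurable M" and B: "\<And>x. norm (w x) \<le> B"
  shows "integrable M (\<lambda>x. complex_of_real (f x) * w x)"
proof (rule Bochner_Integration.integrable_bound)
  show "integrable M (\<lambda>x. B * f x)" using f by simp
  show "(\<lambda>x. complex_of_real (f x) * w x) \<in> borel_measurable M" using f w by simp
  have "0 \<le> B" using B[of undefined] norm_ge_zero order_trans by blast
  then show "AE x in M. norm (complex_of_real (f x) * w x) \<le> norm (B * f x)"
    using B by (auto simp: norm_mult abs_mult mult.commute[of B] intro!: mult_left_mono)
qed

lemma fourier_coeff_translate: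
  assumes "\<And>t. f (t + 2 * pi) = f t" and "integrable circle f"
  shows "(LINT x|circle. complex_of_real (f (x - t)) * fourier_exp k x) =
     2 * pi * fourier_coeff f k * fourier_exp k t"
proof -
  define F where "F = (\<lambda>x. complex_of_real (f x) * fourier_exp k (x + t))"
  have per: "F (x + 2 * pi) = F x" for x
    using exp_minus_ii_periodic[of k "x + t"] assms(1)[of x] unfolding F_def by (simp only: add.assoc add.commute[of t])
  have eq: "F x = (complex_of_real (f x) * fourier_exp k x) * fourier_exp k t" for x
    unfolding F_def of_real_add distrib_left exp_add by simp
  have i: "integrable circle (\<lambda>x. complex_of_real (f x) * fourier_exp k x)"
    by (rule integrable_times_bounded[OF assms(2) exp_minus_ii_measurable eq_refl[OF norm_exp_minus_ii]])
  have int: "integrable circle F" unfolding eq using i by auto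
  have "(LINT x|circle. complex_of_real (f (x - t)) * fourier_exp k x) = (LINT x|circle. F (x + - t))"
    by (simp add: F_def)
  also have "\<dots> = integral\<^sup>L circle F" by (rule period_integral_shift[OF per int])
  also have "\<dots> = 2 * pi * fourier_coeff f k * fourier_exp k t"
    unfolding eq fourier_coeff_eq_period by simp
  finally show ?thesis .
qed

section \<open>Convolution theorem and Young's inequality for periodic integrable functions\<close>

locale periodic_integrable =
  fixes f :: "real \<Rightarrow> real"
  assumes lebesgue_measurable: "f \<in> borel_measurable lebesgue"
    and periodic: "\<And>t. f (t + 2 * pi) = f t"
    and integrable_period: "integrable circle f"

lemma convol_periodic:
  assumes "periodic_integrable f"
  shows "convol f g (x + 2 * pi) = convol f g x"
proof -
  have "f (x + 2 * pi - t) = f (x - t)" for t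
    using periodic_integrable.periodic[OF assms, of "x - t"] by (simp add: algebra_simps)
  then show ?thesis by (simp add: convol_eq_period)
qed

lemma convol_periodic_integrable:
  assumes f: "periodic_integrable f" and g: "integrable circle g"
  shows "periodic_integrable (convol f g)"
proof
  interpret periodic_integrable f by fact
  note P = convol_pairing[OF lebesgue_measurable periodic integrable_period g, of "\<lambda>_. 1" 1, simplified]
  show "convol f g \<in> borel_measurable lebesgue" by (rule P(3))
  show "integrable circle (convol f g)"
    using integrable_Re[OF P(1)] by simp
  show "convol f g (t + 2 * pi) = convol f g t" for t by (rule convol_periodic[OF f])
qed

lemma fourier_coeff_convol:
  assumes f: "periodic_integrable f" and g: "integrable circle g"
  shows "fourier_coeff (convol f g) k = fourier_coeff f k * fourier_coeff g k"
proof -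
  interpret periodic_integrable f by fact
  note P = convol_pairing[OF lebesgue_measurable periodic integrable_period g exp_minus_ii_measurable eq_refl[OF norm_exp_minus_ii]]
  have "fourier_coeff (convol f g) k = (LINT t|circle. complex_of_real (g t) *
      (2 * pi * fourier_coeff f k * fourier_exp k t)) / (2 * pi) / (2 * pi)"
    unfolding fourier_coeff_eq_period[of "convol f g"] P(2) fourier_coeff_translate[OF periodic integrable_period] ..
  also have "\<dots> = (LINT t|circle. (2 * pi * fourier_coeff f k) * (complex_of_real (g t) *
       fourier_exp k t)) / (2 * pi) / (2 * pi)"
    by (simp add: mult_ac)
  also have "\<dots> = fourier_coeff f k * fourier_coeff g k"
    unfolding integral_mult_right_zero by (simp add: fourier_coeff_eq_period[of g])
  finally show ?thesis .
qed

text \<open>Testing the convolution against its own sign turns the \<open>L_1\<close> norm into a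
  pairing; \<open>convol_pairing\<close> then moves the test function onto \<open>f\<close>, whose
  translates all have the same norm.\<close>

lemma integral_abs_convol_le:
  assumes f: "periodic_integrable f" and g: "integrable circle g"
  shows "(LINT x|circle. \<bar>convol f g x\<bar>) \<le>
    (LINT x|circle. \<bar>f x\<bar>) * (LINT t|circle. \<bar>g t\<bar>) / (2 * pi)"
proof -
  interpret periodic_integrable f by fact
  interpret c: periodic_integrable "convol f g" by (rule convol_periodic_integrable[OF f g])
  define w where "w = (\<lambda>x. complex_of_real (sgn (convol f g x)))"
  have wm: "w \<in> borel_measurable circle"
    unfolding w_def by (intro measurable_compose[OF _ borel_measurable_of_real] measurable_compose[OF _ borel_measurable_sgn] measurable_period c.lebesgue_measurable)
  have wb: "norm (w x) \<le> 1" for x by (simp add: w_def sgn_real_def)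
  note P = convol_pairing[OF lebesgue_measurable periodic integrable_period g wm wb]
  have e: "complex_of_real (convol f g x) * w x = complex_of_real \<bar>convol f g x\<bar>" for x
    by (simp add: w_def sgn_real_def)
  have "complex_of_real (LINT x|circle. \<bar>convol f g x\<bar>) =
     (LINT t|circle. complex_of_real (g t) * (LINT x|circle. complex_of_real (f (x - t)) * w x)) / (2 * pi)"
    using P(2) unfolding e integral_complex_of_real .
  then have "(LINT x|circle. \<bar>convol f g x\<bar>) = norm ((LINT t|circle. complex_of_real (g t) * (LINT x|circle. complex_of_real (f (x - t)) * w x)) / (2 * pi))"
  proof -
    have "0 \<le> (LINT x|circle. \<bar>convol f g x\<bar>)" by (rule integral_nonneg_AE) simp
    moreover assume "complex_of_real (LINT x|circle. \<bar>convol f g x\<bar>) =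
     (LINT t|circle. complex_of_real (g t) * (LINT x|circle. complex_of_real (f (x - t)) * w x)) / (2 * pi)"
    ultimately show ?thesis by (metis norm_of_real abs_of_nonneg)
  qed
  also have "\<dots> \<le> (LINT t|circle. \<bar>g t\<bar> * (LINT x|circle. \<bar>f x\<bar>)) / (2 * pi)"
  proof -
    have b: "norm (LINT x|circle. complex_of_real (f (x - t)) * w x) \<le> (LINT x|circle. \<bar>f x\<bar>)" for t
    proof -
      have "integrable circle (\<lambda>x. \<bar>f (x - t)\<bar>)" "(LINT x|circle. \<bar>f (x - t)\<bar>) = (LINT x|circle. \<bar>f x\<bar>)"
        using period_integral_shift[of "\<lambda>t. \<bar>f t\<bar>" "-t"] periodic integrable_period by auto
      moreover have "norm (LINT x|circle. complex_of_real (f (x - t)) * w x) \<le> (LINT x|circle. \<bar>f (x - t)\<bar>)"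
        by (rule Bochner_Integration.integral_norm_bound_integral[OF integrable_times_bounded[OF _ wm wb]])
           (use period_integral_shift[of f "-t"] periodic integrable_period wb in \<open>auto simp: norm_mult mult_left_le\<close>)
      ultimately show ?thesis by simp
    qed
    have "norm (LINT t|circle. complex_of_real (g t) * (LINT x|circle. complex_of_real (f (x - t)) * w x))
      \<le> (LINT t|circle. \<bar>g t\<bar> * (LINT x|circle. \<bar>f x\<bar>))"
    \<comment> \<open>If the outer integrand failed to be integrable, its integral would be 0 by
      convention and the bound trivial; this spares a measurability argument.\<close>
    proof (cases "integrable circle (\<lambda>t. complex_of_real (g t) * (LINT x|circle. complex_of_real (f (x - t)) * w x))")
      case True
      then show ?thesis
        by (rule Bochner_Integration.integral_norm_bound_integral) (use g b in \<open>auto simp: norm_mult mult_left_mono\<close>)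
    next
      case False
      then show ?thesis by (simp add: not_integrable_integral_eq)
    qed
    then show ?thesis by (simp add: norm_divide divide_right_mono)
  qed
  finally show ?thesis by (simp add: mult.commute)
qed

text \<open>The bound on \<open>f\<close> must hold at \<open>x - t\<close> for almost every
  \<open>t\<close>, and this for every single \<open>x\<close>. The exceptional set is periodic with
  integral 0, and reflection and shift preserve that integral.\<close>

lemma abs_convol_le:
  assumes f: "periodic_integrable f" and g: "integrable circle g"
    and bd: "AE t in circle. \<bar>f t\<bar> \<le> B"
  shows "\<bar>convol f g x\<bar> \<le> B * (LINT t|circle. \<bar>g t\<bar>) / (2 * pi)"
proof -
  interpret periodic_integrable f by fact
  define b where "b t = (if \<bar>f t\<bar> \<le> B then 0 else 1 :: real)" for t
  have bm: "b \<in> borel_measurable lebesgue"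
    unfolding b_def using lebesgue_measurable by measurable
  have bp: "b (t + 2 * pi) = b t" for t by (simp add: b_def periodic)
  have "AE t in circle. b t = 0" using bd by eventually_elim (simp add: b_def)
  then have bi: "integrable circle b" "integral\<^sup>L circle b = 0"
    using integrable_cong_AE[of b circle "\<lambda>_. 0"] integral_cong_AE[of b circle "\<lambda>_. 0"] bm by auto
  have "integrable circle (\<lambda>t. b (x - t))" "(LINT t|circle. b (x - t)) = 0"
    using period_integral_reflect_shift[of b x] bp bi by auto
  moreover have "AE t in circle. 0 \<le> b (x - t)" by (simp add: b_def)
  ultimately have "AE t in circle. b (x - t) = 0"
    using integral_nonneg_eq_0_iff_AE by blast
  then have ae: "AE t in circle. \<bar>f (x - t)\<bar> \<le> B"
    by eventually_elim (auto simp: b_def split: if_splits)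
  have "\<bar>LINT t|circle. f (x - t) * g t\<bar> \<le> (LINT t|circle. B * \<bar>g t\<bar>)"
  proof (cases "integrable circle (\<lambda>t. f (x - t) * g t)")
    case True
    have "norm (LINT t|circle. f (x - t) * g t) \<le> (LINT t|circle. norm (f (x - t) * g t))"
      by (rule integral_norm_bound)
    also have "\<dots> \<le> (LINT t|circle. B * \<bar>g t\<bar>)"
    proof (rule integral_mono_AE)
      show "AE t in circle. norm (f (x - t) * g t) \<le> B * \<bar>g t\<bar>"
        using ae by eventually_elim (simp add: abs_mult mult_right_mono)
    qed (use True g in auto)
    finally show ?thesis by simp
  next
    case False
    have "AE t in circle. 0 \<le> B * \<bar>g t\<bar>" using ae by eventually_elim auto
    then have "0 \<le> (LINT t|circle. B * \<bar>g t\<bar>)" by (rule integral_nonneg_AE)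
    then show ?thesis using False by (simp add: not_integrable_integral_eq)
  qed
  then show ?thesis by (simp add: convol_eq_period abs_mult divide_right_mono)
qed

section \<open>Uniqueness of Fourier coefficients\<close>

definition fourier_null :: "(real \<Rightarrow> real) \<Rightarrow> bool" where
  "fourier_null F \<longleftrightarrow> integrable circle F \<and> (\<forall>k. fourier_coeff F k = 0)"

lemma integrable_exp_period:
  "integrable circle F \<Longrightarrow>
    integrable circle (\<lambda>t. complex_of_real (F t) * fourier_exp k t)"
  by (rule integrable_times_bounded[OF _ exp_minus_ii_measurable eq_refl[OF norm_exp_minus_ii]])

lemma fourier_coeff_add:
  "integrable circle F \<Longrightarrow> integrable circle G \<Longrightarrow>
    fourier_coeff (\<lambda>t. F t + G t) k = fourier_coeff F k + fourier_coeff G k"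
  by (simp add: fourier_coeff_eq_period distrib_right add_divide_distrib
      Bochner_Integration.integral_add[OF integrable_exp_period integrable_exp_period, simplified])

lemma fourier_coeff_cmult: "fourier_coeff (\<lambda>t. c * F t) k = of_real c * fourier_coeff F k"
  by (simp add: fourier_coeff_eq_period mult.assoc)

lemma fourier_coeff_diff:
  "integrable circle F \<Longrightarrow> integrable circle G \<Longrightarrow>
    fourier_coeff (\<lambda>t. F t - G t) k = fourier_coeff F k - fourier_coeff G k"
  using fourier_coeff_add[of F "\<lambda>t. (-1) * G t" k] fourier_coeff_cmult[of "-1" G k] by simp

lemma cos_period_measurable: "(\<lambda>t. cos (c * t)) \<in> borel_measurable circle"
  by (intro continuous_imp_measurable_on_sets_lebesgue continuous_intros) auto

lemma sin_period_measurable: "(\<lambda>t. sin (c * t)) \<in> borel_measurable circle"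
  by (intro continuous_imp_measurable_on_sets_lebesgue continuous_intros) auto

lemma integrable_times_bounded_real:
  fixes w :: "'a \<Rightarrow> real"
  assumes f: "integrable M f" and w: "w \<in> borel_measurable M" and B: "\<And>x. \<bar>w x\<bar> \<le> B"
  shows "integrable M (\<lambda>x. f x * w x)"
  using integrable_Re[OF integrable_times_bounded[of M f "\<lambda>x. complex_of_real (w x)" B]] assms
  by simp

text \<open>Multiplying by \<open>cos t\<close> or \<open>sin t\<close> replaces the
  \<open>k\<close>-th coefficient by a combination of its neighbours at \<open>k + 1\<close> and
  \<open>k - 1\<close>.\<close>

lemma fourier_null_cos_sin:
  assumes "fourier_null F"
  shows "fourier_null (\<lambda>t. F t * cos t)" "fourier_null (\<lambda>t. F t * sin t)"
proof -
  have i: "integrable circle F" and z: "\<And>k. (LINT t|circle. complex_of_real (F t) * fourier_exp k t) = 0"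
    using assms by (auto simp: fourier_null_def fourier_coeff_eq_period)
  have ic: "integrable circle (\<lambda>t. F t * cos t)" "integrable circle (\<lambda>t. F t * sin t)"
    using integrable_times_bounded_real[OF i cos_period_measurable[of 1], of 1]
     integrable_times_bounded_real[OF i sin_period_measurable[of 1], of 1] by auto
  have cis_conv_cos_sin: "cis t = complex_of_real (cos t) + \<i> * complex_of_real (sin t)" for t
    by (simp add: complex_eq_iff cos_of_real sin_of_real)
  have e1: "fourier_exp (k + 1) t = fourier_exp k t * (complex_of_real (cos t) - \<i> * complex_of_real (sin t))"
   and e2: "fourier_exp (k - 1) t = fourier_exp k t * (complex_of_real (cos t) + \<i> * complex_of_real (sin t))" for k t
  proof -
    have "fourier_exp (k + 1) t = exp (- \<i> * of_int k * complex_of_real t + \<i> * complex_of_real (-t))"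
      by (simp add: algebra_simps)
    then show "fourier_exp (k + 1) t = fourier_exp k t * (complex_of_real (cos t) - \<i> * complex_of_real (sin t))"
      unfolding exp_add cis_conv_exp[symmetric] by (simp add: cis_conv_cos_sin cos_of_real sin_of_real)
    have "fourier_exp (k - 1) t = exp (- \<i> * of_int k * complex_of_real t + \<i> * complex_of_real t)"
      by (simp add: algebra_simps)
    then show "fourier_exp (k - 1) t = fourier_exp k t * (complex_of_real (cos t) + \<i> * complex_of_real (sin t))"
      unfolding exp_add cis_conv_exp[symmetric] by (simp add: cis_conv_cos_sin cos_of_real sin_of_real)
  qed
  have c: "complex_of_real (F t * cos t) * fourier_exp k t =
     (complex_of_real (F t) * fourier_exp (k + 1) t +
      complex_of_real (F t) * fourier_exp (k - 1) t) / 2" for k t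
    unfolding e1 e2 by (simp add: algebra_simps cos_of_real sin_of_real)
  have s: "complex_of_real (F t * sin t) * fourier_exp k t =
     (complex_of_real (F t) * fourier_exp (k + 1) t -
      complex_of_real (F t) * fourier_exp (k - 1) t) * (\<i> / 2)" for k t
    unfolding e1 e2 by (simp add: algebra_simps cos_of_real sin_of_real)
  show "fourier_null (\<lambda>t. F t * cos t)"
    unfolding fourier_null_def fourier_coeff_eq_period c
    using ic(1) Bochner_Integration.integral_add[OF integrable_exp_period[OF i] integrable_exp_period[OF i]]
    by (simp only: integral_divide_zero z) simp
  show "fourier_null (\<lambda>t. F t * sin t)"
    unfolding fourier_null_def fourier_coeff_eq_period s
    using ic(2) Bochner_Integration.integral_diff[OF integrable_exp_period[OF i] integrable_exp_period[OF i]]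
    by (simp only: integral_mult_left_zero z) simp
qed

lemma fourier_null_linear:
  assumes "fourier_null F" "fourier_null G"
  shows "fourier_null (\<lambda>t. a * F t + b * G t)"
  using assms fourier_coeff_add[of "\<lambda>t. a * F t" "\<lambda>t. b * G t"] by (auto simp: fourier_null_def fourier_coeff_cmult)

text \<open>Quantifying over all \<open>F\<close> makes the set of admissible multipliers closed under products.\<close>

lemma fourier_null_polynomial:
  assumes "real_polynomial_function g" and "fourier_null F"
  shows "fourier_null (\<lambda>t. F t * g (cis t))"
  using assms
proof (induction arbitrary: F rule: real_polynomial_function.induct)
  case (linear g)
  interpret bounded_linear g by fact
  have "g (cis t) = cos t * g 1 + sin t * g \<i>" for t
  proof -
    have "cis t = cos t *\<^sub>R 1 + sin t *\<^sub>R \<i>" by (simp add: complex_eq_iff)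
    then show ?thesis by (simp only: add scaleR real_scaleR_def)
  qed
  then have "F t * g (cis t) = g 1 * (F t * cos t) + g \<i> * (F t * sin t)" for t
    by (simp add: algebra_simps)
  then show ?case
    using fourier_null_linear[OF fourier_null_cos_sin[OF linear.prems], of "g 1" "g \<i>"] by simp
next
  case (const c)
  show ?case using fourier_null_linear[OF const const, of c 0] by (simp add: mult.commute)
next
  case (add f g)
  show ?case
    using fourier_null_linear[OF add.IH(1)[OF add.prems] add.IH(2)[OF add.prems], of 1 1]
    by (simp add: algebra_simps)
next
  case (mult f g)
  show ?case using mult.IH(2)[OF mult.IH(1)[OF mult.prems]] by (simp add: mult.assoc)
qed

lemma fourier_null_integral: "fourier_null F \<Longrightarrow> integral\<^sup>L circle F = 0"
proof -
  assume "fourier_null F"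
  then have "fourier_coeff F 0 = 0" by (simp add: fourier_null_def)
  then have "complex_of_real (integral\<^sup>L circle F) = 0" by (simp add: fourier_coeff_eq_period)
  then show ?thesis by simp
qed

lemma continuous_cis_measurable:
  fixes G :: "complex \<Rightarrow> real"
  assumes "continuous_on (sphere 0 1) G"
  shows "(\<lambda>t. G (cis t)) \<in> borel_measurable circle"
  by (intro continuous_imp_measurable_on_sets_lebesgue continuous_on_compose2[OF assms] continuous_on_cis continuous_on_id) auto

text \<open>Stone-Weierstrass on the unit circle: taking \<open>G\<close> on the sphere in the
  complex plane builds periodicity in, and an approximation within \<open>e\<close> changes the
  integral by at most \<open>e\<close> times the \<open>L_1\<close> norm of
  \<open>F\<close>.\<close>

lemma fourier_null_continuous:
  fixes G :: "complex \<Rightarrow> real"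
  assumes F: "fourier_null F" and G: "continuous_on (sphere 0 1) G"
  shows "(LINT t|circle. F t * G (cis t)) = 0"
proof -
  have i: "integrable circle F" using F by (simp add: fourier_null_def)
  define I where "I = (LINT t|circle. \<bar>F t\<bar>)"
  obtain B where B: "\<And>z. z \<in> sphere 0 1 \<Longrightarrow> \<bar>G z\<bar> \<le> B"
    using compact_imp_bounded[OF compact_continuous_image[OF G compact_sphere]]
    unfolding bounded_iff by (metis imageI real_norm_def)
  have iG: "integrable circle (\<lambda>t. F t * G (cis t))"
    by (rule integrable_times_bounded_real[OF i continuous_cis_measurable[OF G], of B]) (use B in auto)
  have bd: "\<bar>LINT t|circle. F t * G (cis t)\<bar> \<le> e * I" if e: "e > 0" for e
  proof -
    obtain g where g: "real_polynomial_function g" and ge: "\<And>z. z \<in> sphere 0 1 \<Longrightarrow> \<bar>G z - g z\<bar> < e"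
      using Stone_Weierstrass_real_polynomial_function[OF compact_sphere G e] by metis
    have n: "fourier_null (\<lambda>t. F t * g (cis t))" by (rule fourier_null_polynomial[OF g F])
    then have ig: "integrable circle (\<lambda>t. F t * g (cis t))" by (simp add: fourier_null_def)
    have "(LINT t|circle. F t * G (cis t)) = (LINT t|circle. F t * G (cis t) - F t * g (cis t))"
      using iG ig fourier_null_integral[OF n] by simp
    also have "\<bar>\<dots>\<bar> \<le> (LINT t|circle. e * \<bar>F t\<bar>)"
    proof -
      have "norm (LINT t|circle. F t * G (cis t) - F t * g (cis t)) \<le> (LINT t|circle. e * \<bar>F t\<bar>)"
      proof (rule Bochner_Integration.integral_norm_bound_integral)
        show "norm (F t * G (cis t) - F t * g (cis t)) \<le> e * \<bar>F t\<bar>" for t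
          using ge[of "cis t"] by (simp add: right_diff_distrib[symmetric] abs_mult mult.commute[of e] mult_left_mono)
      qed (use iG ig i in auto)
      then show ?thesis by simp
    qed
    finally show ?thesis by (simp add: I_def)
  qed
  have "0 \<le> I" unfolding I_def by simp
  show ?thesis
  proof (rule ccontr)
    assume "\<not> ?thesis"
    then have p: "\<bar>LINT t|circle. F t * G (cis t)\<bar> > 0" (is "?x > 0") by simp
    \<comment> \<open>With this \<open>e\<close> the bound drops below half of \<open>?x\<close>;
      \<open>I + 1\<close> instead of \<open>I\<close> keeps the divisor positive.\<close>
    have "?x \<le> ?x / (2 * (I + 1)) * I" using bd[of "?x / (2 * (I + 1))"] p \<open>0 \<le> I\<close> by simp
    also have "?x / (2 * (I + 1)) * I = ?x * (I / (2 * (I + 1)))" by simp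
    also have "\<dots> < ?x * 1" using \<open>0 \<le> I\<close> by (intro mult_strict_left_mono p) (simp add: field_simps)
    finally show False by simp
  qed
qed

text \<open>The tent functions \<open>G j\<close> are continuous on the circle and decrease to the
  indicator of the image of \<open>T\<close> under \<open>cis\<close>. \<open>T\<close> has to avoid
  \<open>-pi\<close> and \<open>pi\<close>, which \<open>cis\<close> glues together.\<close>

lemma fourier_null_closed_set:
  assumes F: "fourier_null F" and T: "closed T" "T \<subseteq> {-pi<..<pi}"
  shows "(LINT t:T|circle. F t) = 0"
proof (cases "T = {}")
  case False
  have i: "integrable circle F" using F by (simp add: fourier_null_def)
  have cT: "compact T" using T bounded_subset[OF bounded_box[of "-pi" pi]] by (auto simp: compact_eq_bounded_closed)
  then have cc: "compact (cis ` T)" by (intro compact_continuous_image continuous_on_cis continuous_on_id)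
  define G where "G = (\<lambda>(j::nat) z. max 0 (1 - real j * infdist z (cis ` T)))"
  have Gc: "continuous_on S (G j)" for S j
    unfolding G_def by (intro continuous_intros)
  have Gb: "\<bar>G j z\<bar> \<le> 1" for j z unfolding G_def using infdist_nonneg[of z "cis ` T"] by (auto simp: max_def)
  have inT: "cis t \<in> cis ` T \<longleftrightarrow> t \<in> T" if "t \<in> {-pi..pi}" for t
  proof
    assume "cis t \<in> cis ` T"
    then obtain s where s: "s \<in> T" "cis t = cis s" by auto
    then have s': "-pi < s" "s < pi" using T by auto
    have "sin t = sin s" "cos t = cos s" using s(2) by (simp_all add: complex_eq_iff)
    then obtain m :: int where m: "t = s + 2 * pi * m" using sin_cos_eq_iff[of t s] by auto
    have "\<bar>2 * pi * real_of_int m\<bar> < 2 * pi" using that s' m by auto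
    then have "\<bar>real_of_int m\<bar> < 1" by (simp add: abs_mult)
    then have "m = 0" by linarith
    then show "t \<in> T" using m s by simp
  qed auto
  have lim: "(\<lambda>j. G j (cis t)) \<longlonglongrightarrow> indicator T t" if "t \<in> {-pi..pi}" for t
  proof (cases "t \<in> T")
    case True
    then show ?thesis by (simp add: G_def)
  next
    case False
    then have "cis t \<notin> cis ` T" using inT[OF that] by simp
    then have d: "infdist (cis t) (cis ` T) > 0"
      using infdist_pos_not_in_closed[OF compact_imp_closed[OF cc]] \<open>T \<noteq> {}\<close> by auto
    have "\<forall>\<^sub>F j in sequentially. G j (cis t) = 0"
    proof -
      have "\<forall>\<^sub>F j in sequentially. real j > 1 / infdist (cis t) (cis ` T)"
        using filterlim_real_sequentially by (auto simp: filterlim_at_top_dense)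
      then show ?thesis by eventually_elim (use d in \<open>auto simp: G_def field_simps\<close>)
    qed
    then show ?thesis using False by (simp add: tendsto_eventually)
  qed
  have m: "F \<in> borel_measurable circle" using i by simp
  have Ts: "T \<inter> {-pi..pi} \<in> sets circle" "T \<subseteq> {-pi..pi}"
    using T by (auto simp: sets_restrict_space)
  have Tm: "T \<in> sets circle" using Ts by (simp add: Int_absorb2)
  have "(\<lambda>j. LINT t|circle. F t * G j (cis t)) \<longlonglongrightarrow> (LINT t|circle. F t * indicator T t)"
  proof (rule integral_dominated_convergence[where w = "\<lambda>t. \<bar>F t\<bar>"])
    show "AE t in circle. (\<lambda>j. F t * G j (cis t)) \<longlonglongrightarrow> F t * indicator T t"
      by (rule AE_I2) (auto intro!: tendsto_mult lim simp: space_restrict_space)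
    show "AE t in circle. norm (F t * G j (cis t)) \<le> \<bar>F t\<bar>" for j
      by (rule AE_I2) (use Gb in \<open>auto simp: abs_mult mult_left_le\<close>)
    show "(\<lambda>t. F t * G j (cis t)) \<in> borel_measurable circle" for j
      using m continuous_cis_measurable[OF Gc] by simp
    show "(\<lambda>t. F t * indicator T t) \<in> borel_measurable circle"
      using m Tm by simp
  qed (use i in auto)
  then have "(\<lambda>j::nat. 0 :: real) \<longlonglongrightarrow> (LINT t|circle. F t * indicator T t)"
    using fourier_null_continuous[OF F Gc] by simp
  then show ?thesis
    by (simp add: LIMSEQ_const_iff set_lebesgue_integral_def mult.commute)
qed (simp add: set_lebesgue_integral_def)

text \<open>On a closed subset of the set where \<open>F > 0\<close> the integral of
  \<open>F\<close> is 0, so the subset is null; inner regularity then makes the whole set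
  null.\<close>

lemma fourier_null_AE_nonpos:
  assumes F: "fourier_null F"
  shows "AE t in circle. F t \<le> 0"
proof -
  have i: "integrable circle F" using F by (simp add: fourier_null_def)
  \<comment> \<open>Removing the two end points lets every closed subset fall under
    \<open>fourier_null_closed_set\<close>.\<close>
  define S where "S = {t \<in> {-pi..pi}. F t > 0} - {-pi, pi}"
  have Ss: "S \<in> sets circle"
  proof -
    have "{t \<in> space circle. F t > 0} \<in> sets circle" using i by measurable
    moreover have "{-pi, pi} \<in> sets circle" by (auto simp: sets_restrict_space_iff)
    ultimately show ?thesis unfolding S_def by (simp add: space_restrict_space sets.Diff)
  qed
  then have Sl: "S \<in> sets lebesgue" by (auto simp: sets_restrict_space)
  have "emeasure lebesgue S \<le> e" if e: "e > 0" for e :: real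
  proof -
    obtain T where T: "closed T" "T \<subseteq> S" "S - T \<in> lmeasurable" "emeasure lebesgue (S - T) < ennreal e"
      using sets_lebesgue_inner_closed[OF Sl e] by metis
    have Ts: "T \<in> sets circle"
      using T(1,2) by (auto simp: S_def sets_restrict_space_iff)
    have "T \<subseteq> {-pi<..<pi}" using T(2) by (auto simp: S_def)
    from null_if_pos_func_has_zero_int[OF i Ts _ fourier_null_closed_set[OF F T(1) this]]
    have "T \<in> null_sets circle" using T(2) by (auto simp: S_def)
    then have "T \<in> null_sets lebesgue" by (simp add: null_sets_restrict_space)
    then have "emeasure lebesgue S = emeasure lebesgue (S - T)"
      using emeasure_Diff_null_set[of T lebesgue S] Sl by simp
    then show ?thesis using T(4) by simp
  qed
  then have "emeasure lebesgue S \<le> 0 + ennreal e" if "e > 0" for e :: real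
    using that by simp
  then have "emeasure lebesgue S \<le> 0" by (rule ennreal_le_epsilon)
  then have "S \<in> null_sets lebesgue" using Sl by (simp add: null_sets_def)
  then have n: "S \<union> {-pi, pi} \<in> null_sets lebesgue" by (intro null_sets.Un) auto
  have "AE t in lebesgue. t \<in> {-pi..pi} \<longrightarrow> F t \<le> 0"
    by (rule AE_I'[OF n]) (auto simp: S_def)
  then show ?thesis by (subst AE_restrict_space_iff) auto
qed

lemma fourier_coeff_eq_imp_AE_eq:
  assumes "integrable circle f" "integrable circle g"
    and "\<And>k. fourier_coeff f k = fourier_coeff g k"
  shows "AE t in circle. f t = g t"
proof -
  have "fourier_null (\<lambda>t. f t - g t)" "fourier_null (\<lambda>t. g t - f t)"
    using assms by (auto simp: fourier_null_def fourier_coeff_diff)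
  from this[THEN fourier_null_AE_nonpos] show ?thesis by eventually_elim simp
qed

section \<open>Kernels with decreasing coefficients\<close>

lemma abel_summation:
  fixes a X :: "nat \<Rightarrow> real"
  assumes "X 0 = 0"
  shows "(\<Sum>k<N. a k * (X (Suc k) - X k)) = a N * X N + (\<Sum>k<N. (a k - a (Suc k)) * X (Suc k))"
  using assms by (induction N) (simp_all add: algebra_simps)

text \<open>Summation by parts forwards with the partial sums of \<open>d\<close>, termwise
  comparison with \<open>G\<close> because the differences of \<open>a\<close> are nonnegative, then
  summation by parts backwards with \<open>G\<close> in place of the partial sums.\<close>

lemma abel_bound:
  fixes a d G :: "nat \<Rightarrow> real"
  assumes a0: "\<And>k. 0 \<le> a k" and dec: "\<And>k. a (Suc k) \<le> a k" and G0: "G 0 = 0"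
    and bd: "\<And>k. \<bar>\<Sum>j<k. d j\<bar> \<le> G k"
  shows "\<bar>\<Sum>k<N. a k * d k\<bar> \<le> (\<Sum>k<N. a k * (G (Suc k) - G k))"
proof -
  define X where "X k = (\<Sum>j<k. d j)" for k
  have X: "X 0 = 0" "\<bar>X k\<bar> \<le> G k" "d k = X (Suc k) - X k" for k
    using bd by (auto simp: X_def)
  have "\<bar>\<Sum>k<N. a k * d k\<bar> = \<bar>a N * X N + (\<Sum>k<N. (a k - a (Suc k)) * X (Suc k))\<bar>"
    unfolding X(3) using abel_summation[of X a N] X(1) by simp
  also have "\<dots> \<le> a N * G N + (\<Sum>k<N. (a k - a (Suc k)) * G (Suc k))"
  proof (intro order_trans[OF abs_triangle_ineq] add_mono order_trans[OF sum_abs] sum_mono)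
    show "\<bar>a N * X N\<bar> \<le> a N * G N" using a0 X by (simp add: abs_mult mult_left_mono)
    show "\<bar>(a k - a (Suc k)) * X (Suc k)\<bar> \<le> (a k - a (Suc k)) * G (Suc k)" for k
      using dec[of k] X(2)[of "Suc k"] by (simp add: abs_mult mult_left_mono)
  qed
  also have "\<dots> = (\<Sum>k<N. a k * (G (Suc k) - G k))"
    using abel_summation[of G a N] G0 by simp
  finally show ?thesis .
qed

text \<open>The Boolean selects the parity: \<^term>\<open>True\<close> stands for cosines, \<^term>\<open>False\<close> for sines.\<close>

definition harmonic :: "bool \<Rightarrow> nat \<Rightarrow> real \<Rightarrow> real" where
  "harmonic c k t = (if c then cos (real k * t) else sin (real k * t))"

lemma abs_harmonic_le: "\<bar>harmonic c k t\<bar> \<le> 1"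
  by (simp add: harmonic_def)

lemma harmonic_periodic: "harmonic c k (t + 2 * pi) = harmonic c k t"
proof -
  have "real k * (t + 2 * pi) = real k * t + 2 * real k * pi" by (simp add: algebra_simps)
  then show ?thesis by (simp add: harmonic_def sin_add cos_add del: sin_cos_npi)
qed

lemma continuous_on_harmonic [continuous_intros]: "continuous_on S (harmonic c k)"
  unfolding harmonic_def by (cases c) (auto intro!: continuous_intros)

text \<open>For \<open>y = x / 2\<close>, which is at most \<open>pi / 4\<close>, both
  \<open>sin y \<ge> y * cos y\<close> and \<open>(cos y)^2 \<ge> 1 / 2\<close> hold, and
  \<open>sin x = 2 * sin y * cos y\<close>. The constant is weaker than Jordan's
  \<open>2 / pi\<close>; only the order of magnitude matters later.\<close>

lemma sin_ge_half: assumes "0 \<le> x" "x \<le> pi / 2" shows "x / 2 \<le> sin x"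
proof -
  define y where "y = x / 2"
  have y: "0 \<le> y" "y \<le> pi / 4" using assms by (auto simp: y_def)
  have "(\<lambda>y. sin y - y * cos y) 0 \<le> (\<lambda>y. sin y - y * cos y) y"
  proof (rule DERIV_nonneg_imp_nondecreasing[OF y(1)])
    fix z assume z: "0 \<le> z" "z \<le> y"
    have "((\<lambda>y. sin y - y * cos y) has_real_derivative z * sin z) (at z)"
      by (auto intro!: derivative_eq_intros)
    moreover have "0 \<le> z * sin z" using z y by (intro mult_nonneg_nonneg sin_ge_zero) auto
    ultimately show "\<exists>D. ((\<lambda>y. sin y - y * cos y) has_real_derivative D) (at z) \<and> 0 \<le> D" by blast
  qed
  then have s: "y * cos y \<le> sin y" by simp
  have c: "cos (pi / 4) \<le> cos y" using y by (intro cos_monotone_0_pi_le) auto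
  have c0: "0 \<le> cos y" using y by (intro cos_ge_zero) auto
  have "cos (pi / 4) * cos (pi / 4) \<le> cos y * cos y" using c c0 by (intro mult_mono) (auto simp: cos_45)
  then have c2: "1 / 2 \<le> cos y * cos y" by (simp add: cos_45)
  have "x / 2 = 2 * y * (1/2)" by (simp add: y_def)
  also have "\<dots> \<le> 2 * y * (cos y * cos y)" using y c2 by (intro mult_left_mono) auto
  also have "\<dots> = 2 * (y * cos y) * cos y" by simp
  also have "\<dots> \<le> 2 * sin y * cos y" using s c0 by (intro mult_right_mono) auto
  also have "\<dots> = sin x" using sin_double[of y] by (simp add: y_def)
  finally show ?thesis .
qed

lemma abs_sin_half_ge: assumes "\<bar>t\<bar> \<le> pi" shows "\<bar>t\<bar> / 4 \<le> \<bar>sin (t / 2)\<bar>"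
proof -
  have "\<bar>t\<bar> / 4 \<le> sin (\<bar>t\<bar> / 2)" using sin_ge_half[of "\<bar>t\<bar> / 2"] assms by simp
  also have "\<dots> \<le> \<bar>sin (\<bar>t\<bar> / 2)\<bar>" by simp
  also have "\<dots> = \<bar>sin (t / 2)\<bar>" by (cases "t \<ge> 0") auto
  finally show ?thesis .
qed

text \<open>Multiplication by \<open>2 * sin (t / 2)\<close> makes the sum telescope to a difference
  of two values in \<open>[-1, 1]\<close>; the lower bound \<open>|t| / 4\<close> for the sine
  supplies the constant 4.\<close>

lemma abs_sum_harmonic_le:
  assumes t: "0 < \<bar>t\<bar>" "\<bar>t\<bar> \<le> pi"
  shows "\<bar>\<Sum>j<k. harmonic c (m + j) t\<bar> \<le> 4 / \<bar>t\<bar>"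
proof -
  have s: "\<bar>t\<bar> / 4 \<le> \<bar>sin (t / 2)\<bar>" by (rule abs_sin_half_ge) fact
  have S: "2 * sin (t / 2) * (\<Sum>j<k. sin (real (m + j) * t)) =
      cos ((real m - 1/2) * t) - cos ((real m + real k - 1/2) * t)"
  proof (induction k)
    case (Suc k)
    have "cos ((real m + real k - 1/2) * t) - cos ((real m + real (Suc k) - 1/2) * t) = 2 * sin (t / 2) * sin (real (m + k) * t)"
      by (subst cos_diff_cos) (simp add: algebra_simps add_divide_distrib diff_divide_distrib)
    then show ?case using Suc by (simp add: algebra_simps)
  qed simp
  have C: "2 * sin (t / 2) * (\<Sum>j<k. cos (real (m + j) * t)) =
      sin ((real m + real k - 1/2) * t) - sin ((real m - 1/2) * t)"
  proof (induction k)
    case (Suc k)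
    have "sin ((real m + real (Suc k) - 1/2) * t) - sin ((real m + real k - 1/2) * t) = 2 * sin (t / 2) * cos (real (m + k) * t)"
      by (subst sin_diff_sin) (simp add: algebra_simps add_divide_distrib diff_divide_distrib)
    then show ?case using Suc by (simp add: algebra_simps)
  qed simp
  have b: "\<bar>u - v\<bar> \<le> 2" if "\<bar>u\<bar> \<le> 1" "\<bar>v\<bar> \<le> 1" for u v :: real using that by linarith
  have "\<bar>2 * sin (t / 2) * (\<Sum>j<k. harmonic c (m + j) t)\<bar> \<le> 2"
    by (cases c) (simp_all only: harmonic_def if_True if_False S C b abs_sin_le_one abs_cos_le_one)
  then have 1: "\<bar>sin (t / 2)\<bar> * \<bar>\<Sum>j<k. harmonic c (m + j) t\<bar> \<le> 1" by (simp add: abs_mult)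
  have "(\<bar>t\<bar> / 4) * \<bar>\<Sum>j<k. harmonic c (m + j) t\<bar> \<le> \<bar>sin (t / 2)\<bar> * \<bar>\<Sum>j<k. harmonic c (m + j) t\<bar>"
    using s by (intro mult_right_mono) auto
  with 1 have "(\<bar>t\<bar> / 4) * \<bar>\<Sum>j<k. harmonic c (m + j) t\<bar> \<le> 1" by linarith
  then show ?thesis using t by (simp add: field_simps)
qed

text \<open>The factor 2 makes \<open>a k\<close> the complex Fourier coefficient at
  \<open>k\<close> and \<open>-k\<close> up to a phase, as in \<open>psi\<close>; there is no
  constant term.\<close>

definition kernel :: "bool \<Rightarrow> (nat \<Rightarrow> real) \<Rightarrow> real \<Rightarrow> real" where
  "kernel c a t = (\<Sum>j. 2 * a (Suc j) * harmonic c (Suc j) t)"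

definition kernel_sum :: "bool \<Rightarrow> (nat \<Rightarrow> real) \<Rightarrow> nat \<Rightarrow> real \<Rightarrow> real" where
  "kernel_sum c a N t = (\<Sum>j<N. 2 * a (Suc j) * harmonic c (Suc j) t)"

lemma kernel_finite:
  assumes "\<And>k. k > N \<Longrightarrow> a k = 0"
  shows "kernel c a = kernel_sum c a N"
  unfolding kernel_def kernel_sum_def fun_eq_iff
  by (intro allI suminf_finite) (auto intro!: assms)

text \<open>The majorant \<open>G\<close> jumps only once, from 0 to \<open>8 / |t|\<close>, so
  after \<open>abel_bound\<close> only the first coefficient of the tail survives.\<close>

lemma kernel_sum_tail:
  assumes a0: "\<And>k. 0 \<le> a (Suc k)" and dec: "\<And>k. a (Suc (Suc k)) \<le> a (Suc k)"
    and t: "0 < \<bar>t\<bar>" "\<bar>t\<bar> \<le> pi"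
  shows "\<bar>kernel_sum c a (N + n) t - kernel_sum c a N t\<bar> \<le> 8 * a (Suc N) / \<bar>t\<bar>"
proof -
  define G where "G k = (if k = 0 then 0 else 8 / \<bar>t\<bar>)" for k :: nat
  have "kernel_sum c a (N + n) t - kernel_sum c a N t = (\<Sum>k<n. a (Suc (N + k)) * (2 * harmonic c (Suc N + k) t))"
    unfolding kernel_sum_def by (induction n) (simp_all add: algebra_simps)
  also have "\<bar>\<dots>\<bar> \<le> (\<Sum>k<n. a (Suc (N + k)) * (G (Suc k) - G k))"
  proof (rule abel_bound)
    show "\<bar>\<Sum>j<k. 2 * harmonic c (Suc N + j) t\<bar> \<le> G k" for k
      using abs_sum_harmonic_le[OF t, where c = c and m = "Suc N" and k = k]
      by (cases k) (auto simp: G_def sum_distrib_left[symmetric] abs_mult simp del: sum.lessThan_Suc)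
  qed (use a0 dec in \<open>auto simp: G_def\<close>)
  also have "\<dots> \<le> 8 * a (Suc N) / \<bar>t\<bar>"
  proof (cases n)
    case (Suc m)
    have "(\<Sum>k<n. a (Suc (N + k)) * (G (Suc k) - G k)) = (\<Sum>k<n. if k = 0 then 8 * a (Suc N) / \<bar>t\<bar> else 0)"
      by (intro sum.cong) (auto simp: G_def)
    then show ?thesis using Suc by (simp add: sum.delta)
  qed (use a0 in auto)
  finally show ?thesis .
qed

text \<open>A bound that is integrable in \<open>t\<close> and uniform in \<open>N\<close>, even for small \<open>r\<close>: the sums of \<open>k\<close>
  harmonics are at most \<open>min k (4 / \<bar>t\<bar>) \<le> k powr (1 - s) * (4 / \<bar>t\<bar>) powr s\<close>.\<close>

lemma harmonic_series_dominated:
  fixes s r C t :: real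
  assumes a0: "\<And>k. 0 \<le> a (Suc k)" and dec: "\<And>k. a (Suc (Suc k)) \<le> a (Suc k)"
    and bd: "\<And>k. a (Suc k) \<le> C * real (Suc k) powr - r"
    and s: "0 < s" "s < 1" "r + s > 1" and t: "0 < \<bar>t\<bar>" "\<bar>t\<bar> \<le> pi" and C: "0 \<le> C"
  shows "\<bar>kernel_sum c a N t\<bar> \<le> 2 * 4 powr s * C * (\<Sum>k. real (Suc k) powr - (r + s)) * \<bar>t\<bar> powr - s"
proof -
  define A where "A = 4 / \<bar>t\<bar>"
  have A: "A > 0" using t by (simp add: A_def)
  define G where "G k = real k powr (1 - s) * A powr s" for k :: nat
  have D: "\<bar>\<Sum>j<k. harmonic c (Suc j) t\<bar> \<le> G k" for k
  proof -
    define x where "x = \<bar>\<Sum>j<k. harmonic c (Suc j) t\<bar>"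
    have x: "0 \<le> x" "x \<le> A" using abs_sum_harmonic_le[OF t, of c 1 k] by (auto simp: x_def A_def)
    have xk: "x \<le> real k"
      unfolding x_def by (rule order_trans[OF sum_abs]) (use sum_mono[of "{..<k}" "\<lambda>j. \<bar>harmonic c (Suc j) t\<bar>" "\<lambda>_. 1"] abs_harmonic_le in auto)
    have "x = x powr (1 - s) * x powr s" using x by (cases "x = 0") (auto simp: powr_add[symmetric])
    also have "\<dots> \<le> real k powr (1 - s) * A powr s"
      using x xk s by (intro mult_mono powr_mono2) auto
    finally show ?thesis by (simp add: x_def G_def)
  qed
  \<comment> \<open>The increments of \<open>k powr (1 - s)\<close> are at most
    \<open>(k + 1) powr - s\<close>; together with the decay of \<open>a\<close> this leaves the
    convergent series with exponent \<open>r + s\<close>.\<close>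
  have Gd: "G (Suc k) - G k \<le> real (Suc k) powr - s * A powr s" for k
  proof -
    have 1: "real (Suc k) powr (1 - s) = real (Suc k) * real (Suc k) powr - s"
      using powr_add[of "real (Suc k)" 1 "- s"] by simp
    have 2: "real k * real (Suc k) powr - s \<le> real k powr (1 - s)"
    proof (cases "k = 0")
      case False
      have "real k * real (Suc k) powr - s \<le> real k * real k powr - s"
        using False s by (intro mult_left_mono powr_mono2') auto
      also have "\<dots> = real k powr (1 - s)" using False powr_add[of "real k" 1 "- s"] by simp
      finally show ?thesis .
    qed simp
    have "real (Suc k) powr (1 - s) - real k powr (1 - s) \<le> real (Suc k) powr - s"
      using 1 2 by (simp add: algebra_simps)
    then have "(real (Suc k) powr (1 - s) - real k powr (1 - s)) * A powr s \<le> real (Suc k) powr - s * A powr s"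
      by (rule mult_right_mono) simp
    then show ?thesis by (simp add: G_def algebra_simps)
  qed
  have sm: "summable (\<lambda>k. real (Suc k) powr - (r + s))"
    using summable_real_powr_iff[of "-(r+s)"] s by (subst summable_Suc_iff) simp
  have "\<bar>\<Sum>k<N. a (Suc k) * harmonic c (Suc k) t\<bar> \<le> (\<Sum>k<N. a (Suc k) * (G (Suc k) - G k))"
    using a0 dec D by (intro abel_bound) (auto simp: G_def)
  also have "\<dots> \<le> (\<Sum>k<N. (C * real (Suc k) powr - r) * (real (Suc k) powr - s * A powr s))"
  proof (intro sum_mono)
    fix k
    have "a (Suc k) * (G (Suc k) - G k) \<le> a (Suc k) * (real (Suc k) powr - s * A powr s)"
      by (rule mult_left_mono[OF Gd a0])
    also have "\<dots> \<le> (C * real (Suc k) powr - r) * (real (Suc k) powr - s * A powr s)"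
      by (rule mult_right_mono[OF bd]) simp
    finally show "a (Suc k) * (G (Suc k) - G k) \<le> (C * real (Suc k) powr - r) * (real (Suc k) powr - s * A powr s)" .
  qed
  also have "\<dots> = C * A powr s * (\<Sum>k<N. real (Suc k) powr - (r + s))"
    by (simp add: sum_distrib_left mult_ac powr_add[symmetric] del: of_nat_Suc)
  also have "\<dots> \<le> C * A powr s * (\<Sum>k. real (Suc k) powr - (r + s))"
    using C by (intro mult_left_mono sum_le_suminf sm) auto
  also have "A powr s = 4 powr s * \<bar>t\<bar> powr - s"
    using t unfolding A_def by (subst powr_divide) (simp_all add: powr_minus_divide)
  finally have "\<bar>\<Sum>k<N. a (Suc k) * harmonic c (Suc k) t\<bar> \<le> C * (4 powr s * \<bar>t\<bar> powr - s) * (\<Sum>k. real (Suc k) powr - (r + s))" .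
  moreover have "kernel_sum c a N t = 2 * (\<Sum>k<N. a (Suc k) * harmonic c (Suc k) t)"
    by (simp add: kernel_sum_def sum_distrib_left mult.assoc)
  ultimately show ?thesis by (simp add: abs_mult mult_ac)
qed

lemma integrable_abs_powr:
  assumes "0 < s" "s < 1"
  shows "integrable circle (\<lambda>t. \<bar>t\<bar> powr - s)"
proof -
  have m: "(\<lambda>t::real. \<bar>t\<bar> powr - s) \<in> borel_measurable lebesgue"
    by (rule measurable_completion) measurable
  have i: "integrable lebesgue (\<lambda>t. indicator {0..pi} t *\<^sub>R \<bar>t\<bar> powr - s)"
  proof -
    have "(\<lambda>t. t powr - s) absolutely_integrable_on {0..pi}"
      by (rule nonnegative_absolutely_integrable_1 [OF integrable_on_powr_from_0]) (use assms in auto)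
    then show ?thesis unfolding set_integrable_def
      by (rule Bochner_Integration.integrable_cong[THEN iffD1, rotated 2]) (auto simp: indicator_def)
  qed
  have i2: "integrable lebesgue (\<lambda>t. indicator {0..pi} (0 + (-1) * t) *\<^sub>R \<bar>0 + (-1) * t\<bar> powr - s)"
    using lebesgue_integrable_real_affine_iff[of "-1" "\<lambda>t. indicator {0..pi} t *\<^sub>R \<bar>t\<bar> powr - s" 0] i by simp
  have m2: "(\<lambda>t. indicator {-pi..pi} t *\<^sub>R \<bar>t\<bar> powr - s) \<in> borel_measurable lebesgue"
    by (intro borel_measurable_scaleR borel_measurable_indicator m) auto
  have "integrable lebesgue (\<lambda>t. indicator {-pi..pi} t *\<^sub>R \<bar>t\<bar> powr - s)"
    by (rule Bochner_Integration.integrable_bound[OF Bochner_Integration.integrable_add[OF i i2] m2])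
       (auto simp: indicator_def)
  then show ?thesis by (simp add: integrable_restrict_space)
qed

text \<open>\<open>r\<close> and \<open>C\<close> are parameters so that one majorant can serve a
  whole family, for instance all truncations of a sequence.\<close>

definition decreasing_coeffs :: "real \<Rightarrow> real \<Rightarrow> (nat \<Rightarrow> real) \<Rightarrow> bool" where
  "decreasing_coeffs r C a \<longleftrightarrow>
    (\<forall>k. 0 \<le> a (Suc k) \<and> a (Suc (Suc k)) \<le> a (Suc k) \<and> a (Suc k) \<le> C * real (Suc k) powr - r)"

lemma decreasing_coeffs_tendsto:
  assumes "decreasing_coeffs r C a" "r > 0"
  shows "(\<lambda>k. a (Suc k)) \<longlonglongrightarrow> 0"
proof (rule tendsto_sandwich[of "\<lambda>_. 0" _ _ "\<lambda>k. C * real (Suc k) powr - r"])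
  have "(\<lambda>k. real k powr - r) \<longlonglongrightarrow> 0"
    by (rule tendsto_neg_powr[OF _ filterlim_real_sequentially]) (use assms in auto)
  then have "(\<lambda>k. C * real (Suc k) powr - r) \<longlonglongrightarrow> C * 0"
    by (intro tendsto_mult tendsto_const LIMSEQ_Suc)
  then show "(\<lambda>k. C * real (Suc k) powr - r) \<longlonglongrightarrow> 0" by simp
qed (use assms in \<open>auto simp: decreasing_coeffs_def\<close>)

lemma continuous_lebesgue_measurable:
  fixes f :: "real \<Rightarrow> real"
  shows "continuous_on UNIV f \<Longrightarrow> f \<in> borel_measurable lebesgue"
  by (intro measurable_completion) (simp add: borel_measurable_continuous_onI)

lemma harmonic_measurable: "harmonic c k \<in> borel_measurable lebesgue"
  by (intro continuous_lebesgue_measurable continuous_on_harmonic)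

lemma kernel_measurable: "kernel c a \<in> borel_measurable lebesgue"
proof -
  have "harmonic c (Suc j) \<in> borel_measurable borel" for j
    by (intro borel_measurable_continuous_onI continuous_intros)
  note [measurable] = this
  show ?thesis
    unfolding kernel_def by (intro measurable_completion) measurable
qed

lemma kernel_periodic: "kernel c a (t + 2 * pi) = kernel c a t"
  by (simp add: kernel_def harmonic_periodic)

lemma kernel_sum_tendsto:
  assumes dc: "decreasing_coeffs r C a" and r: "r > 0" and t: "0 < \<bar>t\<bar>" "\<bar>t\<bar> \<le> pi"
  shows "(\<lambda>N. kernel_sum c a N t) \<longlonglongrightarrow> kernel c a t"
    and "\<bar>kernel c a t - kernel_sum c a N t\<bar> \<le> 8 * a (Suc N) / \<bar>t\<bar>"
proof -
  have tail: "\<bar>kernel_sum c a (N + n) t - kernel_sum c a N t\<bar> \<le> 8 * a (Suc N) / \<bar>t\<bar>" for N n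
    by (rule kernel_sum_tail[OF _ _ t]) (use dc in \<open>auto simp: decreasing_coeffs_def\<close>)
  have lim: "(\<lambda>N. 8 * a (Suc N) / \<bar>t\<bar>) \<longlonglongrightarrow> 8 * 0 / \<bar>t\<bar>"
    by (intro tendsto_intros decreasing_coeffs_tendsto[OF dc r]) (use t in auto)
  have "Cauchy (\<lambda>N. kernel_sum c a N t)"
  proof (rule CauchyI')
    fix e :: real assume "0 < e"
    from order_tendstoD(2)[OF lim, of e] this obtain N where N: "\<And>m. m \<ge> N \<Longrightarrow> 8 * a (Suc m) / \<bar>t\<bar> < e"
      by (auto simp: eventually_sequentially)
    have "dist (kernel_sum c a m t) (kernel_sum c a n t) < e" if "m \<ge> N" "m < n" for m n
      using tail[of m "n - m"] N[OF that(1)] that(2) by (simp add: dist_real_def abs_minus_commute)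
    then show "\<exists>M. \<forall>m\<ge>M. \<forall>n>m. dist (kernel_sum c a m t) (kernel_sum c a n t) < e" by blast
  qed
  then have "convergent (\<lambda>N. kernel_sum c a N t)" by (simp add: Cauchy_convergent_iff)
  then have "summable (\<lambda>j. 2 * a (Suc j) * harmonic c (Suc j) t)"
    unfolding kernel_sum_def summable_iff_convergent .
  then show L: "(\<lambda>N. kernel_sum c a N t) \<longlonglongrightarrow> kernel c a t"
    unfolding kernel_sum_def kernel_def by (rule summable_LIMSEQ)
  have "(\<lambda>n. \<bar>kernel_sum c a (N + n) t - kernel_sum c a N t\<bar>) \<longlonglongrightarrow> \<bar>kernel c a t - kernel_sum c a N t\<bar>"
    using LIMSEQ_ignore_initial_segment[OF L, of N] by (intro tendsto_intros) (simp add: add.commute)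
  then show "\<bar>kernel c a t - kernel_sum c a N t\<bar> \<le> 8 * a (Suc N) / \<bar>t\<bar>"
    by (rule LIMSEQ_le_const2) (use tail in auto)
qed

lemma kernel_dominated:
  assumes r: "r > 0" and C: "0 \<le> C"
  obtains w where "integrable circle w"
    and "\<And>a c t. decreasing_coeffs r C a \<Longrightarrow> 0 < \<bar>t\<bar> \<Longrightarrow> \<bar>t\<bar> \<le> pi \<Longrightarrow> \<bar>kernel c a t\<bar> \<le> w t"
proof -
  \<comment> \<open>Any \<open>s\<close> strictly between 0 and 1 with \<open>r + s > 1\<close>
    would do: the series with exponent \<open>r + s\<close> converges and
    \<open>|t| powr - s\<close> is integrable at 0.\<close>
  define s where "s = 1 - min r 1 / 2"
  have s: "0 < s" "s < 1" "r + s > 1" using r by (auto simp: s_def min_def)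
  define w where "w t = 2 * 4 powr s * C * (\<Sum>k. real (Suc k) powr - (r + s)) * \<bar>t\<bar> powr - s" for t
  show ?thesis
  proof (rule that)
    show "integrable circle w"
      unfolding w_def using integrable_abs_powr[OF s(1,2)] by auto
  next
    fix a c and t :: real assume dc: "decreasing_coeffs r C a" and t: "0 < \<bar>t\<bar>" "\<bar>t\<bar> \<le> pi"
    have "(\<lambda>N. \<bar>kernel_sum c a N t\<bar>) \<longlonglongrightarrow> \<bar>kernel c a t\<bar>"
      by (intro tendsto_intros kernel_sum_tendsto(1)[OF dc r t])
    then show "\<bar>kernel c a t\<bar> \<le> w t"
    proof (rule LIMSEQ_le_const2)
      show "\<exists>N. \<forall>n\<ge>N. \<bar>kernel_sum c a n t\<bar> \<le> w t"
        using harmonic_series_dominated[OF _ _ _ s t C, of a] dc by (auto simp: w_def decreasing_coeffs_def)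
    qed
  qed
qed

lemma AE_period_nonzero: "AE t in circle. 0 < \<bar>t\<bar> \<and> \<bar>t\<bar> \<le> pi"
proof -
  have "AE t in lebesgue. t \<in> {-pi..pi} \<longrightarrow> 0 < \<bar>t\<bar> \<and> \<bar>t\<bar> \<le> (pi::real)"
    by (rule AE_I'[of "{0}"]) auto
  then show ?thesis by (subst AE_restrict_space_iff) auto
qed

lemma integrable_kernel:
  assumes dc: "decreasing_coeffs r C a" and r: "r > 0" and C: "0 \<le> C"
  shows "periodic_integrable (kernel c a)"
proof
  obtain w where w: "integrable circle w"
    and wb: "\<And>a c t. decreasing_coeffs r C a \<Longrightarrow> 0 < \<bar>t\<bar> \<Longrightarrow> \<bar>t\<bar> \<le> pi \<Longrightarrow> \<bar>kernel c a t\<bar> \<le> w t"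
    using kernel_dominated[OF r C] by blast
  show "integrable circle (kernel c a)"
  proof (rule Bochner_Integration.integrable_bound[OF w])
    show "AE t in circle. norm (kernel c a t) \<le> norm (w t)"
      using AE_period_nonzero
    proof eventually_elim
      case (elim t)
      then show ?case using wb[OF dc, of t c] by auto
    qed
  qed (simp add: kernel_measurable)
qed (simp_all add: kernel_measurable kernel_periodic)

text \<open>Dominated convergence with the common majorant. For the pointwise limit,
  \<open>b M \<le> a\<close> bounds the tails of all \<open>kernel c (b M)\<close> by that of
  \<open>a\<close>, uniformly in \<open>M\<close>; the remaining finite sum converges
  coefficientwise.\<close>

lemma kernel_L1_tendsto:
  assumes dc: "decreasing_coeffs r C a" and r: "r > 0" and C: "0 \<le> C"
    and db: "\<And>M. decreasing_coeffs r C (b M)" and ba: "\<And>M k. b M (Suc k) \<le> a (Suc k)"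
    and lim: "\<And>k. (\<lambda>M. b M (Suc k)) \<longlonglongrightarrow> a (Suc k)"
  shows "(\<lambda>M. LINT t|circle. \<bar>kernel c (b M) t - kernel c a t\<bar>) \<longlonglongrightarrow> 0"
proof -
  obtain w where w: "integrable circle w"
    and wb: "\<And>a c t. decreasing_coeffs r C a \<Longrightarrow> 0 < \<bar>t\<bar> \<Longrightarrow> \<bar>t\<bar> \<le> pi \<Longrightarrow> \<bar>kernel c a t\<bar> \<le> w t"
    using kernel_dominated[OF r C] by blast
  have pt: "(\<lambda>M. \<bar>kernel c (b M) t - kernel c a t\<bar>) \<longlonglongrightarrow> 0" if t: "0 < \<bar>t\<bar>" "\<bar>t\<bar> \<le> pi" for t
  proof (rule LIMSEQ_I)
    fix e :: real assume e: "0 < e"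
    have "(\<lambda>N. 8 * a (Suc N) / \<bar>t\<bar>) \<longlonglongrightarrow> 8 * 0 / \<bar>t\<bar>"
      by (intro tendsto_intros decreasing_coeffs_tendsto[OF dc r]) (use t in auto)
    from order_tendstoD(2)[OF this, of "e/3"] e obtain N where N: "8 * a (Suc N) / \<bar>t\<bar> < e / 3"
      by (auto simp: eventually_sequentially)
    have "(\<lambda>M. kernel_sum c (b M) N t) \<longlonglongrightarrow> kernel_sum c a N t"
      unfolding kernel_sum_def by (intro tendsto_intros lim)
    from tendstoD[OF this, of "e/3"] e obtain M0 where
      M0: "\<And>M. M \<ge> M0 \<Longrightarrow> \<bar>kernel_sum c (b M) N t - kernel_sum c a N t\<bar> < e / 3"
      by (auto simp: eventually_sequentially dist_real_def)
    have "norm (\<bar>kernel c (b M) t - kernel c a t\<bar> - 0) < e" if "M \<ge> M0" for M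
    proof -
      have "8 * b M (Suc N) / \<bar>t\<bar> \<le> 8 * a (Suc N) / \<bar>t\<bar>" using ba[of M N] t by (simp add: divide_right_mono)
      then show ?thesis
        using M0[OF that] N kernel_sum_tendsto(2)[OF dc r t, of c N] kernel_sum_tendsto(2)[OF db r t, of c M N]
        by (simp add: abs_if split: if_splits)
    qed
    then show "\<exists>M0. \<forall>M\<ge>M0. norm (\<bar>kernel c (b M) t - kernel c a t\<bar> - 0) < e" by blast
  qed
  have "(\<lambda>M. LINT t|circle. \<bar>kernel c (b M) t - kernel c a t\<bar>) \<longlonglongrightarrow> (LINT t|circle. 0)"
  proof (rule integral_dominated_convergence[where w = "\<lambda>t. 2 * w t"])
    show "AE t in circle. (\<lambda>M. \<bar>kernel c (b M) t - kernel c a t\<bar>) \<longlonglongrightarrow> 0"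
      using AE_period_nonzero by eventually_elim (use pt in auto)
    show "AE t in circle. norm \<bar>kernel c (b M) t - kernel c a t\<bar> \<le> 2 * w t" for M
      using AE_period_nonzero
    proof eventually_elim
      case (elim t)
      then show ?case using wb[OF dc, of t c] wb[OF db, of t c M] by auto
    qed
    show "(\<lambda>t. \<bar>kernel c (b M) t - kernel c a t\<bar>) \<in> borel_measurable circle" for M
      by (intro borel_measurable_abs borel_measurable_diff measurable_period kernel_measurable)
  qed (use w in auto)
  then show ?thesis by simp
qed

lemma kernel_sum_eq_kernel: "kernel_sum c a N = kernel c (\<lambda>k. if k \<le> N then a k else 0)"
  by (subst kernel_finite[of N]) (auto simp: kernel_sum_def fun_eq_iff)

lemma decreasing_coeffs_truncate:
  "decreasing_coeffs r C a \<Longrightarrow> 0 \<le> C \<Longrightarrow> decreasing_coeffs r C (\<lambda>k. if k \<le> N then a k else 0)"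
  by (auto simp: decreasing_coeffs_def)

lemma kernel_sum_L1_tendsto:
  assumes dc: "decreasing_coeffs r C a" and r: "r > 0" and C: "0 \<le> C"
  shows "(\<lambda>N. LINT t|circle. \<bar>kernel_sum c a N t - kernel c a t\<bar>) \<longlonglongrightarrow> 0"
  unfolding kernel_sum_eq_kernel
proof (rule kernel_L1_tendsto[OF dc r C decreasing_coeffs_truncate[OF dc C]])
  show "(\<lambda>N. if Suc k \<le> N then a (Suc k) else 0) \<longlonglongrightarrow> a (Suc k)" for k
    by (rule tendsto_eventually, rule eventually_sequentiallyI[of "Suc k"]) simp
  show "(if Suc k \<le> N then a (Suc k) else 0) \<le> a (Suc k)" for N k
    using dc by (auto simp: decreasing_coeffs_def)
qed

section \<open>Fourier coefficients of harmonics and kernels\<close>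

lemma integrable_harmonic: "integrable circle (harmonic c k)"
proof (rule finite_measure.integrable_const_bound[OF finite_measure_period, where B = 1])
qed (auto simp: abs_harmonic_le harmonic_measurable)

lemma integrable_kernel_sum: "integrable circle (kernel_sum c a N)"
  unfolding kernel_sum_def using integrable_harmonic by (intro Bochner_Integration.integrable_sum) auto

text \<open>The coefficients of \<open>2 * cos (k * t)\<close> and of \<open>2 * sin (k * t)\<close>
  at the frequencies \<open>k\<close> and \<open>-k\<close>.\<close>

definition parity_coeff :: "bool \<Rightarrow> int \<Rightarrow> complex" where
  "parity_coeff c k = (if k = 0 then 0 else if c then 1 else - \<i> * of_int (sgn k))"

lemma integral_exp_period:
  "(LINT t|circle. fourier_exp k t) = (if k = 0 then 2 * pi else 0)"
proof (cases "k = 0")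
  case True
  then show ?thesis by (simp add: measure_restrict_space scaleR_conv_of_real)
next
  case False
  define F where "F t = fourier_exp k t / (- \<i> * of_int k)" for t
  have d: "(F has_vector_derivative fourier_exp k t) (at t within S)" for t S
    unfolding F_def by (rule has_vector_derivative_real_field) (use False in \<open>auto intro!: derivative_eq_intros\<close>)
  have "((\<lambda>t. fourier_exp k t) has_integral (F pi - F (- pi))) {-pi..pi}"
    by (rule fundamental_theorem_of_calculus[OF _ d]) simp
  moreover have "F pi = F (- pi)"
    using exp_minus_ii_periodic[of k "-pi"] by (simp add: F_def)
  moreover have "integrable circle (\<lambda>t. fourier_exp k t)"
    using integrable_exp_period[of "\<lambda>_. 1" k] finite_measure.emeasure_finite[OF finite_measure_period]
    by (simp add: finite_measure.integrable_const[OF finite_measure_period])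
  ultimately show ?thesis using False
    by (simp add: lebesgue_integral_eq_integral integral_unique)
qed

lemma fourier_coeff_harmonic:
  assumes "k > 0"
  shows "fourier_coeff (harmonic c k) m = (if \<bar>m\<bar> = int k then parity_coeff c m / 2 else 0)"
proof -
  have i: "integrable circle (\<lambda>t. fourier_exp k t)" for k
    using integrable_exp_period[of "\<lambda>_. 1" k] by (simp add: finite_measure.integrable_const[OF finite_measure_period])
  define u v :: complex where "u = (if c then 1 / 2 else - \<i> / 2)" and "v = (if c then 1 / 2 else \<i> / 2)"
  have e: "complex_of_real (harmonic c k t) * fourier_exp m t =
     u * fourier_exp (m - int k) t + v * fourier_exp (m + int k) t" for t
  proof -
    have 1: "fourier_exp (m - int k) t = fourier_exp m t * cis (real k * t)"
      unfolding cis_conv_exp exp_add[symmetric] by (simp add: algebra_simps)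
    have 2: "fourier_exp (m + int k) t = fourier_exp m t * cis (- (real k * t))"
      unfolding cis_conv_exp exp_add[symmetric] by (simp add: algebra_simps)
    have 3: "complex_of_real (harmonic c k t) = u * cis (real k * t) + v * cis (- (real k * t))"
      by (simp add: u_def v_def harmonic_def complex_eq_iff)
    show ?thesis unfolding 1 2 3 by (simp add: algebra_simps)
  qed
  have "fourier_coeff (harmonic c k) m = (u * (if m - int k = 0 then 2 * pi else 0) + v * (if m + int k = 0 then 2 * pi else 0)) / (2 * pi)"
    unfolding fourier_coeff_eq_period e
    using i by (subst Bochner_Integration.integral_add) (simp_all only: integrable_mult_right integral_mult_right_zero integral_exp_period)
  then show ?thesis
    using assms by (auto simp: u_def v_def parity_coeff_def)
qed

lemma fourier_coeff_diff_le:
  assumes "integrable circle f" "integrable circle g"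
  shows "norm (fourier_coeff f k - fourier_coeff g k) \<le> (LINT t|circle. \<bar>f t - g t\<bar>) / (2 * pi)"
proof -
  have "norm (LINT t|circle. complex_of_real (f t - g t) * fourier_exp k t) \<le> (LINT t|circle. \<bar>f t - g t\<bar>)"
    by (rule Bochner_Integration.integral_norm_bound_integral[OF integrable_exp_period])
       (use assms in \<open>auto simp: norm_mult norm_exp_eq_Re\<close>)
  moreover have "fourier_coeff f k - fourier_coeff g k =
      (LINT t|circle. complex_of_real (f t - g t) * fourier_exp k t) / (2 * pi)"
    using fourier_coeff_diff[OF assms, of k] unfolding fourier_coeff_eq_period[of "\<lambda>t. f t - g t"] by simp
  ultimately show ?thesis
    by (simp only: norm_divide) (simp add: divide_right_mono)
qed

lemma fourier_coeff_kernel_sum: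
  "fourier_coeff (kernel_sum c a N) m = (if nat \<bar>m\<bar> \<le> N then parity_coeff c m * a (nat \<bar>m\<bar>) else 0)"
proof (induction N)
  case 0
  then show ?case by (auto simp: kernel_sum_def fourier_coeff_eq_period parity_coeff_def)
next
  case (Suc N)
  have "kernel_sum c a (Suc N) = (\<lambda>t. kernel_sum c a N t + 2 * a (Suc N) * harmonic c (Suc N) t)"
    by (simp add: kernel_sum_def fun_eq_iff)
  then have "fourier_coeff (kernel_sum c a (Suc N)) m =
      fourier_coeff (kernel_sum c a N) m + 2 * a (Suc N) * fourier_coeff (harmonic c (Suc N)) m"
    using integrable_harmonic by (simp add: fourier_coeff_add integrable_kernel_sum fourier_coeff_cmult)
  moreover have "nat (1 + int N) = Suc N" by simp
  ultimately show ?case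
    unfolding Suc.IH by (auto simp: fourier_coeff_harmonic not_le)
qed

text \<open>Fourier coefficients are continuous in \<open>L_1\<close>, the partial sums converge in
  \<open>L_1\<close>, and each coefficient of the partial sums is eventually constant.\<close>

lemma fourier_coeff_kernel:
  assumes dc: "decreasing_coeffs r C a" and r: "r > 0" and C: "0 \<le> C"
  shows "fourier_coeff (kernel c a) m = parity_coeff c m * a (nat \<bar>m\<bar>)"
proof -
  interpret k: periodic_integrable "kernel c a" by (rule integrable_kernel[OF dc r C])
  have "(\<lambda>N. (LINT t|circle. \<bar>kernel_sum c a N t - kernel c a t\<bar>) / (2 * pi)) \<longlonglongrightarrow> 0 / (2 * pi)"
    by (intro tendsto_intros kernel_sum_L1_tendsto[OF dc r C]) auto
  then have "(\<lambda>N. (LINT t|circle. \<bar>kernel_sum c a N t - kernel c a t\<bar>) / (2 * pi)) \<longlonglongrightarrow> 0" by simp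
  then have "(\<lambda>N. fourier_coeff (kernel_sum c a N) m - fourier_coeff (kernel c a) m) \<longlonglongrightarrow> 0"
    by (rule Lim_null_comparison[rotated])
       (intro always_eventually allI fourier_coeff_diff_le integrable_kernel_sum k.integrable_period)
  then have "(\<lambda>N. fourier_coeff (kernel_sum c a N) m) \<longlonglongrightarrow> fourier_coeff (kernel c a) m"
    by (rule LIM_zero_cancel)
  moreover have "(\<lambda>N. fourier_coeff (kernel_sum c a N) m) \<longlonglongrightarrow> parity_coeff c m * a (nat \<bar>m\<bar>)"
    by (rule tendsto_eventually, rule eventually_sequentiallyI[of "nat \<bar>m\<bar>"]) (simp add: fourier_coeff_kernel_sum)
  ultimately show ?thesis by (rule LIMSEQ_unique)
qed

section \<open>Positive trigonometric sums and interpolation of kernels\<close>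

lemma decreasing_sum_nonneg:
  fixes a d :: "nat \<Rightarrow> real"
  assumes a0: "\<And>k. 0 \<le> a k" and dec: "\<And>k. a (Suc k) \<le> a k" and X: "\<And>k. 0 \<le> (\<Sum>i<k. d i)"
  shows "0 \<le> (\<Sum>k<N. a k * d k)"
proof -
  define S where "S k = (\<Sum>i<k. d i)" for k
  have "(\<Sum>k<N. a k * d k) = (\<Sum>k<N. a k * (S (Suc k) - S k))" by (simp add: S_def)
  also have "\<dots> = a N * S N + (\<Sum>k<N. (a k - a (Suc k)) * S (Suc k))"
    by (rule abel_summation) (simp add: S_def)
  also have "\<dots> \<ge> 0"
  proof -
    have S0: "0 \<le> S k" for k using X by (simp add: S_def)
    show ?thesis using a0 dec S0
      by (intro add_nonneg_nonneg sum_nonneg mult_nonneg_nonneg) auto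
  qed
  finally show ?thesis .
qed

text \<open>Two summations by parts move the weight onto the second differences of \<open>a\<close>
  and the iterated partial sums of \<open>d\<close>; the boundary terms vanish because
  \<open>a\<close> is eventually 0.\<close>

lemma convex_sum_nonneg:
  fixes a d :: "nat \<Rightarrow> real"
  assumes conv: "\<And>k. 2 * a (Suc k) \<le> a k + a (Suc (Suc k))" and fin: "\<And>k. k \<ge> N \<Longrightarrow> a k = 0"
    and Y: "\<And>k. 0 \<le> (\<Sum>j<k. \<Sum>i<Suc j. d i)"
  shows "0 \<le> (\<Sum>k<N. a k * d k)"
proof -
  define S where "S k = (\<Sum>i<k. d i)" for k
  define Z where "Z k = (\<Sum>j<k. S (Suc j))" for k
  have Z: "0 \<le> Z k" for k using Y[of k] unfolding Z_def S_def .
  have "(\<Sum>k<N. a k * d k) = (\<Sum>k<N. a k * (S (Suc k) - S k))" by (simp add: S_def)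
  also have "\<dots> = a N * S N + (\<Sum>k<N. (a k - a (Suc k)) * S (Suc k))"
    by (rule abel_summation) (simp add: S_def)
  also have "\<dots> = (\<Sum>k<N. (a k - a (Suc k)) * (Z (Suc k) - Z k))" using fin by (simp add: Z_def)
  also have "\<dots> = (a N - a (Suc N)) * Z N + (\<Sum>k<N. ((a k - a (Suc k)) - (a (Suc k) - a (Suc (Suc k)))) * Z (Suc k))"
    by (rule abel_summation) (simp add: Z_def)
  also have "\<dots> \<ge> 0"
    using fin conv Z by (intro add_nonneg_nonneg sum_nonneg mult_nonneg_nonneg) (auto simp: algebra_simps)
  finally show ?thesis .
qed

text \<open>Iterated partial sums of the cosine system are Fejer kernels,
  \<open>(1 - cos (k * t)) / (1 - cos t)\<close>, hence nonnegative. The identities \<open>X\<close>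
  (the Dirichlet kernel) and \<open>Y\<close> are stated without the denominator, which vanishes at
  multiples of \<open>2 * pi\<close>.\<close>

lemma fejer_nonneg:
  fixes A :: "nat \<Rightarrow> real"
  assumes conv: "\<And>k. 2 * A (Suc k) \<le> A k + A (Suc (Suc k))" and fin: "\<And>k. k \<ge> N \<Longrightarrow> A k = 0"
  shows "0 \<le> (\<Sum>k<N. A k * (if k = 0 then 1 else 2 * cos (real k * t)))"
proof (rule convex_sum_nonneg[where a = A])
  define d where "d k = (if k = 0 then 1 else 2 * cos (real k * t))" for k :: nat
  have X: "(1 - cos t) * (\<Sum>i<Suc k. d i) = cos (real k * t) - cos (real (Suc k) * t)" for k
  proof (induction k)
    case (Suc k)
    have "cos (real (Suc (Suc k)) * t) + cos (real k * t) = 2 * cos t * cos (real (Suc k) * t)"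
      using cos_plus_cos[of "real (Suc (Suc k)) * t" "real k * t"] by (simp add: algebra_simps add_divide_distrib)
    moreover have "d (Suc k) = 2 * cos (real (Suc k) * t)" by (simp add: d_def)
    ultimately show ?case using Suc by (simp add: algebra_simps)
  qed (simp add: d_def)
  have Y: "(1 - cos t) * (\<Sum>j<k. \<Sum>i<Suc j. d i) = 1 - cos (real k * t)" for k
  proof (induction k)
    case (Suc k)
    then show ?case using X[of k] by (simp add: distrib_left del: sum.lessThan_Suc add: sum.lessThan_Suc[of _ k])
  qed simp
  show "0 \<le> (\<Sum>j<k. \<Sum>i<Suc j. if i = 0 then 1 else 2 * cos (real i * t))" for k
  proof (cases "cos t = 1")
    case True
    then obtain m :: int where "t = m * 2 * pi" using cos_one_2pi_int by auto
    then have "cos (real i * t) = 1" for i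
      using cos_int_2pin[of "int i * m"] by (simp add: mult_ac)
    then show ?thesis by (intro sum_nonneg) auto
  next
    case False
    then have "cos t < 1" using cos_le_one[of t] by linarith
    moreover have "0 \<le> (1 - cos t) * (\<Sum>j<k. \<Sum>i<Suc j. d i)" unfolding Y by simp
    ultimately have "0 \<le> (\<Sum>j<k. \<Sum>i<Suc j. d i)" by (simp add: zero_le_mult_iff)
    then show ?thesis unfolding d_def .
  qed
qed (use conv fin in auto)

lemma abs_sin_mult_le:
  assumes "0 \<le> t" "t \<le> pi" shows "\<bar>sin (real m * t)\<bar> \<le> real m * sin t"
proof (induction m)
  case (Suc m)
  have s: "0 \<le> sin t" using assms by (rule sin_ge_zero)
  have "sin (real (Suc m) * t) = sin (real m * t) * cos t + cos (real m * t) * sin t"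
    by (simp add: distrib_right sin_add add.commute)
  also have "\<bar>\<dots>\<bar> \<le> \<bar>sin (real m * t)\<bar> * \<bar>cos t\<bar> + \<bar>cos (real m * t)\<bar> * \<bar>sin t\<bar>"
    by (metis abs_triangle_ineq abs_mult)
  also have "\<dots> \<le> \<bar>sin (real m * t)\<bar> * 1 + 1 * \<bar>sin t\<bar>"
    by (intro add_mono mult_left_mono mult_right_mono) auto
  also have "\<dots> \<le> real (Suc m) * sin t" using Suc s by (simp add: distrib_right)
  finally show ?case .
qed simp

text \<open>The scheme of \<open>fejer_nonneg\<close> for sines: \<open>2 * (1 - cos t)\<close>
  times the iterated partial sum is \<open>(k + 1) * sin t - sin ((k + 1) * t)\<close>, nonnegative
  on \<open>[0, pi]\<close> by \<open>abs_sin_mult_le\<close>.\<close>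

lemma conjugate_fejer_nonneg:
  fixes a :: "nat \<Rightarrow> real"
  assumes conv: "\<And>k. 2 * a (Suc k) \<le> a k + a (Suc (Suc k))" and fin: "\<And>k. k \<ge> N \<Longrightarrow> a k = 0"
    and t: "0 \<le> t" "t \<le> pi"
  shows "0 \<le> (\<Sum>k<N. a k * sin (real (Suc k) * t))"
proof (rule convex_sum_nonneg[where a = a])
  define d where "d k = sin (real (Suc k) * t)" for k :: nat
  have X: "2 * (1 - cos t) * (\<Sum>i<k. d i) = sin t - sin (real (Suc k) * t) + sin (real k * t)" for k
  proof (induction k)
    case (Suc k)
    have "sin (real (Suc (Suc k)) * t) + sin (real k * t) = 2 * cos t * sin (real (Suc k) * t)"
      using sin_plus_sin[of "real (Suc (Suc k)) * t" "real k * t"] by (simp add: algebra_simps add_divide_distrib)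
    moreover have "d k = sin (real (Suc k) * t)" by (simp add: d_def)
    ultimately show ?case using Suc by (simp add: algebra_simps)
  qed (simp add: d_def)
  have Y: "2 * (1 - cos t) * (\<Sum>j<k. \<Sum>i<Suc j. d i) = real (Suc k) * sin t - sin (real (Suc k) * t)" for k
  proof (induction k)
    case (Suc k)
    have "2 * (1 - cos t) * (\<Sum>j<Suc k. \<Sum>i<Suc j. d i) =
        2 * (1 - cos t) * (\<Sum>j<k. \<Sum>i<Suc j. d i) + 2 * (1 - cos t) * (\<Sum>i<Suc k. d i)"
      by (simp only: sum.lessThan_Suc[of _ k] distrib_left)
    then show ?case unfolding Suc X by (simp add: algebra_simps)
  qed simp
  show "0 \<le> (\<Sum>j<k. \<Sum>i<Suc j. sin (real (Suc i) * t))" for k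
  proof (cases "cos t = 1")
    case True
    then have "t = 0" using t cos_inj_pi[of t 0] by auto
    then show ?thesis by simp
  next
    case False
    then have "cos t < 1" using cos_le_one[of t] by linarith
    moreover have "0 \<le> 2 * (1 - cos t) * (\<Sum>j<k. \<Sum>i<Suc j. d i)"
      unfolding Y using abs_sin_mult_le[OF t, of "Suc k"] by linarith
    ultimately have "0 \<le> (\<Sum>j<k. \<Sum>i<Suc j. d i)" by (simp add: zero_le_mult_iff)
    then show ?thesis unfolding d_def .
  qed
qed (use conv fin in auto)

text \<open>At an interior minimum of the sum of \<open>n + 1\<close> terms its derivative vanishes, which forces the last
  term to be nonnegative there.\<close>

lemma fejer_jackson:
  assumes "0 \<le> t" "t \<le> pi"
  shows "0 \<le> (\<Sum>k<n. sin (real (Suc k) * t) / real (Suc k))"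
  using assms
proof (induction n arbitrary: t)
  case (Suc n)
  define f where "f t = (\<Sum>k<Suc n. sin (real (Suc k) * t) / real (Suc k))" for t
  have der: "(f has_real_derivative (\<Sum>k<Suc n. cos (real (Suc k) * x))) (at x)" for x
    unfolding f_def by (auto intro!: derivative_eq_intros sum.cong)
  have "continuous_on {0..pi} f"
    using der by (meson DERIV_isCont continuous_at_imp_continuous_on)
  then obtain x where x: "x \<in> {0..pi}" "\<And>y. y \<in> {0..pi} \<Longrightarrow> f x \<le> f y"
    using continuous_attains_inf[of "{0..pi}" f] by auto
  have "0 \<le> f x"
  proof (cases "x = 0 \<or> x = pi")
    case True
    then show ?thesis
    proof
      assume "x = pi"
      moreover have "sin (real (Suc k) * pi) = 0" for k by (rule sin_npi)
      ultimately show ?thesis unfolding f_def by (simp del: of_nat_Suc)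
    qed (simp add: f_def)
  next
    case False
    then have x0: "0 < x" "x < pi" using x(1) by auto
    have z: "(\<Sum>k<Suc n. cos (real (Suc k) * x)) = 0"
    proof (rule DERIV_local_min[OF der])
      show "0 < min x (pi - x)" using x0 by simp
      show "\<forall>y. \<bar>x - y\<bar> < min x (pi - x) \<longrightarrow> f x \<le> f y"
        by (intro allI impI x(2)) (auto simp: abs_if split: if_splits)
    qed
    have C: "2 * sin (x / 2) * (\<Sum>j<k. cos (real (Suc j) * x)) = sin ((real k + 1/2) * x) - sin (x / 2)" for k
    proof (induction k)
      case (Suc k)
      have "sin ((real (Suc k) + 1/2) * x) - sin ((real k + 1/2) * x) = 2 * sin (x / 2) * cos (real (Suc k) * x)"
        by (subst sin_diff_sin) (simp add: algebra_simps add_divide_distrib diff_divide_distrib)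
      then show ?case using Suc by (simp add: algebra_simps)
    qed simp
    \<comment> \<open>The vanishing derivative means \<open>sin y = sin (x / 2)\<close>, so
      \<open>cos y\<close> is plus or minus \<open>cos (x / 2)\<close>; in either case
      \<open>sin (y - x / 2)\<close>, the numerator of the last term, is nonnegative.\<close>
    define y where "y = (real (Suc n) + 1/2) * x"
    have s: "sin y = sin (x / 2)" using C[of "Suc n"] z by (simp add: y_def)
    have s0: "0 < sin (x / 2)" and c0: "0 \<le> cos (x / 2)" using x0 by (auto intro!: sin_gt_zero cos_ge_zero)
    have "(cos y)\<^sup>2 = (cos (x / 2))\<^sup>2"
      by (simp add: cos_squared_eq s)
    then have c: "cos y \<le> cos (x / 2)" using c0 by (auto simp: power2_eq_iff)
    have "sin (real (Suc n) * x) = sin (y - x / 2)" by (simp add: y_def algebra_simps)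
    also have "\<dots> = sin (x / 2) * (cos (x / 2) - cos y)" by (simp add: sin_diff s algebra_simps)
    also have "\<dots> \<ge> 0" using s0 c by simp
    finally have "0 \<le> sin (real (Suc n) * x) / real (Suc n)" by simp
    moreover have "0 \<le> (\<Sum>k<n. sin (real (Suc k) * x) / real (Suc k))" using Suc.IH[of x] x0 by simp
    ultimately show ?thesis by (simp add: f_def)
  qed
  also have "f x \<le> f t" by (rule x(2)) (use Suc.prems in auto)
  finally show ?case by (simp add: f_def)
qed simp

text \<open>Leibniz's criterion; the upper bound is carried along because the induction peels off
  the first term and subtracts the rest.\<close>

lemma alternating_sum_bounds:
  fixes f :: "nat \<Rightarrow> real"
  assumes "\<And>l. 0 \<le> f l" and "\<And>l. f (Suc l) \<le> f l"
  shows "0 \<le> (\<Sum>l<L. (-1) ^ l * f l) \<and> (\<Sum>l<L. (-1) ^ l * f l) \<le> f 0"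
  using assms
proof (induction L arbitrary: f)
  case (Suc L)
  have "(\<Sum>l<Suc L. (-1) ^ l * f l) = f 0 - (\<Sum>l<L. (-1) ^ l * f (Suc l))"
    by (simp add: sum.lessThan_Suc_shift sum_negf del: sum.lessThan_Suc)
  moreover have "0 \<le> (\<Sum>l<L. (-1) ^ l * f (Suc l)) \<and> (\<Sum>l<L. (-1) ^ l * f (Suc l)) \<le> f 1"
    using Suc.IH[of "\<lambda>l. f (Suc l)"] Suc.prems by auto
  ultimately show ?case using Suc.prems(2)[of 0] by auto
qed simp

section \<open>Interpolation of kernels by polynomials of low degree\<close>

definition low_degree :: "bool \<Rightarrow> nat \<Rightarrow> (real \<Rightarrow> real) \<Rightarrow> bool" where
  "low_degree c n T \<longleftrightarrow> (\<exists>\<tau>. T = (\<lambda>t. \<Sum>k<n. \<tau> k * harmonic c k t))"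

lemma low_degree_harmonic: "k < n \<Longrightarrow> low_degree c n (\<lambda>t. x * harmonic c k t)"
  unfolding low_degree_def
  by (intro exI[of _ "\<lambda>j. if j = k then x else 0"]) (simp add: fun_eq_iff if_distrib[of "\<lambda>x. x * _"] sum.delta cong: if_cong)

lemma low_degree_add: "low_degree c n S \<Longrightarrow> low_degree c n T \<Longrightarrow> low_degree c n (\<lambda>t. S t + T t)"
  unfolding low_degree_def
proof (elim exE)
  fix \<sigma> \<tau> assume "S = (\<lambda>t. \<Sum>k<n. \<sigma> k * harmonic c k t)" "T = (\<lambda>t. \<Sum>k<n. \<tau> k * harmonic c k t)"
  then show "\<exists>\<tau>. (\<lambda>t. S t + T t) = (\<lambda>t. \<Sum>k<n. \<tau> k * harmonic c k t)"
    by (intro exI[of _ "\<lambda>k. \<sigma> k + \<tau> k"]) (simp add: sum.distrib distrib_right)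
qed

lemma low_degree_minus: "low_degree c n T \<Longrightarrow> low_degree c n (\<lambda>t. - T t)"
  unfolding low_degree_def
proof (elim exE)
  fix \<tau> assume "T = (\<lambda>t. \<Sum>k<n. \<tau> k * harmonic c k t)"
  then show "\<exists>\<tau>. (\<lambda>t. - T t) = (\<lambda>t. \<Sum>k<n. \<tau> k * harmonic c k t)"
    by (intro exI[of _ "\<lambda>k. - \<tau> k"]) (simp add: sum_negf)
qed

lemma low_degree_zero: "low_degree c n (\<lambda>t. 0)"
  unfolding low_degree_def by (intro exI[of _ "\<lambda>_. 0"]) simp

lemma low_degree_sum:
  "finite I \<Longrightarrow> (\<And>i. i \<in> I \<Longrightarrow> low_degree c n (T i)) \<Longrightarrow> low_degree c n (\<lambda>t. \<Sum>i\<in>I. T i t)"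
  by (induction I rule: finite_induct) (auto intro: low_degree_zero low_degree_add)

text \<open>Nagy's condition that \<open>K - T\<close> has the sign of \<open>harmonic c n\<close>.
  As an equation with \<open>sgn\<close> it also forces \<open>K = T\<close> at the zeros of the
  harmonic, and it turns the \<open>L_1\<close> norm of \<open>K - T\<close> directly into an
  integral against the square wave.\<close>

definition sign_matched :: "bool \<Rightarrow> nat \<Rightarrow> (real \<Rightarrow> real) \<Rightarrow> bool" where
  "sign_matched c n K \<longleftrightarrow> (\<exists>T. low_degree c n T \<and>
    (\<forall>t\<in>{-pi..pi}. \<bar>K t - T t\<bar> = (K t - T t) * sgn (harmonic c n t)))"

text \<open>The difference meant is \<open>b k - 3 * b (k + 1) + 3 * b (k + 2) - b (k + 3)\<close>
  for \<open>k \<ge> 1\<close>, grouped so that it reads as monotonicity of the second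
  differences.\<close>

definition third_difference_nonneg :: "(nat \<Rightarrow> real) \<Rightarrow> bool" where
  "third_difference_nonneg b \<longleftrightarrow>
    (\<forall>k. b (Suc (Suc k)) - 2 * b (Suc (Suc (Suc k))) + b (Suc (Suc (Suc (Suc k)))) \<le> b (Suc k) - 2 * b (Suc (Suc k)) + b (Suc (Suc (Suc k))))"

lemma sum_lessThan_add: "(\<Sum>k<m + (n::nat). f k) = (\<Sum>k<m. f k) + (\<Sum>i<n. (f (m + i) :: real))"
  by (induction n) (simp_all add: add.assoc)

text \<open>The coefficients \<open>A\<close> below solve \<open>A s + \<eta> * A (2 * n + s) = b (n + s)\<close>, so that, because of
  \<open>2 h\<^sub>n cos (s t) = h\<^sub>n\<^sub>+\<^sub>s + h\<^sub>n\<^sub>-\<^sub>s\<close>, the product of \<open>2 h\<^sub>n\<close> with the Fejer-type sum \<open>Q\<close> has the same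
  harmonics of order at least \<open>n\<close> as the kernel.\<close>

lemma sign_matched_convex:
  assumes n: "n \<ge> 1"
    and conv: "\<And>k. 2 * b (Suc (Suc k)) \<le> b (Suc k) + b (Suc (Suc (Suc k)))"
    and fin: "\<And>k. k \<ge> M \<Longrightarrow> b k = 0"
    and third: "c \<Longrightarrow> third_difference_nonneg b"
  shows "sign_matched c n (kernel_sum c b M)"
proof -
  \<comment> \<open>The sign under reflection of the index: \<open>h (n - s)\<close> continued to
    \<open>s > n\<close> is \<open>\<eta> * h (s - n)\<close>, as cosine is even and sine is
    odd.\<close>
  define \<eta> :: real where "\<eta> = (if c then 1 else -1)"
  \<comment> \<open>The recursion \<open>A s = b (n + s) - \<eta> * A (2 * n + s)\<close> unrolled;
    since \<open>b\<close> vanishes from \<open>M\<close> on, \<open>M\<close> terms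
    suffice.\<close>
  define A where "A s = (\<Sum>l<M. (- \<eta>) ^ l * b ((2 * l + 1) * n + s))" for s
  define h where "h k = harmonic c k" for k
  define H where "H s t = (if s \<le> n then h (n - s) t else \<eta> * h (s - n) t)" for s t
  define Q where "Q t = (\<Sum>s<M. A s * (if s = 0 then 1 else 2 * cos (real s * t)))" for t
  define D where "D k = b k - 2 * b (Suc k) + b (Suc (Suc k))" for k
  have Dnn: "0 \<le> D k" if "k \<ge> 1" for k using conv[of "k - 1"] that by (simp add: D_def)
  have Ddec: "D j \<le> D k" if "c" "1 \<le> k" "k \<le> j" for j k
  proof -
    have "D (Suc k + i) \<le> D (Suc k)" for i k
    proof (induction i)
      case (Suc i)
      have "D (Suc k + Suc i) \<le> D (Suc k + i)"
        using third[OF \<open>c\<close>] unfolding third_difference_nonneg_def D_def by (simp add: add.commute)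
      with Suc show ?case by linarith
    qed simp
    from this[of "k - 1" "j - k"] that show ?thesis by simp
  qed
  have Afin: "A s = 0" if "s \<ge> M" for s
    unfolding A_def using fin that by (intro sum.neutral) (auto simp: trans_le_add2)
  \<comment> \<open>Second differences of \<open>A\<close> are sums of second differences
    \<open>D\<close> of \<open>b\<close>, all with sign plus for sines, with alternating signs for
    cosines. In the alternating case \<open>D\<close> itself must decrease, which is the
    third-difference hypothesis.\<close>
  have Aconv: "2 * A (Suc k) \<le> A k + A (Suc (Suc k))" for k
  proof -
    have "A k + A (Suc (Suc k)) - 2 * A (Suc k) = (\<Sum>l<M. (- \<eta>) ^ l * D ((2 * l + 1) * n + k))"
      unfolding A_def D_def sum_distrib_left sum.distrib[symmetric] sum_subtractf[symmetric]
      by (intro sum.cong) (auto simp: algebra_simps)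
    also have "\<dots> \<ge> 0"
    proof (cases c)
      case True
      have "0 \<le> (\<Sum>l<M. (- 1) ^ l * D ((2 * l + 1) * n + k))"
      proof (rule conjunct1[OF alternating_sum_bounds])
        show "0 \<le> D ((2 * l + 1) * n + k)" for l using n by (intro Dnn) auto
        show "D ((2 * Suc l + 1) * n + k) \<le> D ((2 * l + 1) * n + k)" for l using n True by (intro Ddec) auto
      qed
      then show ?thesis using True by (simp add: \<eta>_def)
    next
      case False
      then show ?thesis using n by (auto simp: \<eta>_def intro!: sum_nonneg Dnn)
    qed
    finally show ?thesis by simp
  qed
  have Q0: "0 \<le> Q t" for t unfolding Q_def by (rule fejer_nonneg[of A M, OF Aconv Afin])
  have rec: "A s + \<eta> * A (2 * n + s) = b (n + s)" for s
  proof -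
    define f where "f l = (- \<eta>) ^ l * b ((2 * l + 1) * n + s)" for l
    have "A s + \<eta> * A (2 * n + s) = (\<Sum>l<M. f l - f (Suc l))"
      unfolding A_def f_def sum_distrib_left sum.distrib[symmetric]
      by (intro sum.cong) (auto simp: algebra_simps)
    also have "\<dots> = f 0 - f M" by (rule sum_lessThan_telescope')
    also have "f M = 0"
    proof -
      have "M * 1 \<le> M * (2 * n)" using n by (intro mult_le_mono2) auto
      also have "\<dots> \<le> (2 * M + 1) * n + s" by (simp add: algebra_simps)
      finally show ?thesis by (simp add: f_def fin)
    qed
    finally show ?thesis by (simp add: f_def)
  qed
  have prod: "2 * h n t * cos (real s * t) = h (n + s) t + H s t" for s t
  proof (cases "s \<le> n")
    case True
    then show ?thesis
      by (auto simp: H_def h_def harmonic_def cos_add cos_diff sin_add sin_diff distrib_right left_diff_distrib of_nat_diff)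
  next
    case False
    then show ?thesis
      by (auto simp: H_def h_def \<eta>_def harmonic_def cos_add cos_diff sin_add sin_diff distrib_right left_diff_distrib of_nat_diff)
  qed
  have H0: "H 0 t = h n t" for t by (simp add: H_def)
  have QH: "2 * h n t * Q t = (\<Sum>s<M. 2 * A s * h (n + s) t) + (\<Sum>s<M. 2 * A s * H s t) - 2 * A 0 * H 0 t" for t
  proof -
    have "2 * h n t * Q t = (\<Sum>s<M. 2 * A s * h (n + s) t + 2 * A s * H s t - (if s = 0 then 2 * A 0 * H 0 t else 0))"
      unfolding Q_def sum_distrib_left
    proof (intro sum.cong refl)
      fix s
      show "2 * h n t * (A s * (if s = 0 then 1 else 2 * cos (real s * t))) =
        2 * A s * h (n + s) t + 2 * A s * H s t - (if s = 0 then 2 * A 0 * H 0 t else 0)"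
        using prod[of t s] by (cases "s = 0") (simp_all add: H0 algebra_simps)
    qed
    also have "\<dots> = (\<Sum>s<M. 2 * A s * h (n + s) t) + (\<Sum>s<M. 2 * A s * H s t) - (\<Sum>s<M. if s = 0 then 2 * A 0 * H 0 t else 0)"
      by (simp add: sum.distrib sum_subtractf)
    also have "(\<Sum>s<M. if s = 0 then 2 * A 0 * H 0 t else 0) = 2 * A 0 * H 0 t"
      using Afin[of 0] by (cases "M = 0") (auto simp: sum.delta)
    finally show ?thesis .
  qed
  \<comment> \<open>\<open>T\<close> takes the harmonics of order below \<open>n\<close> from the
    kernel and removes those created by the product: \<open>H s\<close> has order
    \<open>|n - s|\<close>, which is below \<open>n\<close> exactly for
    \<open>0 < s < 2 * n\<close>.\<close>
  define T where "T t = (\<Sum>k<n. (if k = 0 then 0 else 2 * b k) * h k t) + - (\<Sum>s\<in>{1..<2*n}. 2 * A s * H s t)" for t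
  have low: "low_degree c n T"
    unfolding T_def
  proof (intro low_degree_add low_degree_minus low_degree_sum)
    fix s assume s: "s \<in> {1..<2*n}"
    show "low_degree c n (\<lambda>t. 2 * A s * H s t)"
    proof (cases "s \<le> n")
      case True
      then show ?thesis using s low_degree_harmonic[of "n - s" n c "2 * A s"] by (simp add: H_def h_def)
    next
      case False
      then show ?thesis using s low_degree_harmonic[of "s - n" n c "2 * A s * \<eta>"] by (simp add: H_def h_def mult.assoc)
    qed
  qed (auto simp: h_def intro: low_degree_harmonic low_degree_zero)
  have eq: "kernel_sum c b M t - T t = 2 * h n t * Q t" for t
  proof -
    define g where "g k = (if k = 0 then 0 else 2 * b k * h k t)" for k
    have "kernel_sum c b M t = (\<Sum>k<Suc M. g k)"
      by (simp add: kernel_sum_def g_def h_def sum.lessThan_Suc_shift del: sum.lessThan_Suc)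
    also have "\<dots> = (\<Sum>k<n + M. g k)"
    proof (rule sum.mono_neutral_left)
      show "\<forall>i\<in>{..<n + M} - {..<Suc M}. g i = 0" using fin by (auto simp: g_def)
    qed (use n in auto)
    also have "\<dots> = (\<Sum>k<n. g k) + (\<Sum>i<M. g (n + i))" by (rule sum_lessThan_add)
    also have "(\<Sum>k<n. g k) = (\<Sum>k<n. (if k = 0 then 0 else 2 * b k) * h k t)"
      by (intro sum.cong) (auto simp: g_def)
    \<comment> \<open>The products with \<open>s \<ge> 2 * n\<close> fold back to orders at least
      \<open>n\<close>; this second contribution is what the recursion for \<open>A\<close> accounts
      for.\<close>
    also have "(\<Sum>i<M. g (n + i)) = (\<Sum>i<M. 2 * A i * h (n + i) t) + (\<Sum>i<M. 2 * A (2 * n + i) * H (2 * n + i) t)"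
      unfolding sum.distrib[symmetric]
    proof (intro sum.cong refl)
      fix i
      have Hi: "H (2 * n + i) t = \<eta> * h (n + i) t" using n by (simp add: H_def)
      have "g (n + i) = 2 * (A i + \<eta> * A (2 * n + i)) * h (n + i) t"
        unfolding rec using n by (simp add: g_def)
      then show "g (n + i) = 2 * A i * h (n + i) t + 2 * A (2 * n + i) * H (2 * n + i) t"
        unfolding Hi by (simp add: algebra_simps)
    qed
    also have "(\<Sum>i<M. 2 * A (2 * n + i) * H (2 * n + i) t) = (\<Sum>s<M. 2 * A s * H s t) - 2 * A 0 * H 0 t - (\<Sum>s\<in>{1..<2*n}. 2 * A s * H s t)"
    proof -
      have "(\<Sum>s<M. 2 * A s * H s t) = (\<Sum>s<2 * n + M. 2 * A s * H s t)"
        by (rule sum.mono_neutral_left) (use Afin in auto)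
      also have "\<dots> = (\<Sum>s<2 * n. 2 * A s * H s t) + (\<Sum>i<M. 2 * A (2 * n + i) * H (2 * n + i) t)"
        by (rule sum_lessThan_add)
      also have "{..<2 * n} = insert 0 {1..<2*n}" using n by auto
      finally show ?thesis by simp
    qed
    finally show ?thesis unfolding T_def QH by simp
  qed
  show ?thesis
    unfolding sign_matched_def
  proof (intro exI[of _ T] conjI ballI low)
    fix t
    show "\<bar>kernel_sum c b M t - T t\<bar> = (kernel_sum c b M t - T t) * sgn (harmonic c n t)"
      unfolding eq using Q0[of t] by (simp add: h_def abs_mult sgn_real_def)
  qed
qed

text \<open>The zero polynomial interpolates: an odd kernel that is nonnegative on
  \<open>[0, pi]\<close> has the sign of \<open>sin t\<close>.\<close>

lemma sign_matched_sine_positive: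
  assumes pos: "\<And>t. 0 \<le> t \<Longrightarrow> t \<le> pi \<Longrightarrow> 0 \<le> kernel_sum False b M t"
  shows "sign_matched False 1 (kernel_sum False b M)"
  unfolding sign_matched_def
proof (intro exI[of _ "\<lambda>_. 0"] conjI ballI low_degree_zero)
  fix t :: real assume t: "t \<in> {-pi..pi}"
  have odd: "kernel_sum False b M (- t) = - kernel_sum False b M t"
    by (simp add: kernel_sum_def harmonic_def sum_negf)
  have zero: "kernel_sum False b M 0 = 0" "kernel_sum False b M pi = 0" "kernel_sum False b M (- pi) = 0"
  proof -
    have "sin (real (Suc k) * pi) = 0" for k by (rule sin_npi)
    then show "kernel_sum False b M 0 = 0" "kernel_sum False b M pi = 0" "kernel_sum False b M (- pi) = 0"
      by (simp_all add: kernel_sum_def harmonic_def del: of_nat_Suc)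
  qed
  consider "t \<in> {0, pi, -pi}" | "0 < t" "t < pi" | "-pi < t" "t < 0" using t by fastforce
  then show "\<bar>kernel_sum False b M t - 0\<bar> = (kernel_sum False b M t - 0) * sgn (harmonic False 1 t)"
  proof cases
    case 1
    then show ?thesis using zero by auto
  next
    case 2
    then have "sin t > 0" by (intro sin_gt_zero)
    then show ?thesis using pos[of t] 2 by (simp add: harmonic_def)
  next
    case 3
    then have "sin (- t) > 0" by (intro sin_gt_zero) auto
    then show ?thesis using pos[of "- t"] 3 odd by (simp add: harmonic_def)
  qed
qed

text \<open>The derivative of a cosine sum is minus the sine sum with coefficients
  \<open>k * b k\<close>, so the kernel decreases on \<open>[0, pi]\<close>. The constant
  \<open>K (pi / 2)\<close>, its value at the zero of the cosine, is the interpolating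
  polynomial.\<close>

lemma sign_matched_cosine_decreasing:
  assumes pos: "\<And>t. 0 \<le> t \<Longrightarrow> t \<le> pi \<Longrightarrow> 0 \<le> kernel_sum False (\<lambda>k. real k * b k) M t"
  shows "sign_matched True 1 (kernel_sum True b M)"
proof -
  define K where "K = kernel_sum True b M"
  have der: "(K has_real_derivative - kernel_sum False (\<lambda>k. real k * b k) M t) (at t)" for t
    unfolding K_def kernel_sum_def harmonic_def
    by (auto intro!: derivative_eq_intros simp: sum_negf[symmetric] mult_ac)
  have dec: "K v \<le> K u" if "0 \<le> u" "u \<le> v" "v \<le> pi" for u v
    by (rule DERIV_nonpos_imp_nonincreasing[OF that(2)])
       (use der pos that in \<open>meson neg_le_0_iff_le order_trans\<close>)
  have even: "K (- t) = K t" for t by (simp add: K_def kernel_sum_def harmonic_def)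
  have main: "\<bar>K t - K (pi / 2)\<bar> = (K t - K (pi / 2)) * sgn (cos t)" if t: "0 \<le> t" "t \<le> pi" for t
  proof -
    consider "t < pi / 2" | "t = pi / 2" | "pi / 2 < t" by linarith
    then show ?thesis
    proof cases
      case 1
      then have "cos t > 0" using t by (intro cos_gt_zero_pi) auto
      then show ?thesis using dec[of t "pi / 2"] 1 t by simp
    next
      case 3
      then have "cos (pi - t) > 0" using t by (intro cos_gt_zero_pi) auto
      then show ?thesis using dec[of "pi / 2" t] 3 t by simp
    next
      case 2
      then have "K t = K (pi / 2)" by (simp only:)
      then show ?thesis by simp
    qed
  qed
  show ?thesis
    unfolding sign_matched_def K_def[symmetric]
  proof (intro exI[of _ "\<lambda>t. K (pi / 2) * harmonic True 0 t"] conjI ballI low_degree_harmonic)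
    fix t assume "t \<in> {-pi..pi}"
    then show "\<bar>K t - K (pi / 2) * harmonic True 0 t\<bar> = (K t - K (pi / 2) * harmonic True 0 t) * sgn (harmonic True 1 t)"
      using main[of t] main[of "- t"] even[of t] by (cases "0 \<le> t") (auto simp: harmonic_def)
  qed simp
qed

section \<open>The extremal problem\<close>

definition square_wave :: "bool \<Rightarrow> nat \<Rightarrow> real \<Rightarrow> real" where
  "square_wave c n t = sgn (harmonic c n t)"

lemma abs_square_wave_le: "\<bar>square_wave c n t\<bar> \<le> 1"
  by (simp add: square_wave_def sgn_real_def)

lemma square_wave_borel [measurable]: "square_wave c n \<in> borel_measurable borel"
proof -
  have "harmonic c n \<in> borel_measurable borel"
    by (intro borel_measurable_continuous_onI continuous_intros)
  then show ?thesis unfolding square_wave_def by (rule measurable_compose[OF _ borel_measurable_sgn])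
qed

lemma square_wave_measurable: "square_wave c n \<in> borel_measurable lebesgue"
  by (intro measurable_completion) simp

lemma periodic_integrable_bounded:
  assumes "f \<in> borel_measurable lebesgue" "\<And>t. f (t + 2 * pi) = f t" "\<And>t. \<bar>f t\<bar> \<le> B"
  shows "periodic_integrable f"
proof
  show "integrable circle f"
    by (rule finite_measure.integrable_const_bound[OF finite_measure_period, where B = B]) (use assms in auto)
qed (use assms in auto)

lemma square_wave_periodic_integrable: "periodic_integrable (square_wave c n)"
  by (rule periodic_integrable_bounded[OF square_wave_measurable _ abs_square_wave_le])
     (simp add: square_wave_def harmonic_periodic)

lemma harmonic_antiperiodic:
  assumes "n \<ge> 1" shows "harmonic c n (t + pi / real n) = - harmonic c n t"
proof -
  have "real n * (t + pi / real n) = real n * t + pi" using assms by (simp add: field_simps)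
  then show ?thesis by (simp add: harmonic_def)
qed

text \<open>Translation by \<open>pi / n\<close> multiplies the \<open>k\<close>-th coefficient by a
  root of unity, which must equal -1 unless the coefficient vanishes; this happens only at odd
  multiples of \<open>n\<close>.\<close>

lemma fourier_coeff_antiperiodic:
  assumes f: "periodic_integrable f" and n: "n \<ge> 1" and anti: "\<And>t. f (t + pi / real n) = - f t"
    and nz: "fourier_coeff f k \<noteq> 0"
  obtains j :: int where "k = (2 * j + 1) * int n"
proof -
  interpret periodic_integrable f by fact
  have "(LINT x|circle. complex_of_real (f (x - (- pi / real n))) * fourier_exp k x) =
     2 * pi * fourier_coeff f k * fourier_exp k (- pi / real n)"
    by (rule fourier_coeff_translate[OF periodic integrable_period])
  moreover have "f (x - (- pi / real n)) = - f x" for x using anti[of x] by simp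
  ultimately have "- (LINT x|circle. complex_of_real (f x) * fourier_exp k x) =
     2 * pi * fourier_coeff f k * fourier_exp k (- pi / real n)"
    by simp
  then have eq: "- (2 * pi * fourier_coeff f k) = 2 * pi * fourier_coeff f k * fourier_exp k (- pi / real n)"
    by (simp add: fourier_coeff_eq_period[of f])
  then have "2 * pi * fourier_coeff f k * (fourier_exp k (- pi / real n) + 1) = 0"
    unfolding distrib_left mult_1_right eq[symmetric] by simp
  then have "fourier_exp k (- pi / real n) = - 1"
    using nz by (simp add: eq_neg_iff_add_eq_0)
  then have "cis (of_int k * pi / real n) = - 1" by (simp add: cis_conv_exp mult_ac)
  then have "cos (of_int k * pi / real n) = - 1" by (simp add: complex_eq_iff)
  then have "cos (of_int k * pi / real n - pi) = 1" by simp
  then obtain j :: int where "of_int k * pi / real n - pi = of_int j * 2 * pi"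
    unfolding cos_one_2pi_int by blast
  then have "of_int k * pi = (2 * of_int j + 1) * real n * pi" using n by (simp add: field_simps)
  then have "real_of_int k = real_of_int ((2 * j + 1) * int n)" by simp
  then have "k = (2 * j + 1) * int n" by (simp only: of_int_eq_iff)
  then show ?thesis by (rule that)
qed

lemma fourier_coeff_antiperiodic_low:
  assumes "periodic_integrable f" "n \<ge> 1" "\<And>t. f (t + pi / real n) = - f t" "\<bar>k\<bar> < int n"
  shows "fourier_coeff f k = 0"
proof (rule ccontr)
  assume "fourier_coeff f k \<noteq> 0"
  then obtain j :: int where j: "k = (2 * j + 1) * int n"
    using fourier_coeff_antiperiodic[OF assms(1-3)] by blast
  have "1 * int n \<le> \<bar>2 * j + 1\<bar> * int n" by (intro mult_right_mono) presburger+
  then show False using assms(4) j by (simp add: abs_mult)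
qed

lemma integral_harmonic_fourier:
  assumes f: "integrable circle f" and z: "fourier_coeff f (int k) = 0"
  shows "(LINT t|circle. f t * harmonic c k t) = 0"
proof -
  have i: "integrable circle (\<lambda>t. complex_of_real (f t) * fourier_exp (int k) t)"
    by (rule integrable_exp_period[OF f])
  have e: "fourier_exp (int k) t = cis (- (real k * t))" for t
    by (simp add: cis_conv_exp mult_ac)
  have I: "(LINT t|circle. complex_of_real (f t) * fourier_exp (int k) t) = 0"
    using z by (simp add: fourier_coeff_eq_period)
  have "(LINT t|circle. f t * cos (real k * t)) = 0"
    using integral_Re[OF i[unfolded e]] I[unfolded e] by simp
  moreover have "(LINT t|circle. f t * - sin (real k * t)) = 0"
    using integral_Im[OF i[unfolded e]] I[unfolded e] by simp
  ultimately show ?thesis by (cases c) (simp_all add: harmonic_def)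
qed

lemma integrable_times_harmonic:
  "integrable circle f \<Longrightarrow> integrable circle (\<lambda>t. f t * harmonic c k t)"
  by (rule integrable_times_bounded_real[OF _ measurable_period[OF harmonic_measurable] abs_harmonic_le])

lemma integral_low_degree:
  assumes f: "integrable circle f" and z: "\<And>k. k < n \<Longrightarrow> fourier_coeff f (int k) = 0"
    and T: "low_degree c n T"
  shows "(LINT t|circle. f t * T t) = 0"
proof -
  obtain \<tau> where T: "T = (\<lambda>t. \<Sum>k<n. \<tau> k * harmonic c k t)" using T by (auto simp: low_degree_def)
  have "(LINT t|circle. f t * T t) = (LINT t|circle. (\<Sum>k<n. \<tau> k * (f t * harmonic c k t)))"
    by (simp add: T sum_distrib_left mult_ac)
  also have "\<dots> = (\<Sum>k<n. \<tau> k * (LINT t|circle. f t * harmonic c k t))"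
    using integrable_times_harmonic[OF f] by (subst Bochner_Integration.integral_sum) auto
  also have "\<dots> = 0" using integral_harmonic_fourier[OF f z] by (intro sum.neutral) auto
  finally show ?thesis .
qed

lemma integrable_low_degree: "low_degree c n T \<Longrightarrow> integrable circle T"
  using integrable_harmonic by (auto simp: low_degree_def intro!: Bochner_Integration.integrable_sum)

lemma fourier_coeff_harmonic_high:
  assumes "int k < \<bar>m\<bar>" shows "fourier_coeff (harmonic c k) m = 0"
proof (cases "k = 0")
  case True
  have "harmonic c 0 = (\<lambda>t. if c then 1 else 0)" by (simp add: harmonic_def fun_eq_iff)
  then show ?thesis using True assms
    by (cases c) (simp_all add: fourier_coeff_eq_period integral_exp_period[of m, simplified])
qed (use assms fourier_coeff_harmonic[of k c m] in auto)

lemma fourier_coeff_low_degree: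
  assumes "low_degree c n T" "int n \<le> \<bar>m\<bar>" shows "fourier_coeff T m = 0"
proof -
  obtain \<tau> where T: "T = (\<lambda>t. \<Sum>k<n. \<tau> k * harmonic c k t)" using assms by (auto simp: low_degree_def)
  have "fourier_coeff (\<lambda>t. \<Sum>k<N. \<tau> k * harmonic c k t) m = 0" if "N \<le> n" for N
    using that
  proof (induction N)
    case (Suc N)
    have "fourier_coeff (\<lambda>t. \<tau> N * harmonic c N t) m = 0"
      using fourier_coeff_harmonic_high[of N m c] assms(2) Suc.prems by (simp add: fourier_coeff_cmult)
    moreover have "integrable circle (\<lambda>t. \<Sum>k<N. \<tau> k * harmonic c k t)"
      using integrable_harmonic by (intro Bochner_Integration.integrable_sum) auto
    ultimately show ?case using Suc integrable_harmonic by (simp add: fourier_coeff_add)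
  qed (simp add: fourier_coeff_eq_period)
  then show ?thesis by (simp add: T)
qed

section \<open>Norm bounds by convolution and by duality\<close>

lemma Lp_norm_1:
  assumes "integrable circle f" shows "Lp_norm 1 f = ereal (LINT t|circle. \<bar>f t\<bar>)"
proof -
  have "(\<integral>\<^sup>+ t. ennreal (\<bar>f t\<bar> powr real_of_ereal 1) \<partial>circle) = ennreal (LINT t|circle. \<bar>f t\<bar>)"
    using nn_integral_eq_integral[of circle "\<lambda>t. \<bar>f t\<bar>"] assms by simp
  then show ?thesis by (simp add: Lp_norm_def)
qed

lemma Lp_space_periodic_integrable:
  assumes p: "p = 1 \<or> p = \<infinity>" and f: "f \<in> Lp_space p" shows "periodic_integrable f"
proof
  have m: "f \<in> borel_measurable lebesgue" and N: "Lp_norm p f < \<infinity>" using f by (auto simp: Lp_space_def)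
  then show "f \<in> borel_measurable lebesgue" by simp
  show "f (t + 2 * pi) = f t" for t using f by (simp add: Lp_space_def)
  show "integrable circle f"
  proof (cases "p = 1")
    case True
    have "(\<integral>\<^sup>+ t. ennreal (norm (f t)) \<partial>circle) < \<infinity>"
      using N True by (auto simp: Lp_norm_def Let_def top.not_eq_extremum split: if_splits)
    then show ?thesis using m by (intro integrableI_bounded) auto
  next
    case False
    then have pinf: "p = \<infinity>" using p by simp
    define E where "E = esssup circle (\<lambda>t. ereal \<bar>f t\<bar>)"
    have "E < \<infinity>" using N pinf by (simp add: Lp_norm_def E_def)
    have ae: "AE t in circle. ereal \<bar>f t\<bar> \<le> E" unfolding E_def by (rule esssup_AE)
    show ?thesis
    proof (rule finite_measure.integrable_const_bound[OF finite_measure_period, where B = "real_of_ereal E"])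
      show "AE t in circle. norm (f t) \<le> real_of_ereal E"
        using ae
      proof eventually_elim
        case (elim t)
        then show ?case using \<open>E < \<infinity>\<close> by (cases E) auto
      qed
    qed (use m in auto)
  qed
qed

lemma H_class_Linf_AE: "\<phi> \<in> H_class \<infinity> n \<Longrightarrow> AE t in circle. \<bar>\<phi> t\<bar> \<le> 1"
proof -
  assume "\<phi> \<in> H_class \<infinity> n"
  then have "esssup circle (\<lambda>t. ereal \<bar>\<phi> t\<bar>) \<le> 1" by (simp add: H_class_def Lp_norm_def)
  moreover have "AE t in circle. ereal \<bar>\<phi> t\<bar> \<le> esssup circle (\<lambda>t. ereal \<bar>\<phi> t\<bar>)"
    by (rule esssup_AE)
  ultimately show ?thesis
    by (auto elim!: eventually_mono simp flip: ereal_less_eq(3) simp: one_ereal_def intro: order_trans)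
qed

text \<open>Uniqueness of coefficients identifies \<open>E\<close> with a convolution, so
  \<open>L\<close> may be any kernel with the right coefficients wherever those of
  \<open>\<phi>\<close> do not vanish; a polynomial of low degree can thus be subtracted from the
  kernel for free.\<close>

lemma Lp_norm_le:
  assumes p: "p = 1 \<or> p = \<infinity>" and \<phi>: "\<phi> \<in> H_class p n" and E: "periodic_integrable E"
    and L: "integrable circle L" and fc: "\<And>m. fourier_coeff E m = fourier_coeff \<phi> m * fourier_coeff L m"
  shows "Lp_norm p E \<le> ereal ((LINT t|circle. \<bar>L t\<bar>) / (2 * pi))"
proof -
  interpret E: periodic_integrable E by fact
  have P: "periodic_integrable \<phi>" using Lp_space_periodic_integrable[OF p] \<phi> by (simp add: H_class_def)
  interpret c: periodic_integrable "convol \<phi> L" by (rule convol_periodic_integrable[OF P L])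
  have ae: "AE t in circle. E t = convol \<phi> L t"
    by (rule fourier_coeff_eq_imp_AE_eq[OF E.integrable_period c.integrable_period])
       (simp add: fc fourier_coeff_convol[OF P L])
  have L0: "0 \<le> (LINT t|circle. \<bar>L t\<bar>)" by simp
  show ?thesis
  proof (cases "p = 1")
    case True
    have "ereal (LINT t|circle. \<bar>\<phi> t\<bar>) \<le> 1"
      using \<phi> True Lp_norm_1[OF periodic_integrable.integrable_period[OF P]] by (simp add: H_class_def)
    then have 1: "(LINT t|circle. \<bar>\<phi> t\<bar>) \<le> 1" by (simp add: one_ereal_def)
    have "(LINT t|circle. \<bar>E t\<bar>) = (LINT t|circle. \<bar>convol \<phi> L t\<bar>)"
      by (rule integral_cong_AE)
         (use ae E.lebesgue_measurable c.lebesgue_measurable in \<open>auto elim: eventually_mono\<close>)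
    also have "\<dots> \<le> (LINT t|circle. \<bar>\<phi> t\<bar>) * (LINT t|circle. \<bar>L t\<bar>) / (2 * pi)"
      by (rule integral_abs_convol_le[OF P L])
    also have "\<dots> \<le> (LINT t|circle. \<bar>L t\<bar>) / (2 * pi)"
      using mult_right_mono[OF 1 L0] by (simp add: divide_right_mono)
    finally show ?thesis using Lp_norm_1[OF E.integrable_period] True by simp
  next
    case False
    then have pinf: "p = \<infinity>" using p by simp
    have b: "\<bar>convol \<phi> L t\<bar> \<le> (LINT t|circle. \<bar>L t\<bar>) / (2 * pi)" for t
      using abs_convol_le[OF P L H_class_Linf_AE] \<phi> pinf by fastforce
    have "esssup circle (\<lambda>t. ereal \<bar>E t\<bar>) \<le> ereal ((LINT t|circle. \<bar>L t\<bar>) / (2 * pi))"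
    proof (rule esssup_I)
      show "(\<lambda>t. ereal \<bar>E t\<bar>) \<in> borel_measurable circle"
        by (intro borel_measurable_ereal borel_measurable_abs measurable_period E.lebesgue_measurable)
      show "AE t in circle. ereal \<bar>E t\<bar> \<le> ereal ((LINT t|circle. \<bar>L t\<bar>) / (2 * pi))"
        using ae by eventually_elim (use b in simp)
    qed
    then show ?thesis using pinf by (simp add: Lp_norm_def)
  qed
qed

text \<open>Hoelder's inequality, read as a lower bound for the norm. The bound \<open>B\<close>
  makes \<open>E * w\<close> integrable in both cases; \<open>w\<close> is normalised in the sup
  norm for \<open>p = 1\<close> and in \<open>L_1\<close> for
  \<open>p = \<infinity>\<close>.\<close>

lemma Lp_norm_ge:
  assumes p: "p = 1 \<or> p = \<infinity>" and E: "periodic_integrable E"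
    and w: "w \<in> borel_measurable circle" "\<And>t. \<bar>w t\<bar> \<le> B"
    and w1: "p = 1 \<Longrightarrow> B \<le> 1" and winf: "p = \<infinity> \<Longrightarrow> (LINT t|circle. \<bar>w t\<bar>) \<le> 1"
  shows "ereal \<bar>LINT t|circle. E t * w t\<bar> \<le> Lp_norm p E"
proof -
  interpret E: periodic_integrable E by fact
  have i: "integrable circle (\<lambda>t. E t * w t)"
    by (rule integrable_times_bounded_real[OF E.integrable_period w])
  have iw: "integrable circle w"
    by (rule finite_measure.integrable_const_bound[OF finite_measure_period, where B = B]) (use w in auto)
  show ?thesis
  proof (cases "p = 1")
    case True
    have "norm (LINT t|circle. E t * w t) \<le> (LINT t|circle. \<bar>E t\<bar>)"
    proof (rule Bochner_Integration.integral_norm_bound_integral[OF i])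
      show "norm (E t * w t) \<le> \<bar>E t\<bar>" for t
        using w(2)[of t] w1[OF True] by (simp add: abs_mult mult_left_le)
    qed (use E.integrable_period in auto)
    then show ?thesis using True Lp_norm_1[OF E.integrable_period] by simp
  next
    case False
    then have pinf: "p = \<infinity>" using p by simp
    define N where "N = esssup circle (\<lambda>t. ereal \<bar>E t\<bar>)"
    have ae: "AE t in circle. ereal \<bar>E t\<bar> \<le> N" unfolding N_def by (rule esssup_AE)
    \<comment> \<open>Over a null space an essential supremum would be minus infinity; the period
      has positive measure.\<close>
    have N0: "0 \<le> N"
    proof (rule ccontr)
      assume "\<not> 0 \<le> N"
      then have "AE t in circle. False"
        using ae by (auto elim!: eventually_mono dest: order_trans[of 0, rotated])
      then have "ae_filter circle = bot" by (simp add: trivial_limit_def)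
      then show False
        by (simp add: ae_filter_eq_bot_iff space_restrict_space emeasure_restrict_space)
    qed
    show ?thesis
    proof (cases N)
      case (real x)
      have "norm (LINT t|circle. E t * w t) \<le> (LINT t|circle. norm (E t * w t))"
        by (rule integral_norm_bound)
      also have "\<dots> \<le> (LINT t|circle. x * \<bar>w t\<bar>)"
      proof (rule integral_mono_AE)
        show "AE t in circle. norm (E t * w t) \<le> x * \<bar>w t\<bar>"
          using ae by eventually_elim (simp add: real abs_mult mult_right_mono)
      qed (use i iw in auto)
      also have "\<dots> \<le> x" using winf[OF pinf] N0 real by (simp add: mult_left_le)
      finally show ?thesis using pinf real by (simp add: Lp_norm_def N_def)
    qed (use N0 pinf in \<open>auto simp: Lp_norm_def N_def\<close>)
  qed
qed

lemma convol_pairing_real: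
  assumes f: "periodic_integrable f" and g: "integrable circle g"
    and w: "w \<in> borel_measurable circle" "\<And>x. \<bar>w x\<bar> \<le> B"
  shows "(LINT x|circle. convol f g x * w x) =
    (LINT t|circle. g t * (LINT x|circle. f (x - t) * w x)) / (2 * pi)"
proof -
  interpret periodic_integrable f by fact
  have wm: "(\<lambda>x. complex_of_real (w x)) \<in> borel_measurable circle" using w by measurable
  have "(LINT x|circle. complex_of_real (convol f g x) * complex_of_real (w x)) =
     (LINT t|circle. complex_of_real (g t) * (LINT x|circle. complex_of_real (f (x - t)) * complex_of_real (w x))) / (2 * pi)"
    by (rule convol_pairing(2)[OF lebesgue_measurable periodic integrable_period g wm, of B]) (use w in auto)
  then have "complex_of_real (LINT x|circle. convol f g x * w x) =
     complex_of_real ((LINT t|circle. g t * (LINT x|circle. f (x - t) * w x)) / (2 * pi))"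
    unfolding of_real_mult[symmetric] integral_complex_of_real of_real_divide .
  then show ?thesis by (simp only: of_real_eq_iff)
qed

section \<open>Combs approximating alternating point masses\<close>

definition comb_mass :: "nat \<Rightarrow> nat \<Rightarrow> real" where
  "comb_mass n j = (LINT u|circle. of_bool (\<bar>sin (real n * u)\<bar> \<le> 1 / (real j + 2)))"

text \<open>An approximation in \<open>L\<^sub>1\<close> to the alternating sum of point masses at the multiples of \<open>pi / n\<close>,
  the extremal functional for \<open>p = 1\<close>.\<close>

definition comb :: "nat \<Rightarrow> nat \<Rightarrow> real \<Rightarrow> real" where
  "comb n j u = sgn (cos (real n * u)) * of_bool (\<bar>sin (real n * u)\<bar> \<le> 1 / (real j + 2)) / comb_mass n j"

lemma comb_support_measurable [measurable]:
  "(\<lambda>u. of_bool (\<bar>sin (real n * u)\<bar> \<le> 1 / (real j + 2)) :: real) \<in> borel_measurable borel"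
  by measurable

lemma comb_mass_pos: assumes "n \<ge> 1" shows "comb_mass n j > 0"
proof -
  \<comment> \<open>On \<open>{0..d}\<close> the estimate of the sine by its argument keeps it below
    the threshold, so this interval lies in the support.\<close>
  define d where "d = 1 / (real n * (real j + 2))"
  have nj: "1 * 2 \<le> real n * (real j + 2)" using assms by (intro mult_mono) auto
  then have "d \<le> 1 / 2" unfolding d_def using divide_left_mono[of 2 "real n * (real j + 2)" 1] by simp
  then have d: "0 < d" "d \<le> pi" using assms pi_gt3 by (auto simp: d_def intro: order_trans[of _ "1/2"])
  have "d = (LINT u|circle. indicator {0..d} u)"
    using d by (simp add: measure_restrict_space Int_absorb2 space_restrict_space)
  also have "\<dots> \<le> comb_mass n j"
    unfolding comb_mass_def
  proof (rule integral_mono)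
    show "integrable circle (indicator {0..d} :: real \<Rightarrow> real)"
      by (rule finite_measure.integrable_const_bound[OF finite_measure_period, where B = 1])
         (auto simp: indicator_def intro!: measurable_period measurable_completion)
    show "integrable circle (\<lambda>u. of_bool (\<bar>sin (real n * u)\<bar> \<le> 1 / (real j + 2)) :: real)"
      by (rule finite_measure.integrable_const_bound[OF finite_measure_period, where B = 1])
         (auto intro!: measurable_period measurable_completion)
    fix u
    show "indicator {0..d} u \<le> (of_bool (\<bar>sin (real n * u)\<bar> \<le> 1 / (real j + 2)) :: real)"
    proof (cases "u \<in> {0..d}")
      case True
      have "\<bar>sin (real n * u)\<bar> \<le> real n * u" using abs_sin_x_le_abs_x[of "real n * u"] True by simp
      also have "\<dots> \<le> real n * d" using True by (intro mult_left_mono) auto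
      also have "\<dots> = 1 / (real j + 2)" using assms by (simp add: d_def)
      finally show ?thesis by simp
    qed simp
  qed
  finally show ?thesis using d by simp
qed

lemma comb_borel [measurable]: "comb n j \<in> borel_measurable borel"
  unfolding comb_def by (intro borel_measurable_divide borel_measurable_times measurable_compose[OF _ borel_measurable_sgn]) auto

lemma comb_measurable: "comb n j \<in> borel_measurable lebesgue"
  by (intro measurable_completion) simp

lemma abs_comb:
  assumes "n \<ge> 1"
  shows "\<bar>comb n j u\<bar> = of_bool (\<bar>sin (real n * u)\<bar> \<le> 1 / (real j + 2)) / comb_mass n j"
proof (cases "\<bar>sin (real n * u)\<bar> \<le> 1 / (real j + 2)")
  case True
  \<comment> \<open>The threshold \<open>1 / (j + 2)\<close> stays below 1, so the cosine has no
    zero on the support and its \<open>sgn\<close> has modulus 1 there.\<close>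
  then have "\<bar>sin (real n * u)\<bar> < 1" by (rule le_less_trans) simp
  then have "(sin (real n * u))\<^sup>2 < 1" by (simp add: abs_square_less_1)
  then have "cos (real n * u) \<noteq> 0" using cos_squared_eq[of "real n * u"] by auto
  then show ?thesis using True comb_mass_pos[OF assms, of j] by (simp add: comb_def abs_mult sgn_real_def)
qed (simp add: comb_def)

lemma comb_bounded: assumes "n \<ge> 1" shows "\<bar>comb n j u\<bar> \<le> 1 / comb_mass n j"
  unfolding abs_comb[OF assms] using comb_mass_pos[OF assms, of j] by (intro divide_right_mono) auto

lemma comb_periodic_integrable: assumes "n \<ge> 1" shows "periodic_integrable (comb n j)"
proof (rule periodic_integrable_bounded[OF comb_measurable _ comb_bounded[OF assms]])
  show "comb n j (t + 2 * pi) = comb n j t" for t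
    using harmonic_periodic[of True n t] harmonic_periodic[of False n t] by (simp add: comb_def harmonic_def)
qed

lemma integral_abs_comb: assumes "n \<ge> 1" shows "(LINT u|circle. \<bar>comb n j u\<bar>) = 1"
  unfolding abs_comb[OF assms] using comb_mass_pos[OF assms, of j] by (simp add: comb_mass_def[symmetric])

lemma comb_H_class: assumes n: "n \<ge> 1" shows "comb n j \<in> H_class 1 n"
proof -
  interpret periodic_integrable "comb n j" by (rule comb_periodic_integrable[OF n])
  have "comb n j (t + pi / real n) = - comb n j t" for t
    using harmonic_antiperiodic[OF n, of True t] harmonic_antiperiodic[OF n, of False t]
    by (simp add: comb_def harmonic_def sgn_minus)
  then have "fourier_coeff (comb n j) k = 0" if "\<bar>k\<bar> \<le> int n - 1" for k
    using that by (intro fourier_coeff_antiperiodic_low[OF comb_periodic_integrable[OF n] n]) auto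
  then show ?thesis
    using lebesgue_measurable periodic Lp_norm_1[OF integrable_period] integral_abs_comb[OF n]
    by (simp add: H_class_def Lp_space_def one_ereal_def[symmetric])
qed

lemma square_wave_antiperiodic:
  "n \<ge> 1 \<Longrightarrow> square_wave c n (t + pi / real n) = - square_wave c n t"
  by (simp add: square_wave_def harmonic_antiperiodic sgn_minus)

lemma fourier_coeff_square_wave_low:
  "n \<ge> 1 \<Longrightarrow> \<bar>k\<bar> < int n \<Longrightarrow> fourier_coeff (square_wave c n) k = 0"
  by (rule fourier_coeff_antiperiodic_low[OF square_wave_periodic_integrable _ square_wave_antiperiodic]) auto

lemma square_wave_H_class: assumes n: "n \<ge> 1" shows "square_wave c n \<in> H_class \<infinity> n"
proof -
  interpret periodic_integrable "square_wave c n" by (rule square_wave_periodic_integrable)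
  have "esssup circle (\<lambda>t. ereal \<bar>square_wave c n t\<bar>) \<le> 1"
    using measurable_period[OF lebesgue_measurable] abs_square_wave_le[of c n]
    by (intro esssup_I) (auto simp: one_ereal_def)
  moreover have "(1 :: ereal) < \<infinity>" by simp
  ultimately have "Lp_norm \<infinity> (square_wave c n) \<le> 1" "Lp_norm \<infinity> (square_wave c n) < \<infinity>"
    unfolding Lp_norm_def by (auto intro: le_less_trans)
  then show ?thesis
    using lebesgue_measurable periodic fourier_coeff_square_wave_low[OF n, of _ c]
    by (simp add: H_class_def Lp_space_def)
qed

lemma sgn_add_eq: "\<bar>y\<bar> < \<bar>x\<bar> \<Longrightarrow> sgn (x + y) = sgn (x :: real)"
  by (auto simp: sgn_real_def abs_if split: if_splits)

text \<open>On the support of the comb \<open>n * u\<close> is close to a multiple of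
  \<open>pi\<close>, so \<open>harmonic c n (u + t)\<close> is nearly \<open>cos (n * u)\<close>
  times \<open>harmonic c n t\<close>; the hypothesis makes the correction too small to change the
  sign, and the sign of the cosine cancels against that of the comb.\<close>

lemma comb_times_square_wave:
  assumes n: "n \<ge> 1" and e: "1 / (real j + 2) < (1 - (1 / (real j + 2))\<^sup>2) * \<bar>harmonic c n t\<bar>"
  shows "comb n j u * square_wave c n (u + t) = square_wave c n t * \<bar>comb n j u\<bar>"
proof (cases "\<bar>sin (real n * u)\<bar> \<le> 1 / (real j + 2)")
  case True
  define S C D where "S = sin (real n * u)" and "C = cos (real n * u)"
    and "D = (if c then - sin (real n * t) else cos (real n * t))"
  have S: "\<bar>S\<bar> \<le> 1 / (real j + 2)" using True by (simp add: S_def)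
  have "\<bar>S\<bar>\<^sup>2 \<le> (1 / (real j + 2))\<^sup>2" by (rule power_mono[OF S]) simp
  then have C2: "1 - (1 / (real j + 2))\<^sup>2 \<le> C * C"
    using sin_cos_squared_add[of "real n * u"] by (simp add: S_def C_def power2_eq_square)
  \<comment> \<open>After multiplication by \<open>C\<close> the main term carries the square
    \<open>C * C\<close>, which is bounded below on the support.\<close>
  have eq: "C * harmonic c n (u + t) = C * C * harmonic c n t + S * C * D"
    by (simp add: harmonic_def C_def S_def D_def distrib_left cos_add sin_add algebra_simps)
  have "\<bar>S * C * D\<bar> \<le> (1 / (real j + 2)) * 1 * 1"
    unfolding abs_mult by (intro mult_mono S) (auto simp: C_def D_def)
  also have "\<dots> < (1 - (1 / (real j + 2))\<^sup>2) * \<bar>harmonic c n t\<bar>" using e by simp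
  also have "\<dots> \<le> C * C * \<bar>harmonic c n t\<bar>" by (intro mult_right_mono C2) simp
  finally have lt: "\<bar>S * C * D\<bar> < \<bar>C * C * harmonic c n t\<bar>" by (simp add: abs_mult)
  have "sgn C * square_wave c n (u + t) = sgn (C * harmonic c n (u + t))"
    by (simp add: square_wave_def sgn_mult)
  also have "\<dots> = sgn (C * C * harmonic c n t)" unfolding eq by (rule sgn_add_eq[OF lt])
  also have "\<dots> = square_wave c n t"
    using lt by (cases "C = 0") (auto simp: square_wave_def sgn_mult)
  finally have s: "sgn C * square_wave c n (u + t) = square_wave c n t" .
  have "comb n j u * square_wave c n (u + t) = (sgn C * square_wave c n (u + t)) / comb_mass n j"
    using True by (simp add: comb_def C_def)
  then show ?thesis unfolding s abs_comb[OF n] using True by simp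
qed (simp add: comb_def)

text \<open>For fixed \<open>t\<close> off the zeros the hypothesis of
  \<open>comb_times_square_wave\<close> holds for all large \<open>j\<close>, so the sequence is
  eventually constant, the comb having mass 1.\<close>

lemma comb_square_wave_tendsto:
  assumes n: "n \<ge> 1" and h: "harmonic c n t \<noteq> 0"
  shows "(\<lambda>j. LINT u|circle. comb n j u * square_wave c n (u + t)) \<longlonglongrightarrow> square_wave c n t"
proof (rule tendsto_eventually)
  have "(\<lambda>j. 1 / (real (j + 2))) \<longlonglongrightarrow> 0" using LIMSEQ_ignore_initial_segment[OF lim_1_over_n] .
  then have l: "(\<lambda>j. 1 / (real j + 2)) \<longlonglongrightarrow> 0" by (simp add: add.commute)
  have "(\<lambda>j. (1 - (1 / (real j + 2))\<^sup>2) * \<bar>harmonic c n t\<bar> - 1 / (real j + 2)) \<longlonglongrightarrow> (1 - 0\<^sup>2) * \<bar>harmonic c n t\<bar> - 0"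
    by (intro tendsto_intros l)
  then have "\<forall>\<^sub>F j in sequentially. 0 < (1 - (1 / (real j + 2))\<^sup>2) * \<bar>harmonic c n t\<bar> - 1 / (real j + 2)"
    by (rule order_tendstoD(1)) (use h in simp)
  then show "\<forall>\<^sub>F j in sequentially. (LINT u|circle. comb n j u * square_wave c n (u + t)) = square_wave c n t"
  proof eventually_elim
    case (elim j)
    then have "comb n j u * square_wave c n (u + t) = square_wave c n t * \<bar>comb n j u\<bar>" for u
      by (intro comb_times_square_wave[OF n]) simp
    then show ?case using integral_abs_comb[OF n] by simp
  qed
qed

text \<open>Doubling the angle puts the zeros of both parities among the multiples of
  \<open>pi / (2 * n)\<close>, a countable set.\<close>

lemma AE_harmonic_nonzero:
  assumes n: "n \<ge> 1" shows "AE t in circle. harmonic c n t \<noteq> 0"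
proof -
  define Z where "Z = {t. harmonic c n t = 0}"
  have "Z \<subseteq> range (\<lambda>j::int. of_int j * (pi / (2 * real n)))"
  proof
    fix t assume "t \<in> Z"
    then have "sin (2 * (real n * t)) = 0"
      by (cases c) (simp_all add: Z_def harmonic_def sin_double)
    then obtain j :: int where "2 * (real n * t) = of_int j * pi" unfolding sin_zero_iff_int2 by blast
    then have "t = of_int j * (pi / (2 * real n))" using n by (simp add: field_simps)
    then show "t \<in> range (\<lambda>j::int. of_int j * (pi / (2 * real n)))" by blast
  qed
  then have "countable Z" by (rule countable_subset) simp
  then have "Z \<in> null_sets lebesgue"
    using countable_imp_null_set_lborel by (intro null_sets_completionI)
  then have "AE t in lebesgue. harmonic c n t \<noteq> 0" by (rule AE_I') (auto simp: Z_def)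
  then show ?thesis by (rule AE_period)
qed

text \<open>\<open>s\<close> distinguishes the two orders of convolution: \<open>u + t\<close>
  arises when the comb is the input, \<open>u - t\<close> when it is the test function. The
  integrands are dominated by \<open>|K|\<close> since combs have mass 1.\<close>

lemma kernel_comb_tendsto:
  assumes n: "n \<ge> 1" and K: "integrable circle K" and s: "s = 1 \<or> s = - 1"
  shows "(\<lambda>j. LINT t|circle. K t * (LINT u|circle. comb n j u * square_wave c n (u + s * t)))
    \<longlonglongrightarrow> (LINT t|circle. K t * square_wave c n (s * t))"
proof -
  interpret P: finite_measure circle by (rule finite_measure_period)
  have idm: "(\<lambda>x. x) \<in> circle \<rightarrow>\<^sub>M borel"
    by (simp add: measurable_restrict_space1 measurable_completion)
  have bd: "\<bar>LINT u|circle. comb n j u * square_wave c n (u + s * t)\<bar> \<le> 1" for j t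
  proof -
    have i: "integrable circle (comb n j)"
      using comb_periodic_integrable[OF n] by (rule periodic_integrable.integrable_period)
    have m: "(\<lambda>u. square_wave c n (u + s * t)) \<in> borel_measurable circle"
      using idm by (intro measurable_compose[OF _ square_wave_borel] borel_measurable_add) auto
    have "norm (LINT u|circle. comb n j u * square_wave c n (u + s * t)) \<le> (LINT u|circle. \<bar>comb n j u\<bar>)"
      by (rule Bochner_Integration.integral_norm_bound_integral[OF integrable_times_bounded_real[OF i m abs_square_wave_le]])
         (use i abs_square_wave_le in \<open>auto simp: abs_mult mult_left_le\<close>)
    then show ?thesis using integral_abs_comb[OF n, of j] by simp
  qed
  have mI: "(\<lambda>t. LINT u|circle. comb n j u * square_wave c n (u + s * t)) \<in> borel_measurable circle" for j
  proof (rule P.borel_measurable_lebesgue_integral)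
    have "(\<lambda>p. snd p + s * fst p) \<in> (circle \<Otimes>\<^sub>M circle) \<rightarrow>\<^sub>M (borel :: real measure)"
      using measurable_compose[OF measurable_fst idm] measurable_compose[OF measurable_snd idm]
      by (intro borel_measurable_add borel_measurable_times) auto
    from measurable_compose[OF this square_wave_borel[of c n]] measurable_compose[OF measurable_compose[OF measurable_snd idm] comb_borel[of n j]]
    show "(\<lambda>(t, u). comb n j u * square_wave c n (u + s * t)) \<in> borel_measurable (circle \<Otimes>\<^sub>M circle)"
      unfolding case_prod_beta by (intro borel_measurable_times)
  qed
  have ms: "(\<lambda>t. square_wave c n (s * t)) \<in> borel_measurable circle"
    using idm by (intro measurable_compose[OF _ square_wave_borel] borel_measurable_times) auto
  have ne: "AE t in circle. harmonic c n (s * t) \<noteq> 0"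
    using AE_harmonic_nonzero[OF n, of c]
  proof eventually_elim
    case (elim t)
    then show ?case using s by (auto simp: harmonic_def)
  qed
  show ?thesis
  proof (rule integral_dominated_convergence[where w = "\<lambda>t. \<bar>K t\<bar>"])
    show "AE t in circle. (\<lambda>j. K t * (LINT u|circle. comb n j u * square_wave c n (u + s * t))) \<longlonglongrightarrow> K t * square_wave c n (s * t)"
      using ne by eventually_elim (intro tendsto_mult tendsto_const comb_square_wave_tendsto[OF n])
    show "AE t in circle. norm (K t * (LINT u|circle. comb n j u * square_wave c n (u + s * t))) \<le> \<bar>K t\<bar>" for j
      using bd[of j] by (auto simp: abs_mult mult_left_le)
    show "(\<lambda>t. K t * (LINT u|circle. comb n j u * square_wave c n (u + s * t))) \<in> borel_measurable circle" for j
      using K mI by (intro borel_measurable_times) auto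
    show "(\<lambda>t. K t * square_wave c n (s * t)) \<in> borel_measurable circle"
      using K ms by (intro borel_measurable_times) auto
  qed (use K in auto)
qed

text \<open>For \<open>p = 1\<close> the combs are the extremal inputs and the square wave is the dual test function;
  for \<open>p = \<infinity>\<close> the two exchange roles, so one limit serves both cases.\<close>

lemma extremal_norm_ge:
  assumes p: "p = 1 \<or> p = \<infinity>" and n: "n \<ge> 1" and K: "integrable circle K"
    and E: "\<And>\<phi>. \<phi> \<in> H_class p n \<Longrightarrow> periodic_integrable (E \<phi>)"
    and fc: "\<And>\<phi> m. \<phi> \<in> H_class p n \<Longrightarrow> fourier_coeff (E \<phi>) m = fourier_coeff \<phi> m * fourier_coeff K m"
  shows "ereal ((LINT t|circle. K t * square_wave c n t) / (2 * pi)) \<le> (SUP \<phi>\<in>H_class p n. Lp_norm p (E \<phi>))"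
proof -
  have pair: "ereal \<bar>(LINT t|circle. K t * (LINT x|circle. \<phi> (x - t) * w x)) / (2 * pi)\<bar>
      \<le> (SUP \<phi>\<in>H_class p n. Lp_norm p (E \<phi>))"
    if \<phi>: "\<phi> \<in> H_class p n" and w: "w \<in> borel_measurable lebesgue" "\<And>t. \<bar>w t\<bar> \<le> B"
      "p = 1 \<Longrightarrow> B \<le> 1" "p = \<infinity> \<Longrightarrow> (LINT t|circle. \<bar>w t\<bar>) \<le> 1" for \<phi> w B
  proof -
    have P: "periodic_integrable \<phi>" using Lp_space_periodic_integrable[OF p] \<phi> by (simp add: H_class_def)
    interpret E: periodic_integrable "E \<phi>" by (rule E[OF \<phi>])
    interpret c: periodic_integrable "convol \<phi> K" by (rule convol_periodic_integrable[OF P K])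
    have ae: "AE t in circle. E \<phi> t = convol \<phi> K t"
      by (rule fourier_coeff_eq_imp_AE_eq[OF E.integrable_period c.integrable_period])
         (simp add: fc[OF \<phi>] fourier_coeff_convol[OF P K])
    have "(LINT t|circle. E \<phi> t * w t) = (LINT t|circle. convol \<phi> K t * w t)"
    proof (rule integral_cong_AE)
      show "AE t in circle. E \<phi> t * w t = convol \<phi> K t * w t" using ae by eventually_elim simp
    qed (intro borel_measurable_times measurable_period E.lebesgue_measurable c.lebesgue_measurable w)+
    also have "\<dots> = (LINT t|circle. K t * (LINT x|circle. \<phi> (x - t) * w x)) / (2 * pi)"
      by (rule convol_pairing_real[OF P K measurable_period[OF w(1)] w(2)])
    finally have "ereal \<bar>(LINT t|circle. K t * (LINT x|circle. \<phi> (x - t) * w x)) / (2 * pi)\<bar> \<le> Lp_norm p (E \<phi>)"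
      using Lp_norm_ge[OF p E[OF \<phi>] measurable_period[OF w(1)] w(2-4)] by simp
    also have "\<dots> \<le> (SUP \<phi>\<in>H_class p n. Lp_norm p (E \<phi>))" by (rule SUP_upper[OF \<phi>])
    finally show ?thesis .
  qed
  define s :: real where "s = (if p = 1 then 1 else - 1)"
  have s: "s = 1 \<or> s = - 1" by (simp add: s_def)
  have ge: "ereal \<bar>(LINT t|circle. K t * (LINT u|circle. comb n j u * square_wave c n (u + s * t))) / (2 * pi)\<bar>
      \<le> (SUP \<phi>\<in>H_class p n. Lp_norm p (E \<phi>))" for j
  proof (cases "p = 1")
    case True
    have "(LINT x|circle. comb n j (x - t) * square_wave c n x) = (LINT u|circle. comb n j u * square_wave c n (u + t))" for t
    proof -
      interpret comb: periodic_integrable "comb n j" by (rule comb_periodic_integrable[OF n])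
      define F where "F = (\<lambda>u. comb n j u * square_wave c n (u + t))"
      have "square_wave c n (u + 2 * pi + t) = square_wave c n (u + t)" for u
        using periodic_integrable.periodic[OF square_wave_periodic_integrable, of c n "u + t"] by (simp add: algebra_simps)
      then have per: "F (u + 2 * pi) = F u" for u by (simp add: F_def comb.periodic)
      have "(\<lambda>u. square_wave c n (u + t)) \<in> borel_measurable lebesgue"
        by (intro measurable_completion) simp
      then have "integrable circle F" unfolding F_def
        by (intro integrable_times_bounded_real[OF comb.integrable_period _ abs_square_wave_le]) simp
      from period_integral_shift(2)[of F "-t", OF per this] show ?thesis by (simp add: F_def)
    qed
    then show ?thesis
      using pair[of "comb n j" "square_wave c n" 1] comb_H_class[OF n] True square_wave_measurable abs_square_wave_le
      by (simp add: s_def)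
  next
    case False
    then have "p = \<infinity>" using p by simp
    then show ?thesis
      using pair[of "square_wave c n" "comb n j" "1 / comb_mass n j"] square_wave_H_class[OF n] comb_measurable comb_bounded[OF n]
        integral_abs_comb[OF n, of j]
      by (simp add: s_def mult.commute)
  qed
  define V where "V = (LINT t|circle. K t * square_wave c n t) / (2 * pi)"
  have "(\<lambda>j. ereal \<bar>(LINT t|circle. K t * (LINT u|circle. comb n j u * square_wave c n (u + s * t))) / (2 * pi)\<bar>)
      \<longlonglongrightarrow> ereal \<bar>(LINT t|circle. K t * square_wave c n (s * t)) / (2 * pi)\<bar>"
    by (intro tendsto_intros kernel_comb_tendsto[OF n K s]) auto
  then have ub: "ereal \<bar>(LINT t|circle. K t * square_wave c n (s * t)) / (2 * pi)\<bar> \<le> (SUP \<phi>\<in>H_class p n. Lp_norm p (E \<phi>))"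
    by (rule LIMSEQ_le_const2) (use ge in auto)
  \<comment> \<open>The square wave is even or odd, so reversing its argument changes at most the
    sign of the integral, and the absolute value absorbs it.\<close>
  have eq: "\<bar>(LINT t|circle. K t * square_wave c n (s * t)) / (2 * pi)\<bar> = \<bar>V\<bar>"
  proof (cases "c \<or> s = 1")
    case True
    then have "square_wave c n (s * t) = square_wave c n t" for t using s by (auto simp: square_wave_def harmonic_def)
    then show ?thesis by (simp add: V_def)
  next
    case False
    then have "square_wave c n (s * t) = - square_wave c n t" for t using s by (auto simp: square_wave_def harmonic_def sgn_minus)
    then show ?thesis by (simp add: V_def)
  qed
  have "ereal V \<le> ereal \<bar>V\<bar>" by simp
  also have "\<dots> \<le> (SUP \<phi>\<in>H_class p n. Lp_norm p (E \<phi>))" using ub unfolding eq .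
  finally show ?thesis unfolding V_def .
qed

text \<open>Inputs are orthogonal to polynomials of degree below \<open>n\<close>, so
  \<open>K\<close> may be replaced by \<open>K - T\<close>; the square wave is orthogonal to
  \<open>T\<close> as well, so the norm of \<open>KM M - T\<close> is the integral of
  \<open>KM M\<close> against it. The distance from \<open>KM M\<close> to \<open>K\<close> enters
  twice, which over \<open>2 * pi\<close> gives the divisor \<open>pi\<close>.\<close>

lemma extremal_norm_le:
  assumes p: "p = 1 \<or> p = \<infinity>" and n: "n \<ge> 1" and K: "integrable circle K"
    and KM: "\<And>M. integrable circle (KM M)" "\<And>M. sign_matched c n (KM M)"
    and lim: "(\<lambda>M. LINT t|circle. \<bar>KM M t - K t\<bar>) \<longlonglongrightarrow> 0"
    and \<phi>: "\<phi> \<in> H_class p n" and E: "periodic_integrable E"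
    and fc: "\<And>m. fourier_coeff E m = fourier_coeff \<phi> m * fourier_coeff K m"
  shows "Lp_norm p E \<le> ereal ((LINT t|circle. K t * square_wave c n t) / (2 * pi))"
proof -
  define S where "S = square_wave c n"
  have S: "S \<in> borel_measurable circle" "\<bar>S t\<bar> \<le> 1" for t
    unfolding S_def by (auto intro: measurable_period square_wave_measurable abs_square_wave_le)
  note iS = integrable_times_bounded_real[OF _ S]
  have i: "integrable circle S" unfolding S_def
    by (rule periodic_integrable.integrable_period[OF square_wave_periodic_integrable])
  have bd: "Lp_norm p E \<le> ereal ((LINT t|circle. K t * S t) / (2 * pi) + (LINT t|circle. \<bar>KM M t - K t\<bar>) / pi)" for M
  proof -
    obtain T where T: "low_degree c n T" and sg: "\<And>t. t \<in> {-pi..pi} \<Longrightarrow> \<bar>KM M t - T t\<bar> = (KM M t - T t) * S t"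
      using KM(2)[of M] by (auto simp: sign_matched_def S_def square_wave_def)
    have iT: "integrable circle T" by (rule integrable_low_degree[OF T])
    have KT: "integrable circle (\<lambda>t. K t - T t)" using K iT by auto
    have "fourier_coeff E m = fourier_coeff \<phi> m * fourier_coeff (\<lambda>t. K t - T t) m" for m
    proof (cases "\<bar>m\<bar> \<le> int n - 1")
      case True
      then have "fourier_coeff \<phi> m = 0" using \<phi> by (simp add: H_class_def)
      then show ?thesis by (simp add: fc)
    next
      case False
      then show ?thesis by (simp add: fc fourier_coeff_diff[OF K iT] fourier_coeff_low_degree[OF T])
    qed
    then have "Lp_norm p E \<le> ereal ((LINT t|circle. \<bar>K t - T t\<bar>) / (2 * pi))"
      by (rule Lp_norm_le[OF p \<phi> E KT])
    also have "(LINT t|circle. \<bar>K t - T t\<bar>) \<le> (LINT t|circle. \<bar>KM M t - K t\<bar> + \<bar>KM M t - T t\<bar>)"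
      by (rule integral_mono) (use K KM(1)[of M] iT in auto)
    also have "\<dots> = (LINT t|circle. \<bar>KM M t - K t\<bar>) + (LINT t|circle. \<bar>KM M t - T t\<bar>)"
      by (rule Bochner_Integration.integral_add) (use K KM(1)[of M] iT in auto)
    also have "(LINT t|circle. \<bar>KM M t - T t\<bar>) = (LINT t|circle. KM M t * S t - S t * T t)"
      by (rule Bochner_Integration.integral_cong) (use sg in \<open>auto simp: space_restrict_space algebra_simps\<close>)
    also have "\<dots> = (LINT t|circle. KM M t * S t) - (LINT t|circle. S t * T t)"
      using iS[OF KM(1)[of M]] iS[OF iT] by (intro Bochner_Integration.integral_diff) (auto simp: mult.commute)
    also have "(LINT t|circle. S t * T t) = 0"
      by (rule integral_low_degree[OF i _ T]) (auto simp: S_def fourier_coeff_square_wave_low[OF n])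
    also have "(LINT t|circle. KM M t * S t) = (LINT t|circle. K t * S t) + (LINT t|circle. (KM M t - K t) * S t)"
      using iS[OF KM(1)[of M]] iS[OF K] by (simp add: left_diff_distrib)
    also have "(LINT t|circle. (KM M t - K t) * S t) \<le> (LINT t|circle. \<bar>KM M t - K t\<bar>)"
    proof (rule integral_mono[OF iS])
      show "(KM M t - K t) * S t \<le> \<bar>KM M t - K t\<bar>" for t
      proof -
        have "(KM M t - K t) * S t \<le> \<bar>KM M t - K t\<bar> * \<bar>S t\<bar>" by (simp add: abs_mult[symmetric])
        also have "\<dots> \<le> \<bar>KM M t - K t\<bar>" using S(2)[of t] by (simp add: mult_left_le)
        finally show ?thesis .
      qed
    qed (use K KM(1)[of M] in auto)
    finally show ?thesis by (simp add: divide_right_mono add_divide_distrib add.commute)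
  qed
  have "(\<lambda>M. ereal ((LINT t|circle. K t * S t) / (2 * pi) + (LINT t|circle. \<bar>KM M t - K t\<bar>) / pi))
      \<longlonglongrightarrow> ereal ((LINT t|circle. K t * S t) / (2 * pi) + 0 / pi)"
    by (intro tendsto_intros lim) auto
  then have "Lp_norm p E \<le> ereal ((LINT t|circle. K t * S t) / (2 * pi) + 0 / pi)"
    by (rule LIMSEQ_le_const) (use bd in auto)
  then show ?thesis by (simp add: S_def)
qed

section \<open>Integrals of harmonics and kernels against the square wave\<close>

lemma has_integral_sine_square_wave:
  assumes m: "odd m"
  shows "((\<lambda>t. sin (real m * t) * sgn (sin t)) has_integral 2 * real k / real m) {0..real k * pi}"
proof (induction k)
  case (Suc k)
  have m0: "real m > 0" using m by (auto intro!: Nat.gr0I)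
  define F where "F t = - ((-1) ^ k * cos (real m * t)) / real m" for t
  have d: "(F has_vector_derivative (-1) ^ k * sin (real m * t)) (at t within S)" for t S
    unfolding F_def has_real_derivative_iff_has_vector_derivative[symmetric]
    using m0 by (auto intro!: derivative_eq_intros)
  \<comment> \<open>The sign is constant on the arch from \<open>k * pi\<close> to
    \<open>(k + 1) * pi\<close>. For odd \<open>m\<close> the integral of \<open>sin (m * t)\<close>
    over it, times that sign, is \<open>2 / m\<close>, so the arches add up without
    cancellation.\<close>
  have sg: "sgn (sin t) = (-1) ^ k" if "t \<in> {real k * pi<..<real (Suc k) * pi}" for t
  proof -
    have "0 < sin (t - real k * pi)" by (rule sin_gt_zero) (use that in \<open>auto simp: algebra_simps\<close>)
    moreover have "sin t = (-1) ^ k * sin (t - real k * pi)"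
      using sin_add[of "t - real k * pi" "real k * pi"] by simp
    ultimately show ?thesis by (cases "even k") auto
  qed
  have mk: "cos (real m * (real j * pi)) = (-1) ^ j" for j
  proof -
    have "cos (real m * (real j * pi)) = cos (real (m * j) * pi)" by (simp add: mult.assoc)
    also have "\<dots> = (-1) ^ (m * j)" by (rule cos_npi)
    also have "\<dots> = (-1) ^ j" using m by (simp add: power_mult)
    finally show ?thesis .
  qed
  have "((\<lambda>t. (-1) ^ k * sin (real m * t)) has_integral (F (real (Suc k) * pi) - F (real k * pi))) {real k * pi..real (Suc k) * pi}"
    by (rule fundamental_theorem_of_calculus[OF _ d]) simp
  also have "F (real (Suc k) * pi) - F (real k * pi) = 2 / real m"
    unfolding F_def mk by (simp add: diff_divide_distrib[symmetric] power_add[symmetric] mult_2[symmetric])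
  finally have "((\<lambda>t. (-1) ^ k * sin (real m * t)) has_integral 2 / real m) (cbox (real k * pi) (real (Suc k) * pi))" by simp
  then have "((\<lambda>t. sin (real m * t) * sgn (sin t)) has_integral 2 / real m) (cbox (real k * pi) (real (Suc k) * pi))"
    by (rule has_integral_spike_interior) (use sg in \<open>auto simp: box_real\<close>)
  then have s: "((\<lambda>t. sin (real m * t) * sgn (sin t)) has_integral 2 / real m) {real k * pi..real (Suc k) * pi}" by simp
  have "((\<lambda>t. sin (real m * t) * sgn (sin t)) has_integral 2 * real k / real m + 2 / real m) {0..real (Suc k) * pi}"
    by (rule has_integral_combine[OF _ _ Suc s]) (auto simp: mult_right_mono)
  then show ?case by (simp add: add_divide_distrib distrib_left add.commute)
qed (simp add: has_integral_refl)

lemma integral_sine_square_wave: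
  assumes m: "odd m" and n: "n \<ge> 1"
  shows "(LINT t|circle. harmonic False (m * n) t * square_wave False n t) = 4 / real m"
proof -
  define g where "g = (\<lambda>t. sin (real m * t) * sgn (sin t))"
  have gp: "g (t + real n * pi) = g t" for t
  proof -
    have "sin (real m * (t + real n * pi)) = (-1) ^ n * sin (real m * t)"
    proof -
      have "sin (real m * (t + real n * pi)) = sin (real m * t + real (m * n) * pi)" by (simp add: algebra_simps)
      also have "\<dots> = sin (real m * t) * (-1) ^ (m * n)" by (simp add: sin_add del: of_nat_mult)
      finally show ?thesis using m by (simp add: power_mult)
    qed
    moreover have "sin (t + real n * pi) = (-1) ^ n * sin t" by (simp add: sin_add)
    ultimately show ?thesis by (cases "even n") (simp_all add: g_def sgn_minus)
  qed
  have "(g has_integral 2 * real (2 * n) / real m) (cbox 0 (real (2 * n) * pi))"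
    using has_integral_sine_square_wave[OF m, of "2 * n"] by (simp add: g_def)
  \<comment> \<open>The substitution \<open>n * x + n * pi\<close> carries \<open>[-pi, pi]\<close>
    onto \<open>2 * n\<close> full arches; the shift by \<open>n * pi\<close> is then dropped by
    \<open>gp\<close>.\<close>
  from has_integral_affinity[OF this, of "real n" "real n * pi"] n
  have "((\<lambda>x. g (real n * x + real n * pi)) has_integral (1 / real n) * (2 * real (2 * n) / real m))
     ((\<lambda>x. (1 / real n) *\<^sub>R x + - ((1 / real n) *\<^sub>R (real n * pi))) ` cbox 0 (real (2 * n) * pi))"
    by simp
  also have "(\<lambda>x. (1 / real n) *\<^sub>R x + - ((1 / real n) *\<^sub>R (real n * pi))) ` cbox 0 (real (2 * n) * pi) = {-pi..pi}"
    using n by (subst image_affinity_cbox) (auto simp: field_simps)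
  finally have H: "((\<lambda>x. g (real n * x)) has_integral 4 / real m) {-pi..pi}"
    using n by (simp add: gp)
  have eq: "g (real n * x) = harmonic False (m * n) x * square_wave False n x" for x
    by (simp add: g_def harmonic_def square_wave_def mult.assoc)
  have "integrable circle (\<lambda>x. harmonic False (m * n) x * square_wave False n x)"
    by (rule integrable_times_bounded_real[OF integrable_harmonic measurable_period[OF square_wave_measurable] abs_square_wave_le])
  then show ?thesis using H unfolding eq by (simp add: lebesgue_integral_eq_integral integral_unique)
qed

text \<open>A shift by \<open>pi / (2 * n)\<close>, a quarter of the wave's period, turns the sine
  case into this one; the harmonic of frequency \<open>(2 * i + 1) * n\<close> picks up the factor
  \<open>(-1) ^ i\<close>.\<close>

lemma integral_cosine_square_wave:
  assumes n: "n \<ge> 1"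
  shows "(LINT t|circle. harmonic True ((2 * i + 1) * n) t * square_wave True n t) = (-1) ^ i * 4 / real (2 * i + 1)"
proof -
  define m where "m = 2 * i + 1"
  define f where "f = (\<lambda>t. harmonic False (m * n) t * square_wave False n t)"
  have per: "f (t + 2 * pi) = f t" for t by (simp add: f_def square_wave_def harmonic_periodic)
  have int: "integrable circle f" unfolding f_def
    by (rule integrable_times_bounded_real[OF integrable_harmonic measurable_period[OF square_wave_measurable] abs_square_wave_le])
  have "f (t + pi / (2 * real n)) = (-1) ^ i * (harmonic True (m * n) t * square_wave True n t)" for t
  proof -
    have a: "real (m * n) * (t + pi / (2 * real n)) = (real (m * n) * t + pi / 2) + real i * pi"
      using n by (simp add: m_def field_simps)
    have b: "real n * (t + pi / (2 * real n)) = real n * t + pi / 2" using n by (simp add: field_simps)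
    show ?thesis unfolding f_def harmonic_def square_wave_def if_False if_True a b
      by (simp add: sin_add cos_add)
  qed
  then have "(-1) ^ i * (LINT t|circle. harmonic True (m * n) t * square_wave True n t) = 4 / real m"
    using period_integral_shift(2)[of f "pi / (2 * real n)", OF per int] integral_sine_square_wave[of m n] n
    by (simp add: f_def m_def)
  then have "(-1) ^ i * ((-1) ^ i * (LINT t|circle. harmonic True (m * n) t * square_wave True n t)) = (-1) ^ i * (4 / real m)"
    by simp
  then show ?thesis by (simp add: m_def mult.assoc[symmetric] power_add[symmetric] mult_2[symmetric])
qed

text \<open>Convergence in \<open>L_1\<close> allows integration term by term against the bounded
  square wave. By antiperiodicity only odd multiples of \<open>n\<close> contribute, and the series
  is reindexed by them; 8 is the kernel's factor 2 times the 4 of the single integrals.\<close>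

lemma integral_kernel_square_wave:
  assumes dc: "decreasing_coeffs r C a" and r: "r > 0" and C: "0 \<le> C" and n: "n \<ge> 1"
  shows "(\<lambda>i. (if c then (-1) ^ i else 1) * (8 * a ((2 * i + 1) * n) / real (2 * i + 1)))
    sums (LINT t|circle. kernel c a t * square_wave c n t)"
proof -
  define I where "I k = (LINT t|circle. harmonic c k t * square_wave c n t)" for k
  note iS = integrable_times_bounded_real[OF _ measurable_period[OF square_wave_measurable[of c n]] abs_square_wave_le]
  interpret k: periodic_integrable "kernel c a" by (rule integrable_kernel[OF dc r C])
  have partial: "(LINT t|circle. kernel_sum c a N t * square_wave c n t) = (\<Sum>j<N. 2 * a (Suc j) * I (Suc j))" for N
  proof -
    have "(LINT t|circle. kernel_sum c a N t * square_wave c n t) =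
       (LINT t|circle. (\<Sum>j<N. 2 * a (Suc j) * (harmonic c (Suc j) t * square_wave c n t)))"
      by (simp add: kernel_sum_def sum_distrib_right mult.assoc)
    also have "\<dots> = (\<Sum>j<N. 2 * a (Suc j) * I (Suc j))"
      unfolding I_def using iS[OF integrable_harmonic] by (subst Bochner_Integration.integral_sum) auto
    finally show ?thesis .
  qed
  have "(\<lambda>N. (LINT t|circle. kernel_sum c a N t * square_wave c n t) - (LINT t|circle. kernel c a t * square_wave c n t)) \<longlonglongrightarrow> 0"
  proof (rule Lim_null_comparison[OF always_eventually kernel_sum_L1_tendsto[OF dc r C, of c]], rule allI)
    fix N
    have "norm (LINT t|circle. (kernel_sum c a N t - kernel c a t) * square_wave c n t) \<le> (LINT t|circle. \<bar>kernel_sum c a N t - kernel c a t\<bar>)"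
      by (rule Bochner_Integration.integral_norm_bound_integral[OF iS])
         (use integrable_kernel_sum k.integrable_period abs_square_wave_le in \<open>auto simp: abs_mult mult_left_le\<close>)
    then show "norm ((LINT t|circle. kernel_sum c a N t * square_wave c n t) - (LINT t|circle. kernel c a t * square_wave c n t)) \<le> (LINT t|circle. \<bar>kernel_sum c a N t - kernel c a t\<bar>)"
      using iS[OF integrable_kernel_sum] iS[OF k.integrable_period] by (simp add: left_diff_distrib)
  qed
  then have "(\<lambda>j. 2 * a (Suc j) * I (Suc j)) sums (LINT t|circle. kernel c a t * square_wave c n t)"
    unfolding sums_def partial by (rule LIM_zero_cancel)
  \<comment> \<open>The index \<open>j\<close> stands for the harmonic of order
    \<open>Suc j\<close>, hence the \<open>- 1\<close>.\<close>
  moreover have "strict_mono (\<lambda>i. (2 * i + 1) * n - 1)"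
    using n by (intro strict_monoI) (auto simp: less_diff_iff)
  moreover have "2 * a (Suc j) * I (Suc j) = 0" if j: "j \<notin> range (\<lambda>i. (2 * i + 1) * n - 1)" for j
  proof -
    have "fourier_coeff (square_wave c n) (int (Suc j)) = 0"
    proof (rule ccontr)
      assume "fourier_coeff (square_wave c n) (int (Suc j)) \<noteq> 0"
      then obtain l where l: "int (Suc j) = (2 * l + 1) * int n"
        using fourier_coeff_antiperiodic[OF square_wave_periodic_integrable n square_wave_antiperiodic[OF n]] by blast
      have "0 < (2 * l + 1) * int n" unfolding l[symmetric] by simp
      then have "0 < 2 * l + 1" using n by (simp add: zero_less_mult_iff)
      then have "int (Suc j) = int ((2 * nat l + 1) * n)" using l by (simp add: algebra_simps)
      then have "Suc j = (2 * nat l + 1) * n" by (simp only: of_nat_eq_iff)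
      then have "j = (2 * nat l + 1) * n - 1" by simp
      then show False using j by blast
    qed
    from integral_harmonic_fourier[OF periodic_integrable.integrable_period[OF square_wave_periodic_integrable] this]
    show ?thesis by (simp add: I_def mult.commute)
  qed
  ultimately have "(\<lambda>i. 2 * a (Suc ((2 * i + 1) * n - 1)) * I (Suc ((2 * i + 1) * n - 1))) sums (LINT t|circle. kernel c a t * square_wave c n t)"
    using sums_mono_reindex[of "\<lambda>i. (2 * i + 1) * n - 1" "\<lambda>j. 2 * a (Suc j) * I (Suc j)"] by simp
  moreover have "Suc ((2 * i + 1) * n - 1) = (2 * i + 1) * n" for i using n by simp
  moreover have "2 * a ((2 * i + 1) * n) * I ((2 * i + 1) * n) = (if c then (-1) ^ i else 1) * (8 * a ((2 * i + 1) * n) / real (2 * i + 1))" for i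
    using integral_sine_square_wave[of "2 * i + 1" n] integral_cosine_square_wave[of n i] n
    by (cases c) (simp_all add: I_def)
  ultimately show ?thesis by simp
qed

section \<open>Convex decreasing functions\<close>

text \<open>A convex cone closed under products, under substitution of concave powers and under
  pointwise limits; these closure properties carry the hypotheses on \<open>h\<close> over to the
  coefficients.\<close>

definition convex_decreasing :: "(real \<Rightarrow> real) \<Rightarrow> bool" where
  "convex_decreasing f \<longleftrightarrow> (\<forall>x>0. 0 \<le> f x) \<and> (\<forall>x>0. \<forall>y\<ge>x. f y \<le> f x) \<and> convex_on {0<..} f"

lemma convex_decreasingD:
  assumes "convex_decreasing f"
  shows "0 < x \<Longrightarrow> 0 \<le> f x" "0 < x \<Longrightarrow> x \<le> y \<Longrightarrow> f y \<le> f x"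
    and "0 < x \<Longrightarrow> 0 < y \<Longrightarrow> 0 \<le> t \<Longrightarrow> t \<le> 1 \<Longrightarrow> f ((1 - t) * x + t * y) \<le> (1 - t) * f x + t * f y"
  using assms convex_onD[of "{0<..}" f t x y] by (auto simp: convex_decreasing_def)

lemma convex_decreasingI:
  assumes "\<And>x. 0 < x \<Longrightarrow> 0 \<le> f x" "\<And>x y. 0 < x \<Longrightarrow> x \<le> y \<Longrightarrow> f y \<le> f x"
    and "\<And>t x y. 0 < t \<Longrightarrow> t < 1 \<Longrightarrow> 0 < x \<Longrightarrow> x < y \<Longrightarrow> f ((1 - t) * x + t * y) \<le> (1 - t) * f x + t * f y"
  shows "convex_decreasing f"
  unfolding convex_decreasing_def using assms by (auto intro!: convex_on_linorderI)

lemma convex_decreasing_midpoint: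
  assumes "convex_decreasing f" "0 < x" shows "2 * f (x + 1) \<le> f x + f (x + 2)"
proof -
  have "(1 - 1 / 2) * x + 1 / 2 * (x + 2) = x + 1" by (simp add: field_simps)
  then have "f (x + 1) \<le> (1 - 1 / 2) * f x + 1 / 2 * f (x + 2)"
    using convex_decreasingD(3)[OF assms(1), of x "x + 2" "1 / 2"] assms(2) by simp
  then show ?thesis by simp
qed

lemma convex_decreasing_cong:
  assumes "convex_decreasing f" "\<And>x. 0 < x \<Longrightarrow> f x = g x" shows "convex_decreasing g"
proof (rule convex_decreasingI)
  fix t x y :: real assume t: "0 < t" "t < 1" "0 < x" "x < y"
  then have "0 < (1 - t) * x + t * y" by (intro add_pos_pos mult_pos_pos) auto
  then show "g ((1 - t) * x + t * y) \<le> (1 - t) * g x + t * g y"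
    using convex_decreasingD(3)[OF assms(1), of x y t] assms(2) t by simp
next
  show "0 \<le> g x" if "0 < x" for x using convex_decreasingD(1)[OF assms(1) that] assms(2)[OF that] by simp
  show "g y \<le> g x" if "0 < x" "x \<le> y" for x y
    using convex_decreasingD(2)[OF assms(1) that] assms(2)[of x] assms(2)[of y] that by simp
qed

lemma convex_decreasing_add:
  assumes "convex_decreasing f" "convex_decreasing g" shows "convex_decreasing (\<lambda>x. f x + g x)"
  using assms by (auto simp: convex_decreasing_def intro!: convex_on_add add_mono)

lemma convex_decreasing_cmult:
  assumes "convex_decreasing f" "0 \<le> c" shows "convex_decreasing (\<lambda>x. c * f x)"
  using assms by (auto simp: convex_decreasing_def intro!: convex_on_cmul mult_left_mono)

text \<open>The product of the two chords is the chord of the product minus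
  \<open>t * (1 - t)\<close> times the product of the drops of \<open>f\<close> and
  \<open>g\<close>, which is nonnegative because both functions decrease.\<close>

lemma convex_decreasing_mult:
  assumes f: "convex_decreasing f" and g: "convex_decreasing g" shows "convex_decreasing (\<lambda>x. f x * g x)"
proof (rule convex_decreasingI)
  note F = convex_decreasingD[OF f] and G = convex_decreasingD[OF g]
  show "0 \<le> f x * g x" if "0 < x" for x using F G that by auto
  show "f y * g y \<le> f x * g x" if "0 < x" "x \<le> y" for x y
    using F G that by (intro mult_mono) auto
  fix t x y :: real assume t: "0 < t" "t < 1" "0 < x" "x < y"
  then have p: "0 < (1 - t) * x + t * y" by (intro add_pos_pos mult_pos_pos) auto
  have "f ((1 - t) * x + t * y) * g ((1 - t) * x + t * y) \<le> ((1 - t) * f x + t * f y) * ((1 - t) * g x + t * g y)"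
    using F[of x] G[of x] F[of y] G[of y] t p F(1) G(1) F(3) G(3) by (intro mult_mono) auto
  also have "\<dots> = (1 - t) * (f x * g x) + t * (f y * g y) - t * (1 - t) * ((f x - f y) * (g x - g y))"
    by (simp add: algebra_simps)
  also have "\<dots> \<le> (1 - t) * (f x * g x) + t * (f y * g y)"
  proof -
    have "0 \<le> t * (1 - t) * ((f x - f y) * (g x - g y))"
      using F(2)[of x y] G(2)[of x y] t by (intro mult_nonneg_nonneg) auto
    then show ?thesis by linarith
  qed
  finally show "f ((1 - t) * x + t * y) * g ((1 - t) * x + t * y) \<le> (1 - t) * (f x * g x) + t * (f y * g y)" .
qed

lemma powr_antimono: "0 < x \<Longrightarrow> x \<le> y \<Longrightarrow> e \<le> 0 \<Longrightarrow> y powr e \<le> (x powr e :: real)"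
  by (cases "e = 0") (auto intro: powr_mono2')

lemma convex_decreasing_powr: assumes "e \<le> 0" shows "convex_decreasing (\<lambda>x. x powr e)"
  unfolding convex_decreasing_def
proof (intro conjI allI impI)
  show "convex_on {0<..} (\<lambda>x. x powr e)"
  proof (rule convex_on_realI)
    show "((\<lambda>x. x powr e) has_real_derivative e * x powr (e - 1)) (at x)" if "x \<in> {0<..}" for x
      using that by (auto intro!: derivative_eq_intros)
    show "e * x powr (e - 1) \<le> e * y powr (e - 1)" if "x \<in> {0<..}" "y \<in> {0<..}" "x \<le> y" for x y
      using that assms by (intro mult_left_mono_neg powr_antimono) auto
  qed auto
qed (use assms powr_antimono in auto)

lemma powr_concave:
  assumes "0 < \<alpha>" "\<alpha> \<le> 1" "0 < x" "0 < y" "0 \<le> t" "t \<le> 1"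
  shows "(1 - t) * x powr \<alpha> + t * y powr \<alpha> \<le> ((1 - t) * x + t * y) powr (\<alpha> :: real)"
proof -
  have "convex_on {0<..} (\<lambda>x. - (x powr \<alpha>))"
  proof (rule convex_on_realI)
    show "((\<lambda>x. - (x powr \<alpha>)) has_real_derivative - (\<alpha> * x powr (\<alpha> - 1))) (at x)" if "x \<in> {0<..}" for x
      using that by (auto intro!: derivative_eq_intros)
    show "- (\<alpha> * x powr (\<alpha> - 1)) \<le> - (\<alpha> * y powr (\<alpha> - 1))" if "x \<in> {0<..}" "y \<in> {0<..}" "x \<le> y" for x y
      using that assms by (auto intro!: powr_antimono)
  qed auto
  from convex_onD[OF this, of t x y] assms show ?thesis by simp
qed

text \<open>For \<open>\<alpha> \<le> 1\<close> the inner power is concave, and a decreasing convex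
  function of a concave one is convex.\<close>

lemma convex_decreasing_compose_powr:
  assumes f: "convex_decreasing f" and d: "0 < \<delta>" and a: "0 < \<alpha>" "\<alpha> \<le> 1"
  shows "convex_decreasing (\<lambda>x. f (\<delta> * x powr \<alpha>))"
proof (rule convex_decreasingI)
  note F = convex_decreasingD[OF f]
  show "0 \<le> f (\<delta> * x powr \<alpha>)" if "0 < x" for x using F(1) that d by simp
  show "f (\<delta> * y powr \<alpha>) \<le> f (\<delta> * x powr \<alpha>)" if "0 < x" "x \<le> y" for x y
    using that d a by (intro F(2)) (auto intro!: powr_mono2)
  fix t x y :: real assume t: "0 < t" "t < 1" "0 < x" "x < y"
  have c: "(1 - t) * x powr \<alpha> + t * y powr \<alpha> \<le> ((1 - t) * x + t * y) powr \<alpha>"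
    by (rule powr_concave[OF a]) (use t in auto)
  have p: "0 < (1 - t) * x powr \<alpha> + t * y powr \<alpha>" using t by (intro add_pos_pos mult_pos_pos) auto
  have "f (\<delta> * ((1 - t) * x + t * y) powr \<alpha>) \<le> f (\<delta> * ((1 - t) * x powr \<alpha> + t * y powr \<alpha>))"
    using c d p by (intro F(2)) auto
  also have "\<delta> * ((1 - t) * x powr \<alpha> + t * y powr \<alpha>) = (1 - t) * (\<delta> * x powr \<alpha>) + t * (\<delta> * y powr \<alpha>)"
    by (simp add: algebra_simps)
  also have "f \<dots> \<le> (1 - t) * f (\<delta> * x powr \<alpha>) + t * f (\<delta> * y powr \<alpha>)"
    using t d by (intro F(3)) auto
  finally show "f (\<delta> * ((1 - t) * x + t * y) powr \<alpha>) \<le> (1 - t) * f (\<delta> * x powr \<alpha>) + t * f (\<delta> * y powr \<alpha>)" .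
qed

lemma convex_decreasing_limit:
  assumes f: "\<And>k. convex_decreasing (F k)" and lim: "\<And>x. 0 < x \<Longrightarrow> (\<lambda>k. F k x) \<longlonglongrightarrow> f x"
  shows "convex_decreasing f"
proof (rule convex_decreasingI)
  note F = convex_decreasingD[OF f]
  show "0 \<le> f x" if "0 < x" for x
    by (rule LIMSEQ_le_const[OF lim[OF that]]) (use F(1)[OF that] in auto)
  show "f y \<le> f x" if "0 < x" "x \<le> y" for x y
    by (rule LIMSEQ_le[OF lim lim]) (use F(2)[OF that] that in auto)
  fix t x y :: real assume t: "0 < t" "t < 1" "0 < x" "x < y"
  then have p: "0 < (1 - t) * x + t * y" by (intro add_pos_pos mult_pos_pos) auto
  have "(\<lambda>k. (1 - t) * F k x + t * F k y) \<longlonglongrightarrow> (1 - t) * f x + t * f y"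
    using t by (intro tendsto_intros lim) auto
  then show "f ((1 - t) * x + t * y) \<le> (1 - t) * f x + t * f y"
    by (rule LIMSEQ_le[OF lim[OF p]]) (use F(3) t in auto)
qed

text \<open>The pointwise content of \<open>\<gamma> \<le> \<gamma>\<^sub>m\<close>: the family is affine in \<open>\<gamma>\<close>, so the set of admissible
  parameters is downward closed and contains its supremum.\<close>

lemma convex_decreasing_le_Sup:
  assumes V: "convex_decreasing V" and S: "\<And>\<gamma>. \<gamma> \<in> S \<Longrightarrow> convex_decreasing (\<lambda>x. U x - \<gamma> * V x)"
    and le: "ereal \<gamma> \<le> Sup (ereal ` S)"
  shows "convex_decreasing (\<lambda>x. U x - \<gamma> * V x)"
proof -
  have below: "convex_decreasing (\<lambda>x. U x - \<gamma>' * V x)" if "\<gamma>' < \<gamma>" for \<gamma>'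
  proof -
    have "ereal \<gamma>' < Sup (ereal ` S)" using that le by (intro less_le_trans[OF _ le]) simp
    then obtain s where s: "s \<in> S" "\<gamma>' < s" unfolding less_Sup_iff by auto
    have "convex_decreasing (\<lambda>x. (U x - s * V x) + (s - \<gamma>') * V x)"
      using S[OF s(1)] V s(2) by (intro convex_decreasing_add convex_decreasing_cmult) auto
    then show ?thesis by (simp add: algebra_simps)
  qed
  show ?thesis
  proof (rule convex_decreasing_limit)
    show "convex_decreasing (\<lambda>x. U x - (\<gamma> - inverse (real (Suc k))) * V x)" for k
      by (rule below) simp
    have "(\<lambda>k. U x - (\<gamma> - inverse (real (Suc k))) * V x) \<longlonglongrightarrow> U x - (\<gamma> - 0) * V x" for x
      by (intro tendsto_intros LIMSEQ_inverse_real_of_nat)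
    then show "(\<lambda>k. U x - (\<gamma> - inverse (real (Suc k))) * V x) \<longlonglongrightarrow> U x - \<gamma> * V x" for x by simp
  qed
qed

text \<open>The counterpart of the class \<open>M_2\<close>. The derivative is a witness instead of
  a \<open>deriv\<close> term, so that product and chain rule can supply it directly.\<close>

definition smooth_convex_decreasing :: "(real \<Rightarrow> real) \<Rightarrow> bool" where
  "smooth_convex_decreasing f \<longleftrightarrow> convex_decreasing f \<and>
    (\<exists>f'. (\<forall>x>0. (f has_real_derivative f' x) (at x)) \<and> convex_decreasing (\<lambda>x. - f' x))"

lemma smooth_convex_decreasing_mult:
  assumes "smooth_convex_decreasing f" "smooth_convex_decreasing g"
  shows "smooth_convex_decreasing (\<lambda>x. f x * g x)"
proof -
  from assms obtain f' g' where
    f: "convex_decreasing f" "\<And>x. x > 0 \<Longrightarrow> (f has_real_derivative f' x) (at x)" "convex_decreasing (\<lambda>x. - f' x)" and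
    g: "convex_decreasing g" "\<And>x. x > 0 \<Longrightarrow> (g has_real_derivative g' x) (at x)" "convex_decreasing (\<lambda>x. - g' x)"
    unfolding smooth_convex_decreasing_def by blast
  have "convex_decreasing (\<lambda>x. - f' x * g x + f x * - g' x)"
    by (intro convex_decreasing_add convex_decreasing_mult f g)
  then have "convex_decreasing (\<lambda>x. - (f' x * g x + g' x * f x))" by (simp add: algebra_simps)
  moreover have "\<forall>x>0. ((\<lambda>x. f x * g x) has_real_derivative (f' x * g x + g' x * f x)) (at x)"
    using DERIV_mult[OF f(2) g(2)] by blast
  ultimately show ?thesis
    unfolding smooth_convex_decreasing_def using convex_decreasing_mult[OF f(1) g(1)]
    by (intro conjI exI[of _ "\<lambda>x. f' x * g x + g' x * f x"])
qed

lemma smooth_convex_decreasing_powr: assumes "e \<le> 0" shows "smooth_convex_decreasing (\<lambda>x. x powr e)"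
  unfolding smooth_convex_decreasing_def
proof (intro conjI exI[of _ "\<lambda>x. e * x powr (e - 1)"] allI impI)
  show "((\<lambda>x. x powr e) has_real_derivative e * x powr (e - 1)) (at x)" if "x > 0" for x
    using that by (auto intro!: derivative_eq_intros)
  have "convex_decreasing (\<lambda>x. (- e) * x powr (e - 1))"
    using assms by (intro convex_decreasing_cmult convex_decreasing_powr) auto
  then show "convex_decreasing (\<lambda>x. - (e * x powr (e - 1)))" by simp
qed (rule convex_decreasing_powr[OF assms])

text \<open>By the chain rule minus the derivative is again a product of convex decreasing
  functions, the exponent \<open>\<alpha> - 1\<close> being at most 0.\<close>

lemma smooth_convex_decreasing_compose_powr:
  assumes f: "smooth_convex_decreasing f" and d: "0 < \<delta>" and a: "0 < \<alpha>" "\<alpha> \<le> 1"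
  shows "smooth_convex_decreasing (\<lambda>x. f (\<delta> * x powr \<alpha>))"
proof -
  from f obtain f' where
    f: "convex_decreasing f" "\<And>x. x > 0 \<Longrightarrow> (f has_real_derivative f' x) (at x)" "convex_decreasing (\<lambda>x. - f' x)"
    unfolding smooth_convex_decreasing_def by blast
  define D where "D = (\<lambda>x. f' (\<delta> * x powr \<alpha>) * (\<delta> * (\<alpha> * x powr (\<alpha> - 1))))"
  have "convex_decreasing (\<lambda>x. (\<delta> * \<alpha>) * (- f' (\<delta> * x powr \<alpha>) * x powr (\<alpha> - 1)))"
    using convex_decreasing_compose_powr[OF f(3) d a] d a
    by (intro convex_decreasing_cmult convex_decreasing_mult convex_decreasing_powr) auto
  then have "convex_decreasing (\<lambda>x. - D x)" by (simp add: D_def mult_ac)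
  moreover have "((\<lambda>x. f (\<delta> * x powr \<alpha>)) has_real_derivative D x) (at x)" if "x > 0" for x
  proof -
    have "((\<lambda>x. \<delta> * x powr \<alpha>) has_real_derivative \<delta> * (\<alpha> * x powr (\<alpha> - 1))) (at x)"
      using that by (auto intro!: derivative_eq_intros)
    from DERIV_chain2[OF f(2) this] that d show ?thesis by (simp add: D_def)
  qed
  ultimately show ?thesis
    unfolding smooth_convex_decreasing_def using convex_decreasing_compose_powr[OF f(1) d a] by blast
qed

text \<open>Squared because \<open>max 0 (1 - x / M)\<close> alone is convex but does not have nonnegative third differences.\<close>

definition cutoff :: "nat \<Rightarrow> real \<Rightarrow> real" where
  "cutoff M x = (max 0 (1 - x / real (Suc M)))\<^sup>2"

lemma cutoff_bounds: "0 \<le> x \<Longrightarrow> cutoff M x \<le> 1" "0 \<le> cutoff M x"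
  by (auto simp: cutoff_def max_def intro!: power_le_one)

lemma cutoff_eq_0: "k \<ge> Suc M \<Longrightarrow> cutoff M (real k) = 0"
  by (simp add: cutoff_def max_def field_simps)

lemma cutoff_tendsto: "(\<lambda>M. cutoff M x) \<longlonglongrightarrow> 1"
proof -
  have "(\<lambda>M. (max 0 (1 - x * inverse (real (Suc M))))\<^sup>2) \<longlonglongrightarrow> (max 0 (1 - x * 0))\<^sup>2"
    by (intro tendsto_intros LIMSEQ_inverse_real_of_nat)
  then show ?thesis by (simp add: cutoff_def divide_inverse)
qed

lemma convex_decreasing_ramp: "convex_decreasing (\<lambda>x. max 0 (1 - x / real (Suc M)))"
proof (rule convex_decreasingI)
  fix t x y :: real assume t: "0 < t" "t < 1" "0 < x" "x < y"
  have "1 - ((1 - t) * x + t * y) / real (Suc M) = (1 - t) * (1 - x / real (Suc M)) + t * (1 - y / real (Suc M))"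
    by (simp add: add_divide_distrib diff_divide_distrib algebra_simps del: of_nat_Suc)
  also have "\<dots> \<le> (1 - t) * max 0 (1 - x / real (Suc M)) + t * max 0 (1 - y / real (Suc M))"
    using t by (intro add_mono mult_left_mono) auto
  finally show "max 0 (1 - ((1 - t) * x + t * y) / real (Suc M)) \<le> (1 - t) * max 0 (1 - x / real (Suc M)) + t * max 0 (1 - y / real (Suc M))"
    using t by (simp del: of_nat_Suc)
next
  fix x y :: real assume "0 < x" "x \<le> y"
  then have "x / real (Suc M) \<le> y / real (Suc M)" by (intro divide_right_mono) auto
  then show "max 0 (1 - y / real (Suc M)) \<le> max 0 (1 - x / real (Suc M))" by simp
qed simp

lemma DERIV_max_0_square: "((\<lambda>y::real. (max 0 y)\<^sup>2) has_real_derivative 2 * max 0 y) (at y)"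
proof -
  consider "y > 0" | "y < 0" | "y = 0" by linarith
  then show ?thesis
  proof cases
    case 1
    have "((\<lambda>y. y\<^sup>2) has_real_derivative 2 * y) (at y)" by (auto intro!: derivative_eq_intros)
    then show ?thesis
      by (rule has_field_derivative_transform_within_open[of _ _ _ "{0<..}", THEN DERIV_cong]) (use 1 in auto)
  next
    case 2
    have "((\<lambda>y. 0) has_real_derivative 0) (at y)" by simp
    then show ?thesis
      by (rule has_field_derivative_transform_within_open[of _ _ _ "{..<0}", THEN DERIV_cong]) (use 2 in auto)
  next
    case 3
    have "((\<lambda>h. (max 0 h)\<^sup>2 / h) \<longlongrightarrow> 0) (at (0::real))"
    proof (rule Lim_null_comparison)
      show "\<forall>\<^sub>F h in at 0. norm ((max 0 h)\<^sup>2 / h) \<le> \<bar>h\<bar>"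
        by (rule always_eventually) (auto simp: max_def power2_eq_square)
      show "((\<lambda>h::real. \<bar>h\<bar>) \<longlongrightarrow> 0) (at 0)" by (rule tendsto_rabs_zero) simp
    qed
    then show ?thesis using 3 by (simp add: DERIV_def)
  qed
qed

lemma smooth_convex_decreasing_cutoff: "smooth_convex_decreasing (cutoff M)"
  unfolding smooth_convex_decreasing_def
proof (intro conjI exI[of _ "\<lambda>x. 2 * max 0 (1 - x / real (Suc M)) * (- 1 / real (Suc M))"] allI impI)
  show "convex_decreasing (cutoff M)"
    unfolding cutoff_def power2_eq_square by (intro convex_decreasing_mult convex_decreasing_ramp)
  have "convex_decreasing (\<lambda>x. (2 / real (Suc M)) * max 0 (1 - x / real (Suc M)))"
    by (intro convex_decreasing_cmult convex_decreasing_ramp) simp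
  then show "convex_decreasing (\<lambda>x. - (2 * max 0 (1 - x / real (Suc M)) * (- 1 / real (Suc M))))" by simp
  fix x :: real
  have "((\<lambda>x. 1 - x / real (Suc M)) has_real_derivative - 1 / real (Suc M)) (at x)"
    by (auto intro!: derivative_eq_intros)
  from DERIV_chain2[OF DERIV_max_0_square this]
  show "(cutoff M has_real_derivative 2 * max 0 (1 - x / real (Suc M)) * (- 1 / real (Suc M))) (at x)"
    unfolding cutoff_def[abs_def] .
qed

text \<open>The second difference \<open>G\<close>, taken as a function of a real variable, has as
  derivative the second difference of \<open>f'\<close>, which is at most 0 because
  \<open>- f'\<close> is convex; so \<open>G\<close> decreases.\<close>

lemma third_difference_nonneg_smooth:
  assumes f: "smooth_convex_decreasing f"
  shows "third_difference_nonneg (\<lambda>k. f (real k))"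
  unfolding third_difference_nonneg_def
proof
  fix k
  from f obtain f' where
    f': "\<And>x. x > 0 \<Longrightarrow> (f has_real_derivative f' x) (at x)" "convex_decreasing (\<lambda>x. - f' x)"
    unfolding smooth_convex_decreasing_def by blast
  define G where "G s = f s - 2 * f (s + 1) + f (s + 2)" for s
  have "G (real (Suc k) + 1) \<le> G (real (Suc k))"
  proof (rule DERIV_nonpos_imp_nonincreasing[where f = G])
    fix s assume "real (Suc k) \<le> s" "s \<le> real (Suc k) + 1"
    then have s: "0 < s" by simp
    have sh: "((\<lambda>s. f (s + c)) has_real_derivative f' (s + c)) (at s)" if "c \<ge> 0" for c
      using f'(1)[of "s + c"] s that DERIV_shift[of f "f' (s + c)" s c] by simp
    have "(G has_real_derivative f' s - 2 * f' (s + 1) + f' (s + 2)) (at s)"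
      unfolding G_def[abs_def] using sh[of 1] sh[of 2] f'(1)[OF s]
      by (intro DERIV_add DERIV_diff DERIV_cmult) auto
    moreover have "f' s - 2 * f' (s + 1) + f' (s + 2) \<le> 0"
      using convex_decreasing_midpoint[OF f'(2) s] by simp
    ultimately show "\<exists>y. (G has_real_derivative y) (at s) \<and> y \<le> 0" by blast
  qed simp
  then show "f (real (Suc (Suc k))) - 2 * f (real (Suc (Suc (Suc k)))) + f (real (Suc (Suc (Suc (Suc k))))) \<le>
      f (real (Suc k)) - 2 * f (real (Suc (Suc k))) + f (real (Suc (Suc (Suc k))))"
    by (simp add: G_def add.commute add.left_commute)
qed

section \<open>From the classes \<open>M_1\<close>, \<open>M_2\<close> and the bounds on
  \<open>\<gamma>\<close> to convexity of \<open>lambda_fun\<close>\<close>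

lemma M_class_1D: "f \<in> M_class 1 \<Longrightarrow> convex_decreasing f"
  by (auto simp: M_class_def convex_decreasing_def monotone_on_def)

lemma M_class_2D:
  assumes "f \<in> M_class 2"
  shows "x > 0 \<Longrightarrow> (f has_real_derivative deriv f x) (at x)"
    and "convex_decreasing (\<lambda>x. - deriv f x)"
    and "\<exists>L\<ge>0. (f \<longlongrightarrow> L) at_top"
proof -
  have e: "(2::nat) - 1 = 1" by simp
  show "(f has_real_derivative deriv f x) (at x)" if "x > 0"
    using assms that unfolding M_class_def e by (auto simp: DERIV_deriv_iff_real_differentiable)
  show "convex_decreasing (\<lambda>x. - deriv f x)"
    using assms unfolding M_class_def e by (auto simp: convex_decreasing_def monotone_on_def)
  show "\<exists>L\<ge>0. (f \<longlongrightarrow> L) at_top" using assms by (auto simp: M_class_def)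
qed

text \<open>The sign of the derivative makes \<open>f\<close> decrease, so it stays above its limit
  at infinity, which the class requires to be nonnegative; convexity comes from the monotone
  derivative.\<close>

lemma M_class_2_smooth: assumes "f \<in> M_class 2" shows "smooth_convex_decreasing f"
proof -
  note D = M_class_2D[OF assms]
  note D2 = convex_decreasingD[OF D(2)]
  obtain L where L: "L \<ge> 0" "(f \<longlongrightarrow> L) at_top" using D(3) by blast
  have dec: "f y \<le> f x" if "0 < x" "x \<le> y" for x y
  proof (rule DERIV_nonpos_imp_nonincreasing[OF that(2)])
    fix z assume "x \<le> z" "z \<le> y"
    then have "z > 0" using that by simp
    then show "\<exists>d. (f has_real_derivative d) (at z) \<and> d \<le> 0" using D(1)[of z] D2(1)[of z] by auto
  qed
  have "0 \<le> f x" if "0 < x" for x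
  proof -
    have "L \<le> f x"
      by (rule tendsto_upperbound[OF L(2)]) (use dec that in \<open>auto simp: eventually_at_top_linorder\<close>)
    then show ?thesis using L by simp
  qed
  moreover have "convex_on {0<..} f"
    by (rule convex_on_realI[of _ _ "deriv f"]) (use D(1) D2(2) in auto)
  ultimately have "convex_decreasing f" using dec by (simp add: convex_decreasing_def)
  then show ?thesis unfolding smooth_convex_decreasing_def using D by blast
qed

text \<open>Exhibits the affine dependence on \<open>\<gamma>\<close>; minus the slope is
  \<open>x powr (1 - \<rho>) * h x\<close>, a product of convex decreasing functions when
  \<open>\<rho> \<ge> 1\<close>.\<close>

lemma lambda_fun_split:
  "x > 0 \<Longrightarrow> lambda_fun \<rho> \<gamma> h x = (1 - h x) * x powr - \<rho> - \<gamma> * (x powr (1 - \<rho>) * h x)"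
  by (simp add: lambda_fun_def powr_minus powr_diff field_simps)

lemma smooth_lambda_part:
  "h \<in> M_class 2 \<Longrightarrow> \<rho> \<ge> 1 \<Longrightarrow> smooth_convex_decreasing (\<lambda>x. x powr (1 - \<rho>) * h x)"
  by (intro smooth_convex_decreasing_mult smooth_convex_decreasing_powr M_class_2_smooth) auto

lemma convex_decreasing_lambda:
  assumes h: "h \<in> M_class 2" and \<rho>: "\<rho> \<ge> 1" and \<gamma>: "ereal \<gamma> \<le> gamma_sup 1 \<rho> h"
  shows "convex_decreasing (lambda_fun \<rho> \<gamma> h)"
proof -
  define U V where "U = (\<lambda>x. (1 - h x) * x powr - \<rho>)" and "V = (\<lambda>x. x powr (1 - \<rho>) * h x)"
  have eq: "lambda_fun \<rho> \<gamma> h x = U x - \<gamma> * V x" if "x > 0" for x \<gamma>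
    using lambda_fun_split[OF that] by (simp add: U_def V_def)
  have "convex_decreasing (\<lambda>x. U x - \<gamma> * V x)"
  proof (rule convex_decreasing_le_Sup)
    show "convex_decreasing V"
      using smooth_lambda_part[OF h \<rho>] by (simp add: V_def smooth_convex_decreasing_def)
    show "ereal \<gamma> \<le> Sup (ereal ` {\<gamma>. lambda_fun \<rho> \<gamma> h \<in> M_class 1})" using \<gamma> by (simp add: gamma_sup_def)
    fix \<gamma> assume "\<gamma> \<in> {\<gamma>. lambda_fun \<rho> \<gamma> h \<in> M_class 1}"
    then have "convex_decreasing (lambda_fun \<rho> \<gamma> h)" by (intro M_class_1D) simp
    then show "convex_decreasing (\<lambda>x. U x - \<gamma> * V x)" by (rule convex_decreasing_cong) (simp add: eq)
  qed
  then show ?thesis by (rule convex_decreasing_cong) (simp add: eq)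
qed

text \<open>The derivative is affine in \<open>\<gamma>\<close> too, so the closure argument for the
  supremum runs once for the function and once, with \<open>gamma_sup 2\<close>, for minus its
  derivative.\<close>

lemma smooth_convex_decreasing_lambda:
  assumes h: "h \<in> M_class 2" and \<rho>: "\<rho> \<ge> 1" and \<gamma>: "ereal \<gamma> \<le> gamma_sup 1 \<rho> h" "ereal \<gamma> \<le> gamma_sup 2 \<rho> h"
  shows "smooth_convex_decreasing (lambda_fun \<rho> \<gamma> h)"
proof -
  define U V where "U = (\<lambda>x. (1 - h x) * x powr - \<rho>)" and "V = (\<lambda>x. x powr (1 - \<rho>) * h x)"
  have eq: "lambda_fun \<rho> \<gamma> h x = U x - \<gamma> * V x" if "x > 0" for x \<gamma>
    using lambda_fun_split[OF that] by (simp add: U_def V_def)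
  obtain V' where V': "\<And>x. x > 0 \<Longrightarrow> (V has_real_derivative V' x) (at x)" "convex_decreasing (\<lambda>x. - V' x)"
    using smooth_lambda_part[OF h \<rho>] by (auto simp: V_def smooth_convex_decreasing_def)
  define U' where "U' = (\<lambda>x. (1 - h x) * (- \<rho> * x powr (- \<rho> - 1)) + - deriv h x * x powr - \<rho>)"
  have U': "(U has_real_derivative U' x) (at x)" if "x > 0" for x
    unfolding U_def U'_def using that M_class_2D(1)[OF h that] by (auto intro!: derivative_eq_intros)
  have der: "(lambda_fun \<rho> \<gamma> h has_real_derivative U' x - \<gamma> * V' x) (at x)" if "x > 0" for x \<gamma>
  proof (rule has_field_derivative_transform_within_open[where S = "{0<..}"])
    show "((\<lambda>x. U x - \<gamma> * V x) has_real_derivative U' x - \<gamma> * V' x) (at x)"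
      by (intro DERIV_diff DERIV_cmult U' V' that)
  qed (use that eq in auto)
  have "convex_decreasing (\<lambda>x. - U' x - \<gamma> * - V' x)"
  proof (rule convex_decreasing_le_Sup[OF V'(2)])
    show "ereal \<gamma> \<le> Sup (ereal ` {\<gamma>. lambda_fun \<rho> \<gamma> h \<in> M_class 2})" using \<gamma> by (simp add: gamma_sup_def)
    fix \<gamma> assume "\<gamma> \<in> {\<gamma>. lambda_fun \<rho> \<gamma> h \<in> M_class 2}"
    then have "convex_decreasing (\<lambda>x. - deriv (lambda_fun \<rho> \<gamma> h) x)" by (intro M_class_2D) simp
    then show "convex_decreasing (\<lambda>x. - U' x - \<gamma> * - V' x)"
      by (rule convex_decreasing_cong) (simp add: der[THEN DERIV_imp_deriv])
  qed
  then have "convex_decreasing (\<lambda>x. - (U' x - \<gamma> * V' x))" by (simp add: algebra_simps)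
  then show ?thesis
    unfolding smooth_convex_decreasing_def
    by (intro conjI exI[of _ "\<lambda>x. U' x - \<gamma> * V' x"] allI impI der convex_decreasing_lambda[OF h \<rho> \<gamma>(1)])
qed

section \<open>The approximation error\<close>

lemma convex_decreasing_discrete:
  assumes "convex_decreasing f"
  shows "2 * f (real (Suc (Suc k))) \<le> f (real (Suc k)) + f (real (Suc (Suc (Suc k))))"
  using convex_decreasing_midpoint[OF assms, of "real (Suc k)"] by (simp add: add.commute)

lemma sine_sum_positive_convex:
  assumes f: "convex_decreasing f" and b: "\<And>k. b (Suc k) = f (real (Suc k))" and fin: "\<And>k. k > N \<Longrightarrow> b k = 0"
    and t: "0 \<le> t" "t \<le> pi"
  shows "0 \<le> kernel_sum False b N t"
proof -
  have "0 \<le> (\<Sum>k<N. b (Suc k) * sin (real (Suc k) * t))"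
  proof (rule conjugate_fejer_nonneg[where a = "\<lambda>k. b (Suc k)", OF _ _ t])
    show "2 * b (Suc (Suc k)) \<le> b (Suc k) + b (Suc (Suc (Suc k)))" for k
      unfolding b by (rule convex_decreasing_discrete[OF f])
  qed (auto intro: fin)
  also have "2 * \<dots> = kernel_sum False b N t"
    by (simp add: kernel_sum_def harmonic_def sum_distrib_left mult.assoc)
  finally show ?thesis by simp
qed

text \<open>Each term is split as \<open>k * b k\<close> times \<open>sin (k * t) / k\<close>:
  decreasing weights against Fejer-Jackson sums.\<close>

lemma sine_sum_positive_decreasing:
  assumes b0: "\<And>k. 0 \<le> b (Suc k)" and dec: "\<And>k. real (Suc (Suc k)) * b (Suc (Suc k)) \<le> real (Suc k) * b (Suc k)"
    and t: "0 \<le> t" "t \<le> pi"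
  shows "0 \<le> kernel_sum False b N t"
proof -
  have "0 \<le> (\<Sum>k<N. (real (Suc k) * b (Suc k)) * (sin (real (Suc k) * t) / real (Suc k)))"
    by (intro decreasing_sum_nonneg fejer_jackson t dec mult_nonneg_nonneg b0) simp
  also have "\<dots> = (\<Sum>k<N. b (Suc k) * sin (real (Suc k) * t))" by (intro sum.cong) auto
  also have "2 * \<dots> = kernel_sum False b N t"
    by (simp add: kernel_sum_def harmonic_def sum_distrib_left mult.assoc)
  finally show ?thesis by simp
qed

lemma fourier_coeff_bound:
  "integrable circle g \<Longrightarrow> norm (fourier_coeff g k) \<le> (LINT t|circle. \<bar>g t\<bar>) / (2 * pi)"
  using fourier_coeff_diff_le[of g "\<lambda>_. 0" k] by (simp add: fourier_coeff_eq_period)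

text \<open>The error operator is diagonal in Fourier coefficients, with those of
  \<open>kernel c a\<close> as multipliers up to the sign \<open>\<sigma>\<close>. The
  \<open>b M\<close> are finitely supported coefficients below \<open>a\<close> for which
  interpolation is available; upper and lower bound meet in the square wave integral.\<close>

lemma approx_error_eq_square_wave_integral:
  assumes p: "p = 1 \<or> p = \<infinity>" and n: "n \<ge> 1" and r: "r > 0" and g: "periodic_integrable g"
    and phase: "\<And>x. cos (x - \<beta> * pi / 2) = \<sigma> * (if c then cos x else sin x)" and \<sigma>: "\<sigma> = 1 \<or> \<sigma> = - 1"
    and fg: "\<And>k. fourier_coeff g k = complex_of_real (l (nat \<bar>k\<bar>))"
    and a: "\<And>k. a (Suc k) = (1 - l (Suc k)) * real (Suc k) powr - r"
    and dc: "decreasing_coeffs r C a" and C: "0 \<le> C"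
    and db: "\<And>M. decreasing_coeffs r C (b M)" and ba: "\<And>M k. b M (Suc k) \<le> a (Suc k)"
    and lim: "\<And>k. (\<lambda>M. b M (Suc k)) \<longlonglongrightarrow> a (Suc k)"
    and fin: "\<And>M k. k > M \<Longrightarrow> b M k = 0" and sm: "\<And>M. sign_matched c n (kernel_sum c (b M) M)"
  shows "approx_error p (W_class p n r \<beta>) (\<lambda>f. convol f g) =
    ereal ((LINT t|circle. kernel c a t * square_wave c n t) / (2 * pi))"
proof -
  interpret g: periodic_integrable g by fact
  interpret K: periodic_integrable "kernel c a" by (rule integrable_kernel[OF dc r C])
  define w where "w k = real k powr - r" for k :: nat
  have dw: "decreasing_coeffs r 1 w"
    using r by (auto simp: decreasing_coeffs_def w_def intro!: powr_mono2')
  interpret w: periodic_integrable "kernel c w" by (rule integrable_kernel[OF dw r]) simp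
  define \<psi> where "\<psi> = (\<lambda>t. \<sigma> * kernel c w t)"
  have ipsi: "integrable circle \<psi>" unfolding \<psi>_def using w.integrable_period by simp
  \<comment> \<open>The series may diverge at multiples of \<open>2 * pi\<close>, where \<^const>\<open>suminf\<close> returns junk.\<close>
  have psi: "psi r \<beta> t = \<psi> t" if t: "0 < \<bar>t\<bar>" "\<bar>t\<bar> \<le> pi" for t
  proof -
    have e: "2 * cos (real (Suc j) * t - \<beta> * pi / 2) / real (Suc j) powr r = \<sigma> * (2 * w (Suc j) * harmonic c (Suc j) t)" for j
      unfolding phase by (simp add: w_def harmonic_def powr_minus divide_inverse)
    have "(\<lambda>j. 2 * w (Suc j) * harmonic c (Suc j) t) sums kernel c w t"
      unfolding sums_def using kernel_sum_tendsto(1)[OF dw r t, of c] by (simp add: kernel_sum_def)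
    then have "(\<lambda>j. \<sigma> * (2 * w (Suc j) * harmonic c (Suc j) t)) sums (\<sigma> * kernel c w t)" by (rule sums_mult)
    then show ?thesis unfolding psi_def e \<psi>_def by (rule sums_unique[symmetric])
  qed
  have mpsi: "psi r \<beta> \<in> borel_measurable circle"
  proof -
    have "psi r \<beta> \<in> borel_measurable borel" unfolding psi_def[abs_def] by measurable
    then have "psi r \<beta> \<in> borel_measurable lebesgue" by (intro measurable_completion) simp
    then show ?thesis by (rule measurable_period)
  qed
  have cpsi: "convol \<phi> (psi r \<beta>) = convol \<phi> \<psi>" if "\<phi> \<in> H_class p n" for \<phi>
  proof
    fix x
    have m: "(\<lambda>t. \<phi> (x - t)) \<in> borel_measurable circle"
      using that by (intro measurable_period lebesgue_measurable_reflect_shift) (simp add: H_class_def Lp_space_def)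
    have "(LINT t|circle. \<phi> (x - t) * psi r \<beta> t) = (LINT t|circle. \<phi> (x - t) * \<psi> t)"
    proof (rule integral_cong_AE)
      show "AE t in circle. \<phi> (x - t) * psi r \<beta> t = \<phi> (x - t) * \<psi> t"
        using AE_period_nonzero by eventually_elim (simp add: psi)
    qed (use m mpsi ipsi in \<open>auto intro!: borel_measurable_times\<close>)
    then show "convol \<phi> (psi r \<beta>) x = convol \<phi> \<psi> x" by (simp add: convol_eq_period)
  qed
  \<comment> \<open>The extra factor \<open>\<sigma>\<close> makes the coefficients of
    \<open>E\<close> carry the square of \<open>\<sigma>\<close>, which is 1; norms do not see
    it.\<close>
  define E where "E \<phi> = (\<lambda>x. \<sigma> * (convol \<phi> \<psi> x - convol (convol \<phi> \<psi>) g x))" for \<phi>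
  have main: "periodic_integrable (E \<phi>) \<and> fourier_coeff (E \<phi>) m = fourier_coeff \<phi> m * fourier_coeff (kernel c a) m"
    if \<phi>: "\<phi> \<in> H_class p n" for \<phi> m
  proof -
    have P: "periodic_integrable \<phi>" using Lp_space_periodic_integrable[OF p] \<phi> by (simp add: H_class_def)
    have F: "periodic_integrable (convol \<phi> \<psi>)" by (rule convol_periodic_integrable[OF P ipsi])
    interpret F: periodic_integrable "convol \<phi> \<psi>" by (rule F)
    interpret G: periodic_integrable "convol (convol \<phi> \<psi>) g" by (rule convol_periodic_integrable[OF F g.integrable_period])
    have "periodic_integrable (E \<phi>)"
      unfolding E_def
      by standard (auto intro!: borel_measurable_times borel_measurable_diff F.lebesgue_measurable G.lebesgue_measurable
          simp: F.periodic G.periodic F.integrable_period G.integrable_period)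
    moreover have "fourier_coeff (E \<phi>) m = \<sigma> * (fourier_coeff \<phi> m * (\<sigma> * fourier_coeff (kernel c w) m) * (1 - fourier_coeff g m))"
      unfolding E_def fourier_coeff_cmult fourier_coeff_diff[OF F.integrable_period G.integrable_period]
        fourier_coeff_convol[OF F g.integrable_period] fourier_coeff_convol[OF P ipsi]
      unfolding \<psi>_def fourier_coeff_cmult by (simp add: algebra_simps)
    moreover have "fourier_coeff (kernel c w) m * (1 - fourier_coeff g m) = fourier_coeff (kernel c a) m"
    proof (cases "m = 0")
      case False
      then obtain k where k: "nat \<bar>m\<bar> = Suc k" by (cases "nat \<bar>m\<bar>") auto
      show ?thesis
        unfolding fourier_coeff_kernel[OF dw r zero_le_one] fourier_coeff_kernel[OF dc r C] fg k a
        by (simp add: w_def)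
    qed (simp add: fourier_coeff_kernel[OF dw r zero_le_one] fourier_coeff_kernel[OF dc r C] parity_coeff_def)
    ultimately show ?thesis using \<sigma> by (auto simp: mult.assoc)
  qed
  have Lp: "Lp_norm p (\<lambda>x. convol \<phi> \<psi> x - convol (convol \<phi> \<psi>) g x) = Lp_norm p (E \<phi>)" for \<phi>
  proof -
    have "\<bar>E \<phi> x\<bar> = \<bar>convol \<phi> \<psi> x - convol (convol \<phi> \<psi>) g x\<bar>" for x
      using \<sigma> by (auto simp: E_def)
    then show ?thesis by (simp add: Lp_norm_def)
  qed
  have "W_class p n r \<beta> = (\<lambda>\<phi>. convol \<phi> (psi r \<beta>)) ` H_class p n" by (auto simp: W_class_def)
  also have "\<dots> = (\<lambda>\<phi>. convol \<phi> \<psi>) ` H_class p n" by (rule image_cong[OF refl cpsi])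
  finally have "approx_error p (W_class p n r \<beta>) (\<lambda>f. convol f g) = (SUP \<phi>\<in>H_class p n. Lp_norm p (E \<phi>))"
    unfolding approx_error_def by (simp add: image_image Lp)
  also have "\<dots> = ereal ((LINT t|circle. kernel c a t * square_wave c n t) / (2 * pi))"
  proof (rule antisym)
    show "(SUP \<phi>\<in>H_class p n. Lp_norm p (E \<phi>)) \<le> ereal ((LINT t|circle. kernel c a t * square_wave c n t) / (2 * pi))"
    proof (rule SUP_least)
      fix \<phi> assume \<phi>: "\<phi> \<in> H_class p n"
      show "Lp_norm p (E \<phi>) \<le> ereal ((LINT t|circle. kernel c a t * square_wave c n t) / (2 * pi))"
      proof (rule extremal_norm_le[OF p n K.integrable_period _ _ _ \<phi>])
        show "integrable circle (kernel c (b M))" for M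
          by (rule periodic_integrable.integrable_period[OF integrable_kernel[OF db r C]])
        show "sign_matched c n (kernel c (b M))" for M
          using sm[of M] kernel_finite[of M "b M" c, OF fin] by simp
        show "(\<lambda>M. LINT t|circle. \<bar>kernel c (b M) t - kernel c a t\<bar>) \<longlonglongrightarrow> 0"
          by (rule kernel_L1_tendsto[OF dc r C db ba lim])
      qed (use main[OF \<phi>] in auto)
    qed
    show "ereal ((LINT t|circle. kernel c a t * square_wave c n t) / (2 * pi)) \<le> (SUP \<phi>\<in>H_class p n. Lp_norm p (E \<phi>))"
      by (rule extremal_norm_ge[OF p n K.integrable_period]) (use main in auto)
  qed
  finally show ?thesis .
qed

text \<open>\<open>a k\<close> is \<open>lambda_fun\<close> at
  \<open>\<delta> * k powr \<alpha>\<close> times a constant and a power of \<open>k\<close>, so the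
  shape of \<open>lambda_fun\<close> decides. The alternatives in \<open>cases\<close> are the
  regimes in which an interpolating polynomial is at hand: convex coefficients, or for
  \<open>n = 1\<close> a positive sine sum or a monotone cosine sum.\<close>

lemma approx_error_eq_series:
  fixes h g :: "real \<Rightarrow> real" and \<rho> \<gamma> \<alpha> \<delta> r \<beta> :: real
  assumes p: "p = 1 \<or> p = \<infinity>" and n: "n \<ge> 1"
    and \<lambda>: "convex_decreasing (lambda_fun \<rho> \<gamma> h)" and \<rho>: "\<rho> \<ge> 1" and \<alpha>: "\<alpha> > 0" and \<delta>: "\<delta> > 0"
    and g: "g \<in> Lp_space 1"
    and fg: "is_fourier_series_of
           (\<lambda>k. complex_of_real ((1 + real_of_int \<bar>k\<bar> powr \<alpha> * \<delta> * \<gamma>)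
                                  * h (real_of_int \<bar>k\<bar> powr \<alpha> * \<delta>))) g"
    and phase: "\<And>x. cos (x - \<beta> * pi / 2) = \<sigma> * (if c then cos x else sin x)" and \<sigma>: "\<sigma> = 1 \<or> \<sigma> = - 1"
    and cases: "(\<not> c \<and> \<alpha> \<le> 1 \<and> r \<ge> \<alpha> * \<rho>) \<or> (\<not> c \<and> n = 1 \<and> r \<ge> \<alpha> * \<rho> + 1) \<or>
      (c \<and> n = 1 \<and> \<alpha> \<le> 1 \<and> r \<ge> \<alpha> * \<rho> + 1) \<or> (c \<and> n = 1 \<and> r \<ge> \<alpha> * \<rho> + 2) \<or>
      (c \<and> \<alpha> \<le> 1 \<and> r \<ge> \<alpha> * \<rho> \<and> smooth_convex_decreasing (lambda_fun \<rho> \<gamma> h))"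
  shows "approx_error p (W_class p n r \<beta>) (\<lambda>f. convol f g) =
        ereal (4 / (pi * real n powr r) *
          (\<Sum>k. (1 - (1 + real (2 * k + 1) powr \<alpha> * real n powr \<alpha> * \<delta> * \<gamma>)
                      * h (real (2 * k + 1) powr \<alpha> * real n powr \<alpha> * \<delta>))
                / real (2 * k + 1) powr (r + 1) * (if c then (-1) ^ k else 1)))"
proof -
  interpret g: periodic_integrable g by (rule Lp_space_periodic_integrable[OF _ g]) simp
  have \<alpha>\<rho>: "0 < \<alpha> * \<rho>" using \<alpha> \<rho> by simp
  have r: "r \<ge> \<alpha> * \<rho>" using cases by auto
  then have r0: "r > 0" using \<alpha>\<rho> by linarith
  define l where "l k = (1 + real k powr \<alpha> * \<delta> * \<gamma>) * h (real k powr \<alpha> * \<delta>)" for k :: nat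
  have fgl: "fourier_coeff g k = complex_of_real (l (nat \<bar>k\<bar>))" for k
    using fg by (simp add: is_fourier_series_of_def l_def)
  \<comment> \<open>The coefficients of the integrable \<open>g\<close> are bounded by its mean
    modulus; this is the constant in the decay \<open>C * k powr - r\<close> of
    \<open>a\<close>.\<close>
  define C where "C = 1 + (LINT t|circle. \<bar>g t\<bar>) / (2 * pi)"
  have "0 \<le> (LINT t|circle. \<bar>g t\<bar>) / (2 * pi)" by simp
  then have C: "0 \<le> C" by (simp add: C_def)
  have lC: "1 - l k \<le> C" for k
    using fourier_coeff_bound[OF g.integrable_period, of "int k"] unfolding fgl by (simp add: C_def)
  define F where "F e x = \<delta> powr \<rho> * (lambda_fun \<rho> \<gamma> h (\<delta> * x powr \<alpha>) * x powr e)" for e x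
  define a where "a k = (1 - l k) * real k powr - r" for k
  define b where "b M k = a k * cutoff M (real k)" for M k
  note L = convex_decreasingD[OF \<lambda>]
  \<comment> \<open>Used with \<open>i\<close> equal to 0, 1 and 2, for \<open>a k\<close> and its
    products with \<open>k\<close> and \<open>k^2\<close>. The exponent of \<open>F\<close> must
    stay at most 0, so each power of \<open>k\<close> costs one unit of \<open>r\<close>.\<close>
  have aF: "x powr i * a k = F (\<alpha> * \<rho> - r + i) x" if "x = real k" "k > 0" for i k x
  proof -
    have "(\<delta> * x powr \<alpha>) powr \<rho> = \<delta> powr \<rho> * x powr (\<alpha> * \<rho>)"
      using \<delta> that by (simp add: powr_mult powr_powr)
    then have "F (\<alpha> * \<rho> - r + i) x = (1 - l k) * (\<delta> powr \<rho> / (\<delta> powr \<rho> * x powr (\<alpha> * \<rho>)) * x powr (\<alpha> * \<rho> - r + i))"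
      by (simp add: F_def lambda_fun_def l_def that(1) mult_ac)
    also have "\<delta> powr \<rho> / (\<delta> powr \<rho> * x powr (\<alpha> * \<rho>)) * x powr (\<alpha> * \<rho> - r + i) = x powr (- (\<alpha> * \<rho>)) * x powr (\<alpha> * \<rho> - r + i)"
      using \<delta> by (simp add: powr_minus_divide)
    also have "\<dots> = x powr i * x powr - r" by (simp add: powr_add[symmetric])
    finally show ?thesis using that by (simp add: a_def mult_ac)
  qed
  have F0: "0 \<le> F e x" if "0 < x" for e x using L(1) that \<delta> by (simp add: F_def)
  have Fdec: "F e y \<le> F e x" if "0 < x" "x \<le> y" "e \<le> 0" for e x y
  proof -
    have "\<delta> * x powr \<alpha> \<le> \<delta> * y powr \<alpha>" using that \<delta> \<alpha> by (intro mult_left_mono powr_mono2) auto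
    then have "lambda_fun \<rho> \<gamma> h (\<delta> * y powr \<alpha>) \<le> lambda_fun \<rho> \<gamma> h (\<delta> * x powr \<alpha>)"
      using that \<delta> by (intro L(2)) auto
    then show ?thesis
      unfolding F_def using that \<delta> by (intro mult_left_mono mult_mono powr_antimono) (auto intro!: L(1))
  qed
  have Fconv: "convex_decreasing (F e)" if "\<alpha> \<le> 1" "e \<le> 0" for e
    unfolding F_def using that
    by (intro convex_decreasing_cmult convex_decreasing_mult convex_decreasing_compose_powr[OF \<lambda> \<delta> \<alpha>] convex_decreasing_powr) auto
  have cutdec: "cutoff M y \<le> cutoff M x" if "0 < x" "x \<le> y" for M x y
    using smooth_convex_decreasing_cutoff[of M] convex_decreasingD(2)[OF _ that] by (auto simp: smooth_convex_decreasing_def)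
  have a0: "0 \<le> a (Suc k)" for k using aF[of "real (Suc k)" "Suc k" 0] F0[of "real (Suc k)"] by simp
  have dec: "real (Suc (Suc k)) powr i * b M (Suc (Suc k)) \<le> real (Suc k) powr i * b M (Suc k)"
    if "\<alpha> * \<rho> - r + i \<le> 0" for i k M
  proof -
    have "F (\<alpha> * \<rho> - r + i) (real (Suc (Suc k))) * cutoff M (real (Suc (Suc k))) \<le> F (\<alpha> * \<rho> - r + i) (real (Suc k)) * cutoff M (real (Suc k))"
      using that by (intro mult_mono Fdec cutdec F0 cutoff_bounds) auto
    then show ?thesis
      using aF[of "real (Suc (Suc k))" "Suc (Suc k)" i] aF[of "real (Suc k)" "Suc k" i] by (simp add: b_def mult.assoc[symmetric] del: of_nat_Suc)
  qed
  have adec: "a (Suc (Suc k)) \<le> a (Suc k)" for k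
    using Fdec[of "real (Suc k)" "real (Suc (Suc k))" "\<alpha> * \<rho> - r + 0"] r
      aF[of "real (Suc (Suc k))" "Suc (Suc k)" 0] aF[of "real (Suc k)" "Suc k" 0] by simp
  have aC: "a (Suc k) \<le> C * real (Suc k) powr - r" for k
    unfolding a_def by (intro mult_right_mono lC) simp
  have dc: "decreasing_coeffs r C a" using a0 adec aC by (simp add: decreasing_coeffs_def)
  have b0: "0 \<le> b M (Suc k)" for M k unfolding b_def by (intro mult_nonneg_nonneg a0 cutoff_bounds of_nat_0_le_iff)
  have ba: "b M (Suc k) \<le> a (Suc k)" for M k
    unfolding b_def using a0[of k] cutoff_bounds(1)[of "real (Suc k)" M] by (simp add: mult_left_le del: of_nat_Suc)
  have db: "decreasing_coeffs r C (b M)" for M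
    unfolding decreasing_coeffs_def using b0 dec[of 0] r order_trans[OF ba aC] by simp
  have fin: "b M k = 0" if "k > M" for M k using cutoff_eq_0[of M k] that by (simp add: b_def)
  have lim: "(\<lambda>M. b M (Suc k)) \<longlonglongrightarrow> a (Suc k)" for k
    using tendsto_mult[OF tendsto_const[of "a (Suc k)"] cutoff_tendsto[of "real (Suc k)"]] by (simp add: b_def)
  have bF: "real (Suc k) powr i * b M (Suc k) = F (\<alpha> * \<rho> - r + i) (real (Suc k)) * cutoff M (real (Suc k))" for i M k
    using aF[of "real (Suc k)" "Suc k" i] by (simp add: b_def mult.assoc[symmetric] del: of_nat_Suc)
  have convex_cut: "convex_decreasing (\<lambda>x. F e x * cutoff M x)" if "\<alpha> \<le> 1" "e \<le> 0" for e M
    using smooth_convex_decreasing_cutoff[of M] that by (intro convex_decreasing_mult Fconv) (auto simp: smooth_convex_decreasing_def)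
  \<comment> \<open>\<open>sign_matched_convex\<close> wants coefficients that vanish from the
    summation bound on, while those of \<open>b M\<close> vanish beyond \<open>M\<close>; summing to
    \<open>Suc M\<close> only adds a zero term.\<close>
  have fin': "b M k = 0" if "k \<ge> Suc M" for M k using fin that by simp
  have KS: "kernel_sum c (b M) (Suc M) = kernel_sum c (b M) M" for M
    by (simp add: kernel_sum_def fun_eq_iff fin)
  have sm: "sign_matched c n (kernel_sum c (b M) M)" for M
  proof -
    have conv: "2 * b M (Suc (Suc k)) \<le> b M (Suc k) + b M (Suc (Suc (Suc k)))" if "\<alpha> \<le> 1" for k
      using convex_decreasing_discrete[OF convex_cut[OF that, of "\<alpha> * \<rho> - r + 0" M], of k] r
        bF[of "k" 0 M] bF[of "Suc k" 0 M] bF[of "Suc (Suc k)" 0 M] by simp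
    have pow1: "real (Suc k) powr 1 * x = real (Suc k) * x" for k x by simp
    have pow2: "real (Suc k) powr 2 * x = real (Suc k) * (real (Suc k) * x)" for k x
      by (simp add: power2_eq_square mult.assoc)
    \<comment> \<open>Cases 1 and 5 rest on convexity and serve every \<open>n\<close>. Case 2
      applies Fejer-Jackson with weights \<open>k * b k\<close>. Cases 3 and 4 treat the
      differentiated cosine sum, with coefficients \<open>k * b k\<close>: by their convexity,
      respectively by monotonicity of \<open>k^2 * b k\<close>.\<close>
    from cases consider "\<not> c" "\<alpha> \<le> 1" | "\<not> c" "n = 1" "r \<ge> \<alpha> * \<rho> + 1" | "c" "n = 1" "\<alpha> \<le> 1" "r \<ge> \<alpha> * \<rho> + 1"
      | "c" "n = 1" "r \<ge> \<alpha> * \<rho> + 2" | "c" "\<alpha> \<le> 1" "smooth_convex_decreasing (lambda_fun \<rho> \<gamma> h)" by blast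
    then show ?thesis
    proof cases
      case 1
      have "sign_matched c n (kernel_sum c (b M) (Suc M))"
        by (rule sign_matched_convex[of n "b M" "Suc M", OF n conv fin']) (use 1 in auto)
      then show ?thesis by (simp add: KS)
    next
      case 2
      have "0 \<le> kernel_sum False (b M) M t" if "0 \<le> t" "t \<le> pi" for t
      proof (rule sine_sum_positive_decreasing[of "b M", OF b0 _ that])
        show "real (Suc (Suc k)) * b M (Suc (Suc k)) \<le> real (Suc k) * b M (Suc k)" for k
          using dec[of 1 k M] 2 unfolding pow1 by simp
      qed
      then show ?thesis using sign_matched_sine_positive 2 by simp
    next
      case 3
      have "0 \<le> kernel_sum False (\<lambda>k. real k * b M k) M t" if "0 \<le> t" "t \<le> pi" for t
      proof (rule sine_sum_positive_convex[OF convex_cut _ _ that])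
        show "real (Suc k) * b M (Suc k) = F (\<alpha> * \<rho> - r + 1) (real (Suc k)) * cutoff M (real (Suc k))" for k
          using bF[of k 1 M] unfolding pow1 .
      qed (use 3 fin in auto)
      then show ?thesis using sign_matched_cosine_decreasing 3 by simp
    next
      case 4
      have "0 \<le> kernel_sum False (\<lambda>k. real k * b M k) M t" if "0 \<le> t" "t \<le> pi" for t
      proof (rule sine_sum_positive_decreasing[of "\<lambda>k. real k * b M k", OF _ _ that])
        show "real (Suc (Suc k)) * (real (Suc (Suc k)) * b M (Suc (Suc k))) \<le> real (Suc k) * (real (Suc k) * b M (Suc k))" for k
          using dec[of 2 k M] 4 unfolding pow2 by simp
      qed (use b0 in simp)
      then show ?thesis using sign_matched_cosine_decreasing 4 by simp
    next
      case 5
      have "smooth_convex_decreasing (\<lambda>x. (lambda_fun \<rho> \<gamma> h (\<delta> * x powr \<alpha>) * x powr (\<alpha> * \<rho> - r)) * cutoff M x)"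
        using 5 r by (intro smooth_convex_decreasing_mult smooth_convex_decreasing_compose_powr[OF 5(3) \<delta> \<alpha>]
            smooth_convex_decreasing_powr smooth_convex_decreasing_cutoff) auto
      from third_difference_nonneg_smooth[OF this]
      have "third_difference_nonneg (\<lambda>k. \<delta> powr \<rho> * ((lambda_fun \<rho> \<gamma> h (\<delta> * real k powr \<alpha>) * real k powr (\<alpha> * \<rho> - r)) * cutoff M (real k)))"
        unfolding third_difference_nonneg_def
        by (auto simp: mult.left_commute[of 2] distrib_left[symmetric] right_diff_distrib[symmetric] mult_left_mono simp del: of_nat_Suc)
      moreover have "\<delta> powr \<rho> * ((lambda_fun \<rho> \<gamma> h (\<delta> * real (Suc k) powr \<alpha>) * real (Suc k) powr (\<alpha> * \<rho> - r)) * cutoff M (real (Suc k))) = b M (Suc k)" for k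
        using bF[of k 0 M] by (simp add: F_def mult.assoc del: of_nat_Suc)
      ultimately have third: "third_difference_nonneg (b M)"
        unfolding third_difference_nonneg_def by (simp del: of_nat_Suc)
      have "sign_matched c n (kernel_sum c (b M) (Suc M))"
        by (rule sign_matched_convex[of n "b M" "Suc M", OF n conv fin' third]) (use 5 in auto)
      then show ?thesis by (simp add: KS)
    qed
  qed
  define V where "V = (LINT t|circle. kernel c a t * square_wave c n t)"
  define u where "u k = (1 - (1 + real (2 * k + 1) powr \<alpha> * real n powr \<alpha> * \<delta> * \<gamma>)
                      * h (real (2 * k + 1) powr \<alpha> * real n powr \<alpha> * \<delta>))
                / real (2 * k + 1) powr (r + 1) * (if c then (-1) ^ k else 1)" for k
  have E: "approx_error p (W_class p n r \<beta>) (\<lambda>f. convol f g) = ereal (V / (2 * pi))"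
    unfolding V_def
    by (rule approx_error_eq_square_wave_integral[OF p n r0 g.periodic_integrable_axioms phase \<sigma> fgl _ dc C db ba lim fin sm])
       (simp add: a_def)
  have summand: "(if c then (-1) ^ i else 1) * (8 * a ((2 * i + 1) * n) / real (2 * i + 1)) = 8 * real n powr - r * u i" for i
  proof -
    define m where "m = 2 * i + 1"
    have m: "real m > 0" by (simp add: m_def)
    have "real (m * n) powr \<alpha> = real m powr \<alpha> * real n powr \<alpha>" "real (m * n) powr - r = real m powr - r * real n powr - r"
      by (simp_all add: powr_mult)
    then have "a (m * n) / real m = (1 - (1 + real m powr \<alpha> * real n powr \<alpha> * \<delta> * \<gamma>) * h (real m powr \<alpha> * real n powr \<alpha> * \<delta>)) * (real m powr - r / real m) * real n powr - r"
      by (simp add: a_def l_def)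
    also have "real m powr - r / real m = 1 / real m powr (r + 1)"
      using m by (simp add: powr_add powr_minus divide_inverse)
    finally have am: "a (m * n) / real m = (1 - (1 + real m powr \<alpha> * real n powr \<alpha> * \<delta> * \<gamma>) * h (real m powr \<alpha> * real n powr \<alpha> * \<delta>)) * (1 / real m powr (r + 1)) * real n powr - r" .
    have alg: "s * (8 * x / y) = 8 * R * (X / P * s)" if "x / y = X * (1 / P) * R" for s x y X P R :: real
    proof -
      have "s * (8 * x / y) = 8 * s * (x / y)" by simp
      then show ?thesis unfolding that by simp
    qed
    show ?thesis unfolding u_def m_def[symmetric] by (rule alg[OF am])
  qed
  have "(\<lambda>i. 8 * real n powr - r * u i) sums V"
    using integral_kernel_square_wave[OF dc r0 C n, of c] unfolding summand V_def .
  then have "(\<lambda>i. inverse (8 * real n powr - r) * (8 * real n powr - r * u i)) sums (inverse (8 * real n powr - r) * V)"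
    by (rule sums_mult)
  then have "u sums (inverse (8 * real n powr - r) * V)" using n by (simp add: mult.assoc[symmetric])
  then have "suminf u = inverse (8 * real n powr - r) * V" by (rule sums_unique[symmetric])
  then have "V / (2 * pi) = 4 / (pi * real n powr r) * suminf u"
    using n by (simp add: powr_minus field_simps)
  then show ?thesis unfolding E u_def[abs_def] by simp
qed

theorem mainTheorem4:
  fixes h g :: "real \<Rightarrow> real" and \<rho> \<gamma> \<alpha> \<delta> r :: real
    and p :: ereal and n :: nat and \<beta> :: int
  assumes "h \<in> M_class 2"
    and "\<exists>L. (h \<longlongrightarrow> L) (at_right 0) \<and> 0 < L \<and> L \<le> 1"
    and "(h \<longlongrightarrow> 0) at_top"
    and "\<rho> \<ge> 1" and "ereal \<gamma> \<le> gamma_sup 1 \<rho> h" and "\<alpha> > 0" and "\<delta> > 0"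
    and "g \<in> Lp_space 1"
    and "is_fourier_series_of
           (\<lambda>k. complex_of_real ((1 + real_of_int \<bar>k\<bar> powr \<alpha> * \<delta> * \<gamma>)
                                  * h (real_of_int \<bar>k\<bar> powr \<alpha> * \<delta>))) g"
    and "p = 1 \<or> p = \<infinity>"
  shows
    "(odd \<beta> \<and>
        ((n \<ge> 1 \<and> \<alpha> \<le> 1 \<and> r \<ge> \<alpha> * \<rho>) \<or> (n = 1 \<and> \<alpha> > 1 \<and> r \<ge> \<alpha> * \<rho> + 1)) \<longrightarrow>
      approx_error p (W_class p n r (real_of_int \<beta>)) (\<lambda>f. convol f g) =
        ereal (4 / (pi * real n powr r) *
          (\<Sum>k. (1 - (1 + real (2 * k + 1) powr \<alpha> * real n powr \<alpha> * \<delta> * \<gamma>)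
                      * h (real (2 * k + 1) powr \<alpha> * real n powr \<alpha> * \<delta>))
                / real (2 * k + 1) powr (r + 1))))
   \<and> (even \<beta> \<and>
        ((n = 1 \<and> \<alpha> \<le> 1 \<and> r \<ge> \<alpha> * \<rho> + 1) \<or> (n = 1 \<and> \<alpha> > 1 \<and> r \<ge> \<alpha> * \<rho> + 2) \<or>
         (h \<in> M_class 3 \<and> ereal \<gamma> \<le> gamma_sup 2 \<rho> h \<and> \<alpha> \<le> 1 \<and> n \<ge> 1 \<and> r \<ge> \<alpha> * \<rho>)) \<longrightarrow>
      approx_error p (W_class p n r (real_of_int \<beta>)) (\<lambda>f. convol f g) =
        ereal (4 / (pi * real n powr r) *
          (\<Sum>k. (1 - (1 + real (2 * k + 1) powr \<alpha> * real n powr \<alpha> * \<delta> * \<gamma>)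
                      * h (real (2 * k + 1) powr \<alpha> * real n powr \<alpha> * \<delta>))
                / real (2 * k + 1) powr (r + 1) * (-1) ^ k)))"
proof -
  have p: "p = 1 \<or> p = \<infinity>" by fact
  have \<lambda>: "convex_decreasing (lambda_fun \<rho> \<gamma> h)"
    by (rule convex_decreasing_lambda[OF assms(1,4,5)])
  note series = approx_error_eq_series[OF p _ \<lambda> assms(4,6,7,8,9)]
  have sin_int: "sin (of_int q * pi) = 0" and cos_int: "cos (of_int q * pi) = 1 \<or> cos (of_int q * pi) = - 1" for q :: int
    using sin_npi_int[of q] cos_npi_int[of q] by (auto simp: mult.commute)
  show ?thesis
  proof (intro conjI impI)
    assume A: "odd \<beta> \<and> ((n \<ge> 1 \<and> \<alpha> \<le> 1 \<and> r \<ge> \<alpha> * \<rho>) \<or> (n = 1 \<and> \<alpha> > 1 \<and> r \<ge> \<alpha> * \<rho> + 1))"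
    then obtain q where q: "\<beta> = 2 * q + 1" by (auto elim: oddE)
    \<comment> \<open>With \<open>\<beta> = 2 * q + 1\<close> the phase is a shift by
      \<open>q * pi\<close> and a quarter turn, so the cosine becomes a sine with sign
      \<open>cos (q * pi)\<close>.\<close>
    have phase: "cos (x - real_of_int \<beta> * pi / 2) = cos (of_int q * pi) * (if False then cos x else sin x)" for x
    proof -
      have "x - real_of_int \<beta> * pi / 2 = (x - of_int q * pi) - pi / 2" by (simp add: q field_simps)
      then show ?thesis by (simp only: cos_diff sin_diff) (simp add: sin_int mult.commute)
    qed
    have n: "n \<ge> 1" and d: "\<alpha> \<le> 1 \<and> r \<ge> \<alpha> * \<rho> \<or> n = 1 \<and> r \<ge> \<alpha> * \<rho> + 1" using A by auto
    show "approx_error p (W_class p n r (real_of_int \<beta>)) (\<lambda>f. convol f g) =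
        ereal (4 / (pi * real n powr r) *
          (\<Sum>k. (1 - (1 + real (2 * k + 1) powr \<alpha> * real n powr \<alpha> * \<delta> * \<gamma>)
                      * h (real (2 * k + 1) powr \<alpha> * real n powr \<alpha> * \<delta>))
                / real (2 * k + 1) powr (r + 1)))"
      using series[OF n phase cos_int] d by simp
  next
    assume A: "even \<beta> \<and>
        ((n = 1 \<and> \<alpha> \<le> 1 \<and> r \<ge> \<alpha> * \<rho> + 1) \<or> (n = 1 \<and> \<alpha> > 1 \<and> r \<ge> \<alpha> * \<rho> + 2) \<or>
         (h \<in> M_class 3 \<and> ereal \<gamma> \<le> gamma_sup 2 \<rho> h \<and> \<alpha> \<le> 1 \<and> n \<ge> 1 \<and> r \<ge> \<alpha> * \<rho>))"
    then obtain q where q: "\<beta> = 2 * q" by (auto elim: evenE)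
    have phase: "cos (x - real_of_int \<beta> * pi / 2) = cos (of_int q * pi) * (if True then cos x else sin x)" for x
      by (simp add: q cos_diff sin_int mult.commute)
    have n: "n \<ge> 1" using A by auto
    \<comment> \<open>The bound by \<open>gamma_sup 2\<close> is converted into smooth convexity of
      \<open>lambda_fun\<close>, the form in which the last alternative expects it.\<close>
    have "True \<and> n = 1 \<and> \<alpha> \<le> 1 \<and> r \<ge> \<alpha> * \<rho> + 1 \<or> True \<and> n = 1 \<and> r \<ge> \<alpha> * \<rho> + 2 \<or>
      True \<and> \<alpha> \<le> 1 \<and> r \<ge> \<alpha> * \<rho> \<and> smooth_convex_decreasing (lambda_fun \<rho> \<gamma> h)"
      using A smooth_convex_decreasing_lambda[OF assms(1,4,5)] by blast
    then show "approx_error p (W_class p n r (real_of_int \<beta>)) (\<lambda>f. convol f g) =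
        ereal (4 / (pi * real n powr r) *
          (\<Sum>k. (1 - (1 + real (2 * k + 1) powr \<alpha> * real n powr \<alpha> * \<delta> * \<gamma>)
                      * h (real (2 * k + 1) powr \<alpha> * real n powr \<alpha> * \<delta>))
                / real (2 * k + 1) powr (r + 1) * (-1) ^ k))"
      using series[OF n phase cos_int] by simp
  qed
qed

end
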